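(* Let $N$ be a positive integer and let $\lambda_j,\mu_j>0$ for $j=1,\dots,N$. For any $P_1,\dots,P_N\in\mathbb{N}$ and any $\beta\ge0$, there exist numbers $\varepsilon_0>0$ and $C>0$, depending only on $\lambda_1,\dots,\lambda_N$, $\mu_1,\dots,\mu_N$, $P_1,\dots,P_N$ and $\beta$, such that, if $\beta_{ij}=\beta_{ji}\in[-\varepsilon_0,\beta]$ for all $i,j=1,\dots,N$ with $i\ne j$, then every solution $U=(u_1,\dots,u_N)$ of $$-\Delta u_j+\lambda_j u_j=\mu_j u_j^3+\sum_{i\neq j}\beta_{ij}u_i^2u_j\ \text{ in } B_1,\qquad u_j\in H^1_{0,r}(B_1),\qquad j=1,\dots,N,$$ such that $u_j$ changes its sign exactly $P_j$ times for each $j=1,\dots,N$, satisfies $|U|_\infty\le C$.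
   Context: $B_1$ is the open unit ball of $\mathbb{R}^3$ centred at the origin, and $H^1_{0,r}(B_1)$ is the subspace of radial functions of $H^1_0(B_1)$. Solutions are weak solutions (these are continuous on $\overline{B_1}$ and classical by elliptic regularity). $|U|_\infty=\max_{j}\|u_j\|_{L^\infty(B_1)}$. $\mathbb{N}=\{0,1,2,\dots\}$. For a continuous radial function $u$, the number of sign changes (number of nodes) $n(u)$ is the largest integer $k\ge 0$ for which there are radii $0<x_0<x_1<\dots<x_k$ in the domain with $u|_{|x|=x_j}\cdot u|_{|x|=x_{j+1}}<0$ for $j=0,\dots,k-1$; "$u$ changes its sign exactly $P$ times" means $n(u)=P$. *)

theory Defs
  imports "HOL-Analysis.Analysis" "HOL-Probability.Essential_Supremum"
begin

text \<open>Test functions: real-valued, infinitely differentiable, compactly supported in \<open>\<Omega>\<close>.\<close>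

definition partial_deriv :: "'a::euclidean_space \<Rightarrow> ('a \<Rightarrow> real) \<Rightarrow> 'a \<Rightarrow> real" where
  "partial_deriv b f x = frechet_derivative f (at x) b"

fun Ck :: "nat \<Rightarrow> ('a::euclidean_space \<Rightarrow> real) \<Rightarrow> bool" where
  "Ck 0 f \<longleftrightarrow> continuous_on UNIV f"
| "Ck (Suc k) f \<longleftrightarrow> (\<forall>x. f differentiable (at x)) \<and> (\<forall>b\<in>Basis. Ck k (partial_deriv b f))"

definition test_function :: "'a::euclidean_space set \<Rightarrow> ('a \<Rightarrow> real) \<Rightarrow> bool" where
  "test_function \<Omega> \<phi> \<longleftrightarrow>
     (\<forall>k. Ck k \<phi>) \<and> (\<exists>K. compact K \<and> K \<subseteq> \<Omega> \<and> (\<forall>x. x \<notin> K \<longrightarrow> \<phi> x = 0))"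

definition classical_grad :: "('a::euclidean_space \<Rightarrow> real) \<Rightarrow> 'a \<Rightarrow> 'a" where
  "classical_grad f x = (\<Sum>b\<in>Basis. partial_deriv b f x *\<^sub>R b)"

text \<open>Elements of the Lebesgue and Sobolev spaces are represented by functions on the whole
  space; only their values almost everywhere on \<open>\<Omega>\<close> matter.\<close>

definition square_integrable ::
  "'a::euclidean_space set \<Rightarrow> ('a \<Rightarrow> 'b::euclidean_space) \<Rightarrow> bool" where
  "square_integrable \<Omega> f \<longleftrightarrow> f \<in> borel_measurable (lebesgue_on \<Omega>) \<and>
     integrable (lebesgue_on \<Omega>) (\<lambda>x. (norm (f x))\<^sup>2)"

definition is_weak_grad ::
  "'a::euclidean_space set \<Rightarrow> ('a \<Rightarrow> real) \<Rightarrow> ('a \<Rightarrow> 'a) \<Rightarrow> bool" where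
  "is_weak_grad \<Omega> u g \<longleftrightarrow> (\<forall>\<phi>. test_function \<Omega> \<phi> \<longrightarrow> (\<forall>b\<in>Basis.
     (LINT x|lebesgue_on \<Omega>. u x * partial_deriv b \<phi> x)
       = - (LINT x|lebesgue_on \<Omega>. (g x \<bullet> b) * \<phi> x)))"

definition H1 :: "'a::euclidean_space set \<Rightarrow> ('a \<Rightarrow> real) set" where
  "H1 \<Omega> = {u. square_integrable \<Omega> u \<and> (\<exists>g. square_integrable \<Omega> g \<and> is_weak_grad \<Omega> u g)}"

text \<open>For \<open>u \<in> H1 \<Omega>\<close> with \<open>\<Omega>\<close> open, the weak gradient is determined almost everywhere, so the
  choice below is immaterial inside integrals.\<close>

definition weak_grad :: "'a::euclidean_space set \<Rightarrow> ('a \<Rightarrow> real) \<Rightarrow> 'a \<Rightarrow> 'a" where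
  "weak_grad \<Omega> u = (SOME g. square_integrable \<Omega> g \<and> is_weak_grad \<Omega> u g)"

definition H1_norm :: "'a::euclidean_space set \<Rightarrow> ('a \<Rightarrow> real) \<Rightarrow> real" where
  "H1_norm \<Omega> u = sqrt ((LINT x|lebesgue_on \<Omega>. (u x)\<^sup>2)
     + (LINT x|lebesgue_on \<Omega>. (norm (weak_grad \<Omega> u x))\<^sup>2))"

definition H1_0 :: "'a::euclidean_space set \<Rightarrow> ('a \<Rightarrow> real) set" where
  "H1_0 \<Omega> = {u \<in> H1 \<Omega>. \<exists>\<phi>. (\<forall>n::nat. test_function \<Omega> (\<phi> n)) \<and>
     (\<lambda>n. H1_norm \<Omega> (\<lambda>x. \<phi> n x - u x)) \<longlonglongrightarrow> 0}"

abbreviation B1 :: "(real^3) set" where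
  "B1 \<equiv> ball 0 1"

definition H1_0_radial :: "(real^3 \<Rightarrow> real) set" where
  "H1_0_radial = {u \<in> H1_0 B1. \<exists>f. AE x in lebesgue_on B1. u x = f (norm x)}"

definition Linf_norm :: "(real^3 \<Rightarrow> real) \<Rightarrow> ereal" where
  "Linf_norm u = esssup (lebesgue_on B1) (\<lambda>x. ereal \<bar>u x\<bar>)"

text \<open>The components \<open>u\<^sub>1, \<dots>, u\<^sub>N\<close> are indexed by \<open>{1..N}\<close>; the remaining values of the
  index-dependent data are not used. All integrands below are integrable by the Sobolev embedding
  of \<open>H1_0 B1\<close> into the Lebesgue space with exponent 6.\<close>

definition weak_solution ::
  "nat \<Rightarrow> (nat \<Rightarrow> real) \<Rightarrow> (nat \<Rightarrow> real) \<Rightarrow> (nat \<Rightarrow> nat \<Rightarrow> real) \<Rightarrow> (nat \<Rightarrow> real^3 \<Rightarrow> real) \<Rightarrow> bool" where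
  "weak_solution N lam mu b u \<longleftrightarrow> (\<forall>j\<in>{1..N}. u j \<in> H1_0_radial \<and>
     (\<forall>\<phi>. test_function B1 \<phi> \<longrightarrow>
        (LINT x|lebesgue_on B1. weak_grad B1 (u j) x \<bullet> classical_grad \<phi> x + lam j * u j x * \<phi> x)
        = (LINT x|lebesgue_on B1.
             (mu j * (u j x)^3 + (\<Sum>i\<in>{1..N} - {j}. b i j * (u i x)\<^sup>2 * u j x)) * \<phi> x)))"

definition alternates :: "(real^3 \<Rightarrow> real) \<Rightarrow> nat \<Rightarrow> bool" where
  "alternates w k \<longleftrightarrow> (\<exists>r::nat \<Rightarrow> real. 0 < r 0 \<and> (\<forall>j<k. r j < r (Suc j)) \<and> r k < 1 \<and>
     (\<forall>j<k. \<forall>x y. norm x = r j \<longrightarrow> norm y = r (Suc j) \<longrightarrow> w x * w y < 0))"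

text \<open>The number of nodes is a property of the continuous representative, which is unique and
  radial on \<open>B1\<close> whenever \<open>u\<close> is radial almost everywhere.\<close>

definition changes_sign_exactly :: "(real^3 \<Rightarrow> real) \<Rightarrow> nat \<Rightarrow> bool" where
  "changes_sign_exactly u P \<longleftrightarrow>
     (\<exists>w. continuous_on B1 w \<and> (AE x in lebesgue_on B1. w x = u x) \<and>
        alternates w P \<and> (\<forall>k. alternates w k \<longrightarrow> k \<le> P))"

end

theory Submission
  imports Defs
begin

text \<open>
  A large solution is compared with its own blow-up. Let \<open>W\<^sub>j\<close> be the radial profile of the
  continuous representative of \<open>u\<^sub>j\<close>. The function \<open>v\<^sub>j r = r * W\<^sub>j r\<close> solves \<open>v\<^sub>j'' = - Q\<^sub>j v\<^sub>j\<close> on the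
  unit interval, where \<open>Q\<^sub>j = \<mu>\<^sub>j W\<^sub>j\<^sup>2 + (\<Sum>i. b\<^sub>i\<^sub>j W\<^sub>i\<^sup>2) - \<lambda>\<^sub>j\<close>. Fix \<open>\<rho> < 1\<close> and suppose that the joint
  maximum \<open>M\<close> of all \<open>\<bar>W\<^sub>i\<bar>\<close> on \<open>{0..\<rho>}\<close> is large and is attained by the component \<open>m\<close>. In the length
  scale \<open>1 / M\<close> the function \<open>f s = v\<^sub>m (s / M)\<close> satisfies \<open>f'' = - q f\<close>, \<open>\<bar>f s\<bar> \<le> s\<close> and
  \<open>\<mu> f\<^sup>2 / s\<^sup>2 - \<delta> \<le> q\<close> with \<open>\<bar>q\<bar> \<le> K\<close>. The error \<open>\<delta>\<close> collects \<open>\<lambda>\<^sub>m / M\<^sup>2\<close> and the negative part of the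
  couplings, so it is small if \<open>M\<close> is large and the couplings are at least \<open>-\<epsilon>\<^sub>0\<close>. The other
  components survive only in the constants \<open>K\<close> and \<open>\<delta>\<close>: what remains is a statement about one scalar
  function.

  For \<open>\<delta> = 0\<close> the profile \<open>w = f / s\<close> is a radial function with \<open>- \<Delta>w \<ge> \<mu> w\<^sup>3\<close> wherever it is
  positive. In dimension three the exponent \<open>3 = n / (n - 2)\<close> is exactly the largest one for which
  such a function cannot stay positive up to infinity, so \<open>w\<close> has to oscillate for ever. The
  lemmas \<open>cubic_ode_sign_flip\<close> and \<open>cubic_ode_oscillates\<close> are a quantitative form of this fact that
  is stable under a small \<open>\<delta>\<close>: any number of sign changes is reached within a length that
  depends on the constants only.

  The oscillation needs room. If the point \<open>s\<^sub>0\<close> where \<open>\<bar>w\<bar>\<close> is almost maximal is bounded, one moves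
  outwards; the interval extends at least up to \<open>M / 2\<close>. If \<open>s\<^sub>0\<close> is large, one moves inwards: \<open>f / s\<^sub>0\<close>
  read backwards satisfies the same differential inequality, because \<open>1 / s\<^sup>2 \<ge> 1 / s\<^sub>0\<^sup>2\<close> there. Both cases
  together are \<open>large_profile_oscillates\<close>. For \<open>M\<close> above a constant, \<open>u\<^sub>m\<close> would have more than \<open>P\<^sub>m\<close>
  sign changes inside the ball, which proves the bound on every \<open>{0..\<rho>}\<close> and hence on the ball.

  The remaining part derives the ordinary differential equation from the weak formulation.
  For a smooth \<open>\<zeta>\<close> with compact support in the unit interval, \<open>\<zeta> \<bar>x\<bar> / \<bar>x\<bar>\<close> is a test function whose
  Laplacian is \<open>\<zeta>'' \<bar>x\<bar> / \<bar>x\<bar>\<close>. Polar coordinates turn the weak equation into the identity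
  \<open>v\<^sub>j'' = - Q\<^sub>j v\<^sub>j\<close> in the sense of distributions, and \<open>weak_second_derivative_is_classical\<close> (a second order
  du Bois-Reymond lemma) makes it classical because \<open>W\<^sub>j\<close> is continuous. At the origin, which these
  test functions do not see, the continuity of all profiles gives the missing regularity of \<open>v\<^sub>j'\<close>.
\<close>

section \<open>Sign changes forced by a cubic differential inequality\<close>

lemma derivative_comparison:
  fixes f g :: "real \<Rightarrow> real"
  assumes "x \<le> y"
    and "\<And>s. s \<in> {x..y} \<Longrightarrow> (f has_real_derivative f' s) (at s within {x..y})"
    and "\<And>s. s \<in> {x..y} \<Longrightarrow> (g has_real_derivative g' s) (at s within {x..y})"
    and "\<And>s. s \<in> {x..y} \<Longrightarrow> f' s \<le> g' s"
  shows "f y - f x \<le> g y - g x"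
proof (cases "x = y")
  case False
  then have "x < y" using assms(1) by simp
  have "((\<lambda>s. g s - f s) has_derivative (\<lambda>h. (g' s - f' s) * h)) (at s within {x..y})"
    if "x \<le> s" "s \<le> y" for s
    using DERIV_diff[OF assms(3) assms(2), of s] that by (simp add: has_field_derivative_def)
  then have "\<exists>z\<in>{x<..<y}. (g y - f y) - (g x - f x) = (g' z - f' z) * (y - x)"
    using mvt_simple[OF \<open>x < y\<close>, of "\<lambda>s. g s - f s" "\<lambda>s h. (g' s - f' s) * h"] by auto
  then obtain z where z: "z \<in> {x<..<y}" "(g y - f y) - (g x - f x) = (g' z - f' z) * (y - x)"
    by blast
  have "0 \<le> (g' z - f' z) * (y - x)" using assms(4)[of z] z(1) by simp
  with z(2) show ?thesis by linarith
qed simp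

text \<open>The first point of the compact set where \<open>f \<le> 0\<close>; before it \<open>f\<close> is positive, which is what
  the slope estimates on the way down need.\<close>

lemma first_zero:
  fixes f :: "real \<Rightarrow> real"
  assumes "continuous_on {x..y} f" "x \<le> y" "0 < f x" "f y \<le> 0"
  obtains z where "z \<in> {x..y}" "f z = 0" "\<And>s. s \<in> {x..z} \<Longrightarrow> 0 \<le> f s"
proof -
  define Z where "Z = {x..y} \<inter> f -` {..0}"
  have "compact Z" unfolding Z_def
    by (simp add: assms(1) compact_eq_bounded_closed continuous_on_closed_vimage bounded_Int
        continuous_closed_preimage)
  moreover have "y \<in> Z" using assms by (auto simp: Z_def)
  ultimately obtain z where z: "z \<in> Z" "\<And>t. t \<in> Z \<Longrightarrow> z \<le> t"
    using compact_attains_inf[of Z] by blast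
  have pos: "0 < f s" if "s \<in> {x..<z}" for s
  proof (rule ccontr)
    assume "\<not> 0 < f s"
    then have "s \<in> Z" using that z(1) by (auto simp: Z_def)
    then show False using z(2)[of s] that by auto
  qed
  have "f z = 0"
  proof -
    have "continuous_on {x..z} f" by (rule continuous_on_subset[OF assms(1)]) (use z in \<open>auto simp: Z_def\<close>)
    then obtain t where "x \<le> t" "t \<le> z" "f t = 0"
      using IVT2'[of f z 0 x] z(1) assms(3) by (auto simp: Z_def)
    with pos[of t] show ?thesis by (cases "t = z") auto
  qed
  then show thesis using that[of z] z(1) pos by (force simp: Z_def le_less)
qed

text \<open>A barrier argument: if \<open>f\<close> fell below \<open>c\<close>, its maximum up to that moment would be at least \<open>c\<close>
  and would not be the last point, but there \<open>f\<close> still increases to the right.\<close>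

lemma stays_above:
  fixes f :: "real \<Rightarrow> real"
  assumes der: "\<And>s. s \<in> {a..b} \<Longrightarrow> (f has_real_derivative f' s) (at s within {a..b})"
    and "c \<le> f a" and up: "\<And>s. s \<in> {a..b} \<Longrightarrow> c \<le> f s \<Longrightarrow> 0 < f' s"
    and t: "t \<in> {a..b}"
  shows "c \<le> f t"
proof (rule ccontr)
  assume less: "\<not> c \<le> f t"
  have "continuous_on {a..t} f"
    using t by (intro continuous_on_subset[of "{a..b}" f "{a..t}"])
      (auto intro!: DERIV_continuous_on der)
  then obtain m where m: "m \<in> {a..t}" "\<And>s. s \<in> {a..t} \<Longrightarrow> f s \<le> f m"
    using continuous_attains_sup[of "{a..t}" f] t by auto
  have "c \<le> f m" using m(2)[of a] assms(2) t by force
  then have "m < t" "m \<in> {a..b}" using less m(1) t by (auto simp: le_less)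
  then obtain d where d: "d > 0" "\<And>h. h > 0 \<Longrightarrow> m + h \<in> {a..b} \<Longrightarrow> h < d \<Longrightarrow> f m < f (m + h)"
    using has_real_derivative_pos_inc_right[OF der up] \<open>c \<le> f m\<close> by blast
  define h where "h = min (d/2) (t - m)"
  have "f m < f (m + h)" using d \<open>m < t\<close> m(1) t by (intro d(2)) (auto simp: h_def)
  moreover have "f (m + h) \<le> f m" using \<open>m < t\<close> d(1) m(1) by (intro m(2)) (auto simp: h_def)
  ultimately show False by simp
qed

text \<open>The rescaled radial equation on \<open>{a..L}\<close>. Here \<open>f s = s * w s\<close> for a radial profile \<open>w\<close> with \<open>\<bar>w\<bar> \<le> 1\<close>,
  which explains the bound \<open>\<bar>f s\<bar> \<le> s\<close> and the term \<open>\<mu> * (f s)\<^sup>2 / s\<^sup>2 = \<mu> * (w s)\<^sup>2\<close>; the substitution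
  \<open>f = s * w\<close> removes the first order term of the radial Laplacian in dimension three. Derivatives
  are taken within the interval so that the predicate passes to subintervals.\<close>

definition cubic_ode ::
  "real \<Rightarrow> real \<Rightarrow> real \<Rightarrow> real \<Rightarrow> real \<Rightarrow> (real \<Rightarrow> real) \<Rightarrow> (real \<Rightarrow> real) \<Rightarrow> (real \<Rightarrow> real) \<Rightarrow> bool" where
  "cubic_ode \<mu> K \<delta> a L f f' q \<longleftrightarrow> (\<forall>s\<in>{a..L}.
     (f has_real_derivative f' s) (at s within {a..L}) \<and>
     (f' has_real_derivative - (q s * f s)) (at s within {a..L}) \<and>
     \<bar>f s\<bar> \<le> s \<and> \<bar>q s\<bar> \<le> K \<and> \<mu> * (f s)\<^sup>2 / s\<^sup>2 - \<delta> \<le> q s)"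

lemma cubic_ode_subinterval:
  assumes "cubic_ode \<mu> K \<delta> a L f f' q" "a \<le> a'" "L' \<le> L" "\<delta> \<le> \<delta>'"
  shows "cubic_ode \<mu> K \<delta>' a' L' f f' q"
  unfolding cubic_ode_def
proof
  fix s assume s: "s \<in> {a'..L'}"
  have sub: "{a'..L'} \<subseteq> {a..L}" using assms by auto
  then have "s \<in> {a..L}" using s by blast
  note o = assms(1)[unfolded cubic_ode_def, rule_format, OF this]
  show "(f has_real_derivative f' s) (at s within {a'..L'}) \<and>
     (f' has_real_derivative - (q s * f s)) (at s within {a'..L'}) \<and>
     \<bar>f s\<bar> \<le> s \<and> \<bar>q s\<bar> \<le> K \<and> \<mu> * (f s)\<^sup>2 / s\<^sup>2 - \<delta>' \<le> q s"
    by (intro conjI DERIV_subset[OF conjunct1[OF o] sub] DERIV_subset[OF conjunct1[OF conjunct2[OF o]] sub])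
      (use o assms(4) in auto)
qed

lemma cubic_ode_uminus:
  assumes "cubic_ode \<mu> K \<delta> a L f f' q"
  shows "cubic_ode \<mu> K \<delta> a L (\<lambda>s. - f s) (\<lambda>s. - f' s) q"
  using assms unfolding cubic_ode_def by (auto intro!: derivative_eq_intros)

context
  fixes \<mu> K \<delta> a L :: real and f f' q :: "real \<Rightarrow> real"
  assumes ode: "cubic_ode \<mu> K \<delta> a L f f' q" and a: "0 < a" and K: "0 < K" and mu: "0 < \<mu>"
    and \<delta>: "0 < \<delta>"
begin

lemma ode_der:
  assumes "{x..y} \<subseteq> {a..L}" "s \<in> {x..y}"
  shows "(f has_real_derivative f' s) (at s within {x..y})"
    and "(f' has_real_derivative - (q s * f s)) (at s within {x..y})"
  using ode assms DERIV_subset unfolding cubic_ode_def by (meson subsetD)+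

lemma ode_cont: "continuous_on {a..L} f"
  by (rule DERIV_continuous_on) (auto intro: ode_der)

lemma ode_bounds:
  assumes "s \<in> {a..L}"
  shows "f s \<le> L" "\<bar>q s * f s\<bar> \<le> K * L"
proof -
  have b: "\<bar>f s\<bar> \<le> s" "\<bar>q s\<bar> \<le> K" "s \<le> L" using ode assms by (auto simp: cubic_ode_def)
  then show "f s \<le> L" by linarith
  show "\<bar>q s * f s\<bar> \<le> K * L" unfolding abs_mult by (rule mult_mono) (use b in auto)
qed

text \<open>Where \<open>f\<close> is at least \<open>c\<close> the cubic term bends the graph down; the price of the error \<open>\<delta>\<close> in
  \<open>q\<close> is at most \<open>\<delta> * L\<close>. With \<open>c = 0\<close> this says that a nonnegative \<open>f\<close> is almost concave.\<close>

lemma ode_concave: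
  assumes s: "s \<in> {a..L}" and f: "c \<le> f s" "0 \<le> c"
  shows "- (q s * f s) \<le> - (\<mu> * c ^ 3 / s\<^sup>2) + \<delta> * L"
proof -
  have s0: "0 < s" using s a by auto
  have q: "\<mu> * (f s)\<^sup>2 / s\<^sup>2 - \<delta> \<le> q s" using ode s by (auto simp: cubic_ode_def)
  have "(\<mu> * (f s)\<^sup>2 / s\<^sup>2 - \<delta>) * f s \<le> q s * f s" using q f by (intro mult_right_mono) auto
  moreover have "(\<mu> * (f s)\<^sup>2 / s\<^sup>2 - \<delta>) * f s = \<mu> * (f s) ^ 3 / s\<^sup>2 - \<delta> * f s"
    by (simp add: algebra_simps power2_eq_square power3_eq_cube)
  moreover have "\<mu> * c ^ 3 / s\<^sup>2 \<le> \<mu> * (f s) ^ 3 / s\<^sup>2"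
    using mu f by (intro divide_right_mono mult_left_mono power_mono) auto
  moreover have "\<delta> * f s \<le> \<delta> * L" using \<delta> ode_bounds(1)[OF s] by simp
  ultimately show ?thesis by linarith
qed

lemma ode_deriv_bound:
  assumes "x \<in> {a..L}" "s \<in> {x..L}"
  shows "\<bar>f' s - f' x\<bar> \<le> K * L * (s - x)"
proof -
  have sub: "{x..s} \<subseteq> {a..L}" using assms by auto
  have b: "- (K * L) \<le> - (q t * f t)" "- (q t * f t) \<le> K * L" if "t \<in> {x..s}" for t
    using ode_bounds(2)[of t] that sub by (auto simp: abs_le_iff)
  have "f' s - f' x \<le> K * L * s - K * L * x"
    by (rule derivative_comparison[where f' = "\<lambda>t. - (q t * f t)" and g' = "\<lambda>t. K * L"])
      (use assms sub b in \<open>auto intro!: ode_der derivative_eq_intros\<close>)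
  moreover have "(\<lambda>t. - (K * L) * t) s - - (K * L) * x \<le> f' s - f' x"
    by (rule derivative_comparison[where g' = "\<lambda>t. - (q t * f t)" and f' = "\<lambda>t. - (K * L)"])
      (use assms sub b in \<open>auto intro!: ode_der derivative_eq_intros\<close>)
  ultimately show ?thesis by (simp add: algebra_simps abs_le_iff)
qed

text \<open>A solution that starts above \<open>c\<close> cannot increase for ever. If it did, then somewhere
  \<open>f' < \<mu> f\<^sup>3 / (2 s)\<close>: otherwise \<open>(- 1 / f\<^sup>2)' \<ge> \<mu> / s\<close>, and \<open>1 / f\<^sup>2\<close> would become negative because the integral
  of \<open>1 / s\<close> diverges (this is where the exponent is critical). From such a point \<open>s\<^sub>1\<close> on, the
  integral of \<open>\<mu> f\<^sup>3 / s\<^sup>2\<close> over \<open>{s\<^sub>1..4 * s\<^sub>1}\<close> is at least \<open>3/4 * \<mu> f(s\<^sub>1)\<^sup>3 / s\<^sub>1\<close>, which is more than the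
  remaining slope.\<close>

lemma ode_turns:
  assumes c: "0 < c" "c \<le> f a" and S1: "a \<le> S1" "1 / (\<mu> * c\<^sup>2) \<le> ln (S1 / a)" "4 * S1 \<le> L"
    and small: "12 * \<delta> * S1 * L\<^sup>2 \<le> \<mu> * c ^ 3"
  obtains s where "s \<in> {a..4 * S1}" "c \<le> f s" "f' s \<le> 0"
proof (rule ccontr)
  assume "\<not> thesis"
  then have up: "0 < f' s" if "s \<in> {a..4 * S1}" "c \<le> f s" for s
    using that \<open>\<And>s. s \<in> {a..4 * S1} \<Longrightarrow> c \<le> f s \<Longrightarrow> f' s \<le> 0 \<Longrightarrow> thesis\<close> by force
  have sub: "{a..4 * S1} \<subseteq> {a..L}" using S1 by auto
  have fc: "c \<le> f s" if "s \<in> {a..4 * S1}" for s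
    by (rule stays_above[OF ode_der(1)[OF sub] c(2) up that]) auto
  have pos: "0 < f' s" if "s \<in> {a..4 * S1}" for s using up fc that by blast
  have "\<exists>s1\<in>{a..S1}. f' s1 < \<mu> * (f s1) ^ 3 / (2 * s1)"
  proof (rule ccontr)
    assume "\<not> ?thesis"
    then have ge: "\<mu> * (f s) ^ 3 / (2 * s) \<le> f' s" if "s \<in> {a..S1}" for s using that by force
    have "- (1 / (f S1)\<^sup>2) - - (1 / (f a)\<^sup>2) \<ge> \<mu> * ln S1 - \<mu> * ln a"
    proof (rule derivative_comparison[where f' = "\<lambda>s. \<mu> / s" and g' = "\<lambda>s. 2 * f' s / (f s) ^ 3"])
      fix s assume s: "s \<in> {a..S1}"
      then have s0: "0 < s" and f0: "0 < f s" using a fc[of s] c S1 by auto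
      show "((\<lambda>s. \<mu> * ln s) has_real_derivative \<mu> / s) (at s within {a..S1})"
        using s0 by (auto intro!: derivative_eq_intros)
      have "(f has_real_derivative f' s) (at s within {a..S1})"
        by (rule ode_der) (use s S1 a in auto)
      then show "((\<lambda>s. - (1 / (f s)\<^sup>2)) has_real_derivative 2 * f' s / (f s) ^ 3) (at s within {a..S1})"
        using f0 by (auto intro!: derivative_eq_intros simp: field_simps power2_eq_square power3_eq_cube)
      have "\<mu> / s = 2 * (\<mu> * (f s) ^ 3 / (2 * s)) / (f s) ^ 3" using f0 s0 by (simp add: field_simps)
      also have "\<dots> \<le> 2 * f' s / (f s) ^ 3"
        using ge[OF s] f0 by (intro divide_right_mono mult_left_mono) auto
      finally show "\<mu> / s \<le> 2 * f' s / (f s) ^ 3" .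
    qed (use S1 in auto)
    moreover have "\<mu> * ln S1 - \<mu> * ln a = \<mu> * ln (S1 / a)"
      using a S1 by (subst ln_div) (auto simp: algebra_simps)
    moreover have "\<mu> * ln (S1 / a) \<ge> 1 / c\<^sup>2"
      using mult_left_mono[OF S1(2), of \<mu>] mu by simp
    moreover have "1 / (f a)\<^sup>2 \<le> 1 / c\<^sup>2"
      using c by (intro divide_left_mono power_mono) auto
    moreover have "0 < 1 / (f S1)\<^sup>2" using fc[of S1] c S1 a by auto
    ultimately show False by linarith
  qed
  then obtain s1 where s1: "s1 \<in> {a..S1}" "f' s1 < \<mu> * (f s1) ^ 3 / (2 * s1)" by blast
  have sub1: "{s1..4 * s1} \<subseteq> {a..4 * S1}" using s1 by auto
  have s10: "0 < s1" using s1 a by auto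
  have mono: "f s1 \<le> f s" if "s \<in> {s1..4 * s1}" for s
  proof -
    have "(\<lambda>_. 0::real) s - 0 \<le> f s - f s1"
      by (rule derivative_comparison[where f' = "\<lambda>_. 0" and g' = f'])
        (use that sub1 sub in \<open>auto intro!: ode_der less_imp_le[OF pos]\<close>)
    then show ?thesis by simp
  qed
  have f1: "c \<le> f s1" using fc sub1 s10 by auto
  have "f' (4 * s1) - f' s1 \<le> (\<mu> * (f s1) ^ 3 / (4 * s1) + \<delta> * L * (4 * s1)) - (\<mu> * (f s1) ^ 3 / s1 + \<delta> * L * s1)"
  proof (rule derivative_comparison[where f' = "\<lambda>t. - (q t * f t)"
        and g' = "\<lambda>t. - (\<mu> * (f s1) ^ 3 / t\<^sup>2) + \<delta> * L"])
    fix s assume s: "s \<in> {s1..4 * s1}"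
    then show "(f' has_real_derivative - (q s * f s)) (at s within {s1..4 * s1})"
      by (intro ode_der) (use sub1 sub in auto)
    have "s > 0" using s s10 by auto
    then show "((\<lambda>s. \<mu> * (f s1) ^ 3 / s + \<delta> * L * s) has_real_derivative
        - (\<mu> * (f s1) ^ 3 / s\<^sup>2) + \<delta> * L) (at s within {s1..4 * s1})"
      by (auto intro!: derivative_eq_intros simp: power2_eq_square)
    show "- (q s * f s) \<le> - (\<mu> * (f s1) ^ 3 / s\<^sup>2) + \<delta> * L"
      by (rule ode_concave) (use s sub1 sub mono f1 c in auto)
  qed (use s10 in auto)
  moreover have "\<mu> * (f s1) ^ 3 / (4 * s1) - \<mu> * (f s1) ^ 3 / s1 + \<mu> * (f s1) ^ 3 / (2 * s1)
      = - (\<mu> * (f s1) ^ 3 / (4 * s1))" using s10 by (simp add: field_simps)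
  ultimately have neg: "f' (4 * s1) < - (\<mu> * (f s1) ^ 3 / (4 * s1)) + 3 * \<delta> * L * s1"
    using s1(2) by (simp add: algebra_simps)
  have "\<mu> * c ^ 3 / (4 * S1) \<le> \<mu> * (f s1) ^ 3 / (4 * s1)"
    using mu f1 c s1 s10 by (intro frac_le mult_left_mono power_mono) auto
  moreover have "3 * \<delta> * L * s1 \<le> \<mu> * c ^ 3 / (4 * S1)"
  proof -
    have S0: "0 < S1" using s1 s10 by auto
    have "3 * \<delta> * L * s1 \<le> 3 * \<delta> * L * L"
      using \<delta> s1 S1 s10 by (intro mult_left_mono) auto
    then have "(3 * \<delta> * L * s1) * (4 * S1) \<le> 3 * \<delta> * L * L * (4 * S1)"
      using S0 by (intro mult_right_mono) auto
    also have "\<dots> \<le> \<mu> * c ^ 3" using small by (simp add: power2_eq_square mult_ac)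
    finally show ?thesis using S0 by (simp add: pos_le_divide_eq)
  qed
  ultimately have "f' (4 * s1) < 0" using neg by linarith
  moreover have "0 < f' (4 * s1)" using pos[of "4 * s1"] sub1 s10 by auto
  ultimately show False by simp
qed

text \<open>After the turning point \<open>f\<close> stays above \<open>c / 2\<close> for a time \<open>h\<close> since its slope is bounded, and
  during that time the cubic term makes the slope definitely negative.\<close>

lemma ode_descends:
  assumes s2: "s2 \<in> {a..S2}" "S2 + 1 \<le> L" "f' s2 \<le> 0" "c \<le> f s2" "0 < c"
    and D: "\<And>s. s \<in> {a..S2 + 1} \<Longrightarrow> \<bar>f' s\<bar> \<le> D1"
    and h: "0 < h" "h \<le> 1" "h * D1 \<le> c / 2"
  defines "s3 \<equiv> s2 + h"
  shows "f' s3 \<le> - (h * \<mu> * c ^ 3 / (8 * (S2 + 1)\<^sup>2)) + \<delta> * L" "c / 2 \<le> f s3"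
proof -
  have sub: "{s2..s3} \<subseteq> {a..L}" "{s2..s3} \<subseteq> {a..S2+1}" using s2 h by (auto simp: s3_def)
  have D1: "- D1 \<le> f' t" if "t \<in> {s2..s3}" for t
    using D[of t] that sub(2) by (auto simp: abs_le_iff)
  have half: "c / 2 \<le> f s" if s: "s \<in> {s2..s3}" for s
  proof -
    have "- D1 * s - - D1 * s2 \<le> f s - f s2"
      by (rule derivative_comparison[where f' = "\<lambda>_. - D1" and g' = f'])
        (use s sub D1 in \<open>auto intro!: ode_der derivative_eq_intros\<close>)
    moreover have "D1 * (s - s2) \<le> h * D1"
    proof -
      have "0 \<le> D1" using D[of s2] s2 by force
      then have "D1 * (s - s2) \<le> D1 * h" using s by (intro mult_left_mono) (auto simp: s3_def)
      then show ?thesis by (simp add: mult.commute)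
    qed
    ultimately show ?thesis using s2 h by (simp add: algebra_simps)
  qed
  show "c / 2 \<le> f s3" using half h by (auto simp: s3_def)
  define m where "m = - (\<mu> * (c/2) ^ 3 / (S2 + 1)\<^sup>2) + \<delta> * L"
  have "f' s3 - f' s2 \<le> m * s3 - m * s2"
  proof (rule derivative_comparison[where f' = "\<lambda>t. - (q t * f t)" and g' = "\<lambda>_. m"])
    fix s assume s: "s \<in> {s2..s3}"
    then show "(f' has_real_derivative - (q s * f s)) (at s within {s2..s3})"
      by (intro ode_der) (use sub in auto)
    show "((*) m has_real_derivative m) (at s within {s2..s3})"
      by (auto intro!: derivative_eq_intros)
    have s': "s \<in> {a..S2+1}" "s \<in> {a..L}" using s sub by blast+
    have "- (q s * f s) \<le> - (\<mu> * (c/2) ^ 3 / s\<^sup>2) + \<delta> * L"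
      by (rule ode_concave) (use s' half[OF s] s2 in auto)
    moreover have "\<mu> * (c/2) ^ 3 / (S2 + 1)\<^sup>2 \<le> \<mu> * (c/2) ^ 3 / s\<^sup>2"
      using mu s' s2 a by (intro divide_left_mono power_mono mult_pos_pos) auto
    ultimately show "- (q s * f s) \<le> m" by (simp add: m_def)
  qed (use h in \<open>auto simp: s3_def\<close>)
  then have "f' s3 \<le> m * h" using s2 by (simp add: s3_def algebra_simps)
  also have "m * h \<le> - (h * \<mu> * c ^ 3 / (8 * (S2 + 1)\<^sup>2)) + \<delta> * L"
  proof -
    have "\<delta> * L * h \<le> \<delta> * L * 1" using \<delta> s2 h a by (intro mult_left_mono) auto
    moreover have "\<mu> * (c/2) ^ 3 / (S2 + 1)\<^sup>2 * h = h * \<mu> * c ^ 3 / (8 * (S2 + 1)\<^sup>2)"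
      by (simp add: power_divide)
    ultimately show ?thesis unfolding m_def by (simp add: algebra_simps)
  qed
  finally show "f' s3 \<le> - (h * \<mu> * c ^ 3 / (8 * (S2 + 1)\<^sup>2)) + \<delta> * L" .
qed

text \<open>A solution with slope near \<open>- 2 * b\<close> or below is almost concave as long as it is nonnegative, so the slope
  stays below \<open>- b\<close> until the axis is crossed. This takes time at most \<open>s\<^sub>3 / b\<close> because \<open>f s\<^sub>3 \<le> s\<^sub>3\<close>.\<close>

lemma ode_crosses:
  assumes s3: "s3 \<in> {a..L}" "0 < f s3" "f' s3 \<le> - (2 * b) + \<delta> * L" and b: "0 < b"
    and L: "s3 + s3 / b + 2 \<le> L" and small: "\<delta> * L + \<delta> * L\<^sup>2 \<le> b"
  obtains s4 where "s4 \<in> {s3..L - 1}" "f s4 = 0" "f' s4 \<le> - b"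
proof -
  have s30: "0 < s3" using s3 a by auto
  have slope: "f' t \<le> - b" if t: "t \<in> {s3..L}" and nn: "\<And>s. s \<in> {s3..t} \<Longrightarrow> 0 \<le> f s" for t
  proof -
    have "f' t - f' s3 \<le> \<delta> * L * t - \<delta> * L * s3"
    proof (rule derivative_comparison[where f' = "\<lambda>t. - (q t * f t)" and g' = "\<lambda>_. \<delta> * L"])
      fix s assume s: "s \<in> {s3..t}"
      then show "(f' has_real_derivative - (q s * f s)) (at s within {s3..t})"
        by (intro ode_der) (use t s3 in auto)
      show "((*) (\<delta> * L) has_real_derivative \<delta> * L) (at s within {s3..t})"
        by (auto intro!: derivative_eq_intros)
      show "- (q s * f s) \<le> \<delta> * L" using ode_concave[of s 0] nn[OF s] s t s3 by auto
    qed (use t in auto)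
    moreover have "\<delta> * L * t - \<delta> * L * s3 \<le> \<delta> * L * L"
    proof -
      have "\<delta> * L * (t - s3) \<le> \<delta> * L * L" using t s30 \<delta> by (intro mult_left_mono) auto
      then show ?thesis by (simp add: algebra_simps)
    qed
    ultimately show ?thesis using s3(3) small by (simp add: power2_eq_square algebra_simps)
  qed
  have quot: "0 < s3 / b" using s30 b by simp
  have "\<exists>y\<in>{s3..L - 1}. f y \<le> 0"
  proof (rule ccontr)
    assume "\<not> ?thesis"
    then have nn: "0 < f y" if "y \<in> {s3..L-1}" for y using that by force
    have "f (L - 1) - f s3 \<le> - b * (L - 1) - - b * s3"
      by (rule derivative_comparison[where f' = f' and g' = "\<lambda>_. - b"])
        (use L s3 quot in \<open>auto intro!: ode_der slope less_imp_le[OF nn] derivative_eq_intros\<close>)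
    moreover have "f s3 \<le> s3" using ode s3 by (auto simp: cubic_ode_def abs_le_iff)
    moreover have "b * (L - 1 - s3) \<ge> b * (s3 / b)" using L b by (intro mult_left_mono) auto
    moreover have "b * (s3 / b) = s3" using b by simp
    moreover have "0 < f (L - 1)" using nn[of "L - 1"] L s3 quot by auto
    ultimately show False by (simp add: algebra_simps)
  qed
  then obtain y where y: "y \<in> {s3..L-1}" "f y \<le> 0" by blast
  have "continuous_on {s3..y} f" by (rule continuous_on_subset[OF ode_cont]) (use y s3 in auto)
  then obtain z where z: "z \<in> {s3..y}" "f z = 0" "\<And>s. s \<in> {s3..z} \<Longrightarrow> 0 \<le> f s"
    using first_zero[of s3 y f] y s3 by auto
  show thesis by (rule that[of z]) (use z y slope[of z] in auto)
qed

text \<open>Only the upper bound on \<open>q\<close> acts here: it keeps the slope below \<open>- b / 2\<close> for a definite time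
  after the zero, so the next hump has a definite height.\<close>

lemma ode_undershoots:
  assumes s4: "s4 \<in> {a..L - 1}" "f s4 = 0" "f' s4 \<le> - b" "0 < b"
    and h: "0 < h" "h \<le> 1" "h * (K * L) \<le> b / 2"
  shows "f (s4 + h) \<le> - (b * h / 2)"
proof -
  have slope: "f' s \<le> - b / 2" if s: "s \<in> {s4..s4 + h}" for s
  proof -
    have "\<bar>f' s - f' s4\<bar> \<le> K * L * (s - s4)" using s s4 h by (intro ode_deriv_bound) auto
    also have "\<dots> \<le> K * L * h" using s K s4 a by (intro mult_left_mono) auto
    finally show ?thesis using s4 h by (simp add: algebra_simps abs_le_iff)
  qed
  have "f (s4 + h) - f s4 \<le> - b / 2 * (s4 + h) - - b / 2 * s4"
    by (rule derivative_comparison[where f' = f' and g' = "\<lambda>_. - b / 2"])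
      (use s4 h slope in \<open>auto intro!: ode_der derivative_eq_intros\<close>)
  then show ?thesis using s4 by (simp add: field_simps)
qed

end

text \<open>The uniform step of the oscillation argument. The constants are chosen in the order \<open>S\<^sub>1\<close> (length until
  the slope is subcritical), \<open>D\<^sub>1\<close> (bound on the slope), \<open>h\<close>, \<open>b\<close> (slope of the descent), \<open>L\<close>, and
  only at the end \<open>\<delta>\<close>, which must be small compared with all of them. The data \<open>c'\<close>, \<open>D'\<close> at the
  new point have the same shape as \<open>c\<close>, \<open>D\<close>, so the step can be iterated for \<open>- f\<close>.\<close>

lemma cubic_ode_sign_flip:
  fixes \<mu> K c D a1 :: real
  assumes mu: "0 < \<mu>" and K: "0 < K" and c: "0 < c" and D: "0 < D" and a1: "0 < a1"
  obtains \<delta> L c' D' :: real where "0 < \<delta>" "a1 \<le> L" "0 < c'" "0 < D'"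
    "\<And>a f f' q. cubic_ode \<mu> K \<delta> a L f f' q \<Longrightarrow> a \<le> a1 \<Longrightarrow> c \<le> f a \<Longrightarrow> \<bar>f' a\<bar> \<le> D \<Longrightarrow>
       \<exists>a'\<in>{a<..L}. f a' \<le> - c' \<and> \<bar>f' a'\<bar> \<le> D'"
proof -
  define S1 where "S1 = a1 * exp (1 / (\<mu> * c\<^sup>2))"
  define S2 where "S2 = 4 * S1"
  define D1 where "D1 = D + K * (S2 + 1) * (S2 + 1)"
  define h where "h = min 1 (c / (2 * D1))"
  define b where "b = h * \<mu> * c ^ 3 / (16 * (S2 + 1)\<^sup>2)"
  define L where "L = S2 + 3 + (S2 + 1) / b"
  define h4 where "h4 = min 1 (b / (2 * (K * L)))"
  define \<delta> where "\<delta> = min (\<mu> * c ^ 3 / (12 * S1 * L\<^sup>2)) (b / (L + L\<^sup>2))"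
  have S1: "0 < S1" "a1 \<le> S1" using a1 mu c by (auto simp: S1_def)
  have S2: "0 < S2" using S1 by (simp add: S2_def)
  have D1: "0 < D1" using D K S2 by (simp add: D1_def add_pos_pos)
  have h: "0 < h" "h \<le> 1" "h * D1 \<le> c / 2"
  proof -
    show "0 < h" "h \<le> 1" using c D1 by (auto simp: h_def)
    have "h * D1 \<le> c / (2 * D1) * D1" using D1 by (intro mult_right_mono) (auto simp: h_def)
    then show "h * D1 \<le> c / 2" using D1 by simp
  qed
  have b: "0 < b" using h mu c S2 by (simp add: b_def)
  have L: "0 < L" "S2 + 3 \<le> L" using S2 b by (auto simp: L_def add_pos_pos)
  have h4: "0 < h4" "h4 \<le> 1" "h4 * (K * L) \<le> b / 2"
  proof -
    have KL: "0 < K * L" using K L by simp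
    show "0 < h4" "h4 \<le> 1" using b KL by (auto simp: h4_def)
    have "h4 * (K * L) \<le> b / (2 * (K * L)) * (K * L)" using KL by (intro mult_right_mono) (auto simp: h4_def)
    then show "h4 * (K * L) \<le> b / 2" using KL K L by simp
  qed
  have \<delta>: "0 < \<delta>" using mu c S1 L b by (auto simp: \<delta>_def add_pos_pos)
  have small1: "12 * \<delta> * S1 * L\<^sup>2 \<le> \<mu> * c ^ 3"
  proof -
    have "\<delta> * (12 * S1 * L\<^sup>2) \<le> \<mu> * c ^ 3 / (12 * S1 * L\<^sup>2) * (12 * S1 * L\<^sup>2)"
      using S1 L by (intro mult_right_mono) (auto simp: \<delta>_def)
    then show ?thesis using S1 L by (simp add: mult_ac)
  qed
  have small2: "\<delta> * L + \<delta> * L\<^sup>2 \<le> b"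
  proof -
    have p: "0 < L + L\<^sup>2" using L by (simp add: add_pos_pos)
    have "\<delta> * (L + L\<^sup>2) \<le> b / (L + L\<^sup>2) * (L + L\<^sup>2)"
      using p by (intro mult_right_mono) (auto simp: \<delta>_def)
    also have "\<dots> = b" using p by simp
    finally show ?thesis by (simp add: distrib_left)
  qed
  show thesis
  proof (rule that[of \<delta> L "b * h4 / 2" "D + K * L * L"])
    show "0 < \<delta>" "a1 \<le> L" "0 < b * h4 / 2" "0 < D + K * L * L"
      using \<delta> L b h4 D K S1 by (auto simp: add_pos_pos S2_def)
    fix a and f f' q :: "real \<Rightarrow> real"
    assume ode: "cubic_ode \<mu> K \<delta> a L f f' q" and a': "a \<le> a1" "c \<le> f a" "\<bar>f' a\<bar> \<le> D"
    have a: "a \<le> a1" "a \<le> L" "c \<le> f a" "\<bar>f' a\<bar> \<le> D" using a' S1 L by (auto simp: S2_def)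
    have a0: "0 < a" using ode a c by (force simp: cubic_ode_def)
    note ctx = ode a0 K mu \<delta>
    have "1 / (\<mu> * c\<^sup>2) \<le> ln (S1 / a)"
    proof -
      have "exp (1 / (\<mu> * c\<^sup>2)) \<le> S1 / a"
        using a a0 by (simp add: S1_def pos_le_divide_eq mult.commute)
      then show ?thesis using a0 S1 by (simp add: ln_ge_iff)
    qed
    then obtain s2 where s2: "s2 \<in> {a..S2}" "c \<le> f s2" "f' s2 \<le> 0"
      using ode_turns[OF ctx c a(3) _ _ _ small1] a S1 L by (auto simp: S2_def)
    have dbound: "\<bar>f' s\<bar> \<le> D1" if "s \<in> {a..S2+1}" for s
    proof -
      have ode': "cubic_ode \<mu> K \<delta> a (S2+1) f f' q"
        by (rule cubic_ode_subinterval[OF ode]) (use L in auto)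
      have "\<bar>f' s - f' a\<bar> \<le> K * (S2 + 1) * (s - a)"
        by (rule ode_deriv_bound[OF ode' a0 K mu \<delta>]) (use that in auto)
      also have "\<dots> \<le> K * (S2 + 1) * (S2 + 1)"
        using that K S2 a0 by (intro mult_left_mono) auto
      finally show ?thesis using a(4) by (simp add: D1_def)
    qed
    have s3: "f' (s2 + h) \<le> - (h * \<mu> * c ^ 3 / (8 * (S2 + 1)\<^sup>2)) + \<delta> * L" "c / 2 \<le> f (s2 + h)"
      by (rule ode_descends[OF ctx s2(1) _ s2(3,2) c dbound h]; use L in simp)+
    have "h * \<mu> * c ^ 3 / (8 * (S2 + 1)\<^sup>2) = 2 * b" by (simp add: b_def)
    with s3 have s3': "f' (s2 + h) \<le> - (2 * b) + \<delta> * L" "0 < f (s2 + h)" using c by auto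
    have "s2 + h + (s2 + h) / b + 2 \<le> L"
    proof -
      have "(s2 + h) / b \<le> (S2 + 1) / b" using s2 h b by (intro divide_right_mono) auto
      then show ?thesis using s2 h by (simp add: L_def)
    qed
    moreover have "s2 + h \<in> {a..L}" using s2 h L by auto
    ultimately obtain s4 where s4: "s4 \<in> {s2+h..L - 1}" "f s4 = 0" "f' s4 \<le> - b"
      using ode_crosses[OF ctx _ s3'(2,1) b _ small2] by auto
    have "f (s4 + h4) \<le> - (b * h4 / 2)"
      by (rule ode_undershoots[OF ctx _ s4(2,3) b h4]) (use s4 s2 h in auto)
    moreover have "\<bar>f' (s4 + h4)\<bar> \<le> D + K * L * L"
    proof -
      have "\<bar>f' (s4 + h4) - f' a\<bar> \<le> K * L * (s4 + h4 - a)"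
        by (rule ode_deriv_bound[OF ctx]) (use s4 s2 h h4 a in auto)
      also have "\<dots> \<le> K * L * L" using s4 h4 K L a0 by (intro mult_left_mono) auto
      finally show ?thesis using a(4) by simp
    qed
    ultimately show "\<exists>a'\<in>{a<..L}. f a' \<le> - (b * h4 / 2) \<and> \<bar>f' a'\<bar> \<le> D + K * L * L"
      by (intro bexI[of _ "s4 + h4"]) (use s4 s2 h h4 in auto)
  qed
qed

text \<open>Iteration of the previous step. The induction is over the number of sign changes with all constants
  generalised, because each step starts further to the right and from a lower hump.\<close>

lemma cubic_ode_oscillates:
  fixes \<mu> K :: real
  assumes mu: "0 < \<mu>" and K: "0 < K"
  shows "0 < c \<Longrightarrow> 0 < D \<Longrightarrow> 0 < a1 \<Longrightarrow> \<exists>\<delta>>0. \<exists>L\<ge>a1. \<forall>a f f' q. cubic_ode \<mu> K \<delta> a L f f' q \<longrightarrow>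
     a \<le> a1 \<longrightarrow> c \<le> \<bar>f a\<bar> \<longrightarrow> \<bar>f' a\<bar> \<le> D \<longrightarrow>
     (\<exists>r::nat \<Rightarrow> real. r 0 = a \<and> (\<forall>j<k. r j < r (Suc j) \<and> f (r j) * f (r (Suc j)) < 0) \<and> r k \<le> L)"
proof (induction k arbitrary: c D a1)
  case 0
  then show ?case by (intro exI[of _ "1::real"] conjI exI[of _ a1] allI impI) (auto intro: exI[of _ "\<lambda>_. _"])
next
  case (Suc k)
  obtain \<delta>1 L1 c' D' :: real where one: "0 < \<delta>1" "a1 \<le> L1" "0 < c'" "0 < D'"
    "\<And>a f f' q. cubic_ode \<mu> K \<delta>1 a L1 f f' q \<Longrightarrow> a \<le> a1 \<Longrightarrow> c \<le> f a \<Longrightarrow> \<bar>f' a\<bar> \<le> D \<Longrightarrow>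
       \<exists>a'\<in>{a<..L1}. f a' \<le> - c' \<and> \<bar>f' a'\<bar> \<le> D'"
    using cubic_ode_sign_flip[OF mu K Suc.prems] by metis
  have "0 < L1" using one(2) Suc.prems(3) by simp
  obtain \<delta>2 L2 where two: "0 < \<delta>2" "L1 \<le> L2"
    "\<And>a f f' q. cubic_ode \<mu> K \<delta>2 a L2 f f' q \<Longrightarrow> a \<le> L1 \<Longrightarrow> c' \<le> \<bar>f a\<bar> \<Longrightarrow> \<bar>f' a\<bar> \<le> D' \<Longrightarrow>
     (\<exists>r::nat \<Rightarrow> real. r 0 = a \<and> (\<forall>j<k. r j < r (Suc j) \<and> f (r j) * f (r (Suc j)) < 0) \<and> r k \<le> L2)"
    using Suc.IH[OF one(3,4) \<open>0 < L1\<close>] by metis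
  define \<delta> where "\<delta> = min \<delta>1 \<delta>2"
  have flip: "\<exists>r::nat \<Rightarrow> real. r 0 = a \<and>
      (\<forall>j<Suc k. r j < r (Suc j) \<and> f (r j) * f (r (Suc j)) < 0) \<and> r (Suc k) \<le> L2"
    if ode: "cubic_ode \<mu> K \<delta> a L2 f f' q" and a: "a \<le> a1" "c \<le> f a" "\<bar>f' a\<bar> \<le> D"
    for a and f f' q :: "real \<Rightarrow> real"
  proof -
    have "cubic_ode \<mu> K \<delta>1 a L1 f f' q"
      by (rule cubic_ode_subinterval[OF ode]) (use two(2) in \<open>auto simp: \<delta>_def\<close>)
    then obtain a' where a': "a' \<in> {a<..L1}" "f a' \<le> - c'" "\<bar>f' a'\<bar> \<le> D'"
      using one(5) a by blast
    have "cubic_ode \<mu> K \<delta>2 a' L2 f f' q"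
      by (rule cubic_ode_subinterval[OF ode]) (use a' in \<open>auto simp: \<delta>_def\<close>)
    then obtain r :: "nat \<Rightarrow> real" where r: "r 0 = a'"
      "\<forall>j<k. r j < r (Suc j) \<and> f (r j) * f (r (Suc j)) < 0" "r k \<le> L2"
      using two(3) a' by force
    have "f a * f a' < 0" using a(2) a'(2) Suc.prems(1) one(3) by (intro mult_pos_neg) auto
    then show ?thesis
      by (intro exI[of _ "case_nat a r"]) (use r a' in \<open>auto split: nat.split simp: less_Suc_eq_0_disj\<close>)
  qed
  show ?case
  proof (rule exI[of _ \<delta>], rule conjI, use one two in \<open>simp add: \<delta>_def\<close>, rule exI[of _ L2],
      rule conjI, use one two in simp, intro allI impI)
    fix a and f f' q :: "real \<Rightarrow> real"
    assume ode: "cubic_ode \<mu> K \<delta> a L2 f f' q" and a: "a \<le> a1" "c \<le> \<bar>f a\<bar>" "\<bar>f' a\<bar> \<le> D"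
    show "\<exists>r::nat \<Rightarrow> real. r 0 = a \<and>
      (\<forall>j<Suc k. r j < r (Suc j) \<and> f (r j) * f (r (Suc j)) < 0) \<and> r (Suc k) \<le> L2"
    proof (cases "c \<le> f a")
      case True
      show ?thesis by (rule flip[OF ode a(1) True a(3)])
    next
      case False
      then have "c \<le> - f a" using a by linarith
      then show ?thesis
        using flip[OF cubic_ode_uminus[OF ode] a(1)] a(3) by simp
    qed
  qed
qed

section \<open>Large radial profiles change sign often\<close>

definition oscillates :: "(real \<Rightarrow> real) \<Rightarrow> nat \<Rightarrow> real \<Rightarrow> bool" where
  "oscillates f k b \<longleftrightarrow> (\<exists>r::nat \<Rightarrow> real.
     0 < r 0 \<and> (\<forall>j<k. r j < r (Suc j) \<and> f (r j) * f (r (Suc j)) < 0) \<and> r k \<le> b)"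

text \<open>The pointwise form of \<open>cubic_ode\<close> with two-sided derivatives, as it is delivered by the interior
  equation.\<close>

definition cubic_ode_at ::
  "real \<Rightarrow> real \<Rightarrow> real \<Rightarrow> (real \<Rightarrow> real) \<Rightarrow> (real \<Rightarrow> real) \<Rightarrow> (real \<Rightarrow> real) \<Rightarrow> real \<Rightarrow> bool" where
  "cubic_ode_at \<mu> K \<delta> f f' q s \<longleftrightarrow>
     (f has_real_derivative f' s) (at s) \<and> (f' has_real_derivative - (q s * f s)) (at s) \<and>
     \<bar>f s\<bar> \<le> s \<and> \<bar>q s\<bar> \<le> K \<and> \<mu> * (f s)\<^sup>2 / s\<^sup>2 - \<delta> \<le> q s"

lemma cubic_ode_at_mono:
  "cubic_ode_at \<mu> K \<delta> f f' q s \<Longrightarrow> \<delta> \<le> \<delta>' \<Longrightarrow> cubic_ode_at \<mu> K \<delta>' f f' q s"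
  unfolding cubic_ode_at_def by auto

lemma alternation_reversed:
  fixes r :: "nat \<Rightarrow> real" and m :: real
  assumes "\<forall>j<k. r j < r (Suc j) \<and> F (r j) * F (r (Suc j)) < 0"
    and F: "\<And>t. t \<in> {r 0..r k} \<Longrightarrow> F t = f (d - t) / m" and "0 < m"
  shows "\<forall>j<k. d - r (k - j) < d - r (k - Suc j) \<and> f (d - r (k - j)) * f (d - r (k - Suc j)) < (0::real)"
proof (intro allI impI)
  fix j assume "j < k"
  define i where "i = k - Suc j"
  have i: "i < k" "k - j = Suc i" using \<open>j < k\<close> by (auto simp: i_def)
  have mono: "r a \<le> r b" if "a \<le> b" "b \<le> k" for a b
    using that by (induction b rule: dec_induct) (use assms(1) in \<open>auto, meson Suc_le_lessD less_imp_le order_trans\<close>)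
  have *: "r i < r (Suc i)" "F (r i) * F (r (Suc i)) < 0" using assms(1) i by auto
  have "F (r i) = f (d - r i) / m" "F (r (Suc i)) = f (d - r (Suc i)) / m"
    using i mono by (auto intro!: F)
  with *(2) have "f (d - r i) * f (d - r (Suc i)) / (m * m) < 0" by simp
  then have "f (d - r i) * f (d - r (Suc i)) < 0"
    using \<open>0 < m\<close> by (simp add: divide_less_0_iff)
  with *(1) show "d - r (k - j) < d - r (k - Suc j) \<and> f (d - r (k - j)) * f (d - r (k - Suc j)) < 0"
    using i unfolding i_def[symmetric] by (simp add: mult.commute)
qed

text \<open>If \<open>s\<^sub>0\<close> is large, the function \<open>F t = f (s\<^sub>0 + 1 - t) / s\<^sub>0\<close> is bounded by 1 and starts at \<open>t = 1\<close> with
  \<open>\<bar>F\<bar> \<ge> 1/2\<close>. Since \<open>s \<le> s\<^sub>0\<close> on the way inwards, \<open>f\<^sup>2 / s\<^sup>2 \<ge> F\<^sup>2 \<ge> F\<^sup>2 / t\<^sup>2\<close>, so the equation for \<open>F\<close> is even better than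
  the one required; the start at 1 instead of 0 makes the weight \<open>1 / t\<^sup>2\<close> harmless. The initial
  slope is bounded because \<open>F\<close> and \<open>F''\<close> are bounded on an interval of length one.\<close>

lemma ode_oscillates_leftwards:
  fixes \<mu> K :: real
  assumes mu: "0 < \<mu>" and K: "0 < K"
  obtains \<delta> R :: real where "0 < \<delta>" "1 \<le> R"
    "\<And>f f' q s0. R \<le> s0 \<Longrightarrow> s0 / 2 \<le> \<bar>f s0\<bar> \<Longrightarrow>
      (\<forall>s\<in>{0<..s0}. cubic_ode_at \<mu> K \<delta> f f' q s) \<Longrightarrow>
      oscillates f k s0"
proof -
  have "0 < (1/2::real)" "0 < 2 + K" "0 < (1::real)" using K by auto
  from cubic_ode_oscillates[OF mu K this, of k] obtain \<delta> L :: real where \<delta>: "0 < \<delta>" and L: "1 \<le> L"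
    and osc: "\<And>a f f' q. cubic_ode \<mu> K \<delta> a L f f' q \<Longrightarrow> a \<le> 1 \<Longrightarrow> 1/2 \<le> \<bar>f a\<bar> \<Longrightarrow> \<bar>f' a\<bar> \<le> 2 + K \<Longrightarrow>
     (\<exists>r::nat \<Rightarrow> real. r 0 = a \<and> (\<forall>j<k. r j < r (Suc j) \<and> f (r j) * f (r (Suc j)) < 0) \<and> r k \<le> L)"
    by blast
  show thesis
  proof (rule that[of \<delta> "L + 1"])
    fix f f' q :: "real \<Rightarrow> real" and s0 :: real
    assume s0: "L + 1 \<le> s0" "s0 / 2 \<le> \<bar>f s0\<bar>"
      and ode': "\<forall>s\<in>{0<..s0}. cubic_ode_at \<mu> K \<delta> f f' q s"
    note ode = ode'[unfolded cubic_ode_at_def, rule_format]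
    have s0p: "0 < s0" "2 \<le> s0" using s0 L by auto
    define F where "F = (\<lambda>t. f (s0 + 1 - t) / s0)"
    define F' where "F' = (\<lambda>t. - f' (s0 + 1 - t) / s0)"
    have "cubic_ode \<mu> K \<delta> 1 L F F' (\<lambda>t. q (s0 + 1 - t))"
      unfolding cubic_ode_def
    proof (intro ballI conjI)
      fix t assume t: "t \<in> {1..L}"
      define s where "s = s0 + 1 - t"
      have s: "s \<in> {0<..s0}" using t s0 by (auto simp: s_def)
      note o = ode[OF s]
      have inner: "((\<lambda>t. s0 + 1 - t) has_real_derivative -1) (at t)"
        using DERIV_diff[OF DERIV_const[of "s0 + 1"] DERIV_ident] by simp
      have "(F has_real_derivative F' t) (at t)"
      proof -
        have "(f has_real_derivative f' s) (at (s0 + 1 - t))" using o by (simp add: s_def)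
        from DERIV_chain2[where g = "\<lambda>t. s0 + 1 - t", OF this inner]
        have "((\<lambda>t. f (s0 + 1 - t)) has_real_derivative f' s * -1) (at t)" .
        from DERIV_cdivide[OF this, of s0] show ?thesis by (simp add: F_def F'_def s_def)
      qed
      then show "(F has_real_derivative F' t) (at t within {1..L})" by (rule DERIV_subset) simp
      have "(F' has_real_derivative - (q s * F t)) (at t)"
      proof -
        have "(f' has_real_derivative - (q s * f s)) (at (s0 + 1 - t))" using o by (simp add: s_def)
        from DERIV_chain2[where g = "\<lambda>t. s0 + 1 - t", OF this inner]
        have "((\<lambda>t. f' (s0 + 1 - t)) has_real_derivative - (q s * f s) * -1) (at t)" .
        from DERIV_cdivide[OF DERIV_minus[OF this], of s0]
        show ?thesis by (simp add: F_def F'_def s_def)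
      qed
      then show "(F' has_real_derivative - (q (s0 + 1 - t) * F t)) (at t within {1..L})"
        unfolding s_def[symmetric] by (rule DERIV_subset) simp
      have "\<bar>F t\<bar> \<le> s / s0" using o s0p by (simp add: F_def s_def divide_right_mono)
      also have "\<dots> \<le> 1" using s s0p by simp
      finally show "\<bar>F t\<bar> \<le> t" using t by simp
      show "\<bar>q (s0 + 1 - t)\<bar> \<le> K" using o by (simp add: s_def)
      have "\<mu> * (F t)\<^sup>2 / t\<^sup>2 \<le> \<mu> * (F t)\<^sup>2 / 1"
        using t mu by (intro divide_left_mono) auto
      also have "\<dots> = \<mu> * (f s)\<^sup>2 / s0\<^sup>2" by (simp add: F_def s_def power_divide)
      also have "\<dots> \<le> \<mu> * (f s)\<^sup>2 / s\<^sup>2" using s mu by (intro divide_left_mono power_mono) auto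
      finally show "\<mu> * (F t)\<^sup>2 / t\<^sup>2 - \<delta> \<le> q (s0 + 1 - t)" using o by (simp add: s_def)
    qed
    moreover have "1/2 \<le> \<bar>F 1\<bar>" using s0 s0p by (simp add: F_def field_simps)
    moreover have "\<bar>F' 1\<bar> \<le> 2 + K"
    proof -
      have ib: "\<bar>f s\<bar> \<le> s0" "\<bar>q s * f s\<bar> \<le> K * s0" if "s \<in> {0<..s0}" for s
      proof -
        have o: "\<bar>f s\<bar> \<le> s" "\<bar>q s\<bar> \<le> K" "s \<le> s0" using ode[OF that] that by auto
        then show "\<bar>f s\<bar> \<le> s0" by simp
        then show "\<bar>q s * f s\<bar> \<le> K * s0" unfolding abs_mult using o by (intro mult_mono) auto
      qed
      obtain x where x: "s0 - 1 < x" "x < s0" "f s0 - f (s0 - 1) = (s0 - (s0 - 1)) * f' x"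
        using MVT2[of "s0 - 1" s0 f f'] ode s0p by auto
      have "\<bar>f s0\<bar> \<le> s0" "\<bar>f (s0 - 1)\<bar> \<le> s0" using ib s0p by auto
      with x have 1: "\<bar>f' x\<bar> \<le> 2 * s0" by (simp add: abs_le_iff)
      obtain y where y: "x < y" "y < s0" "f' s0 - f' x = (s0 - x) * - (q y * f y)"
        using MVT2[of x s0 f' "\<lambda>s. - (q s * f s)"] ode s0p x by auto
      have "\<bar>f' s0 - f' x\<bar> \<le> 1 * (K * s0)"
        unfolding y(3) abs_mult[of "s0 - x"] abs_minus_cancel
        by (rule mult_mono) (use ib(2)[of y] x y s0p in auto)
      with 1 have "\<bar>f' s0\<bar> \<le> (2 + K) * s0" by (simp add: algebra_simps abs_le_iff)
      then show ?thesis using s0p by (simp add: F'_def pos_divide_le_eq)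
    qed
    ultimately obtain r :: "nat \<Rightarrow> real" where r: "r 0 = 1"
      "\<forall>j<k. r j < r (Suc j) \<and> F (r j) * F (r (Suc j)) < 0" "r k \<le> L"
      using osc[OF _ order_refl] by blast
    have "\<forall>j<k. (s0 + 1) - r (k - j) < (s0 + 1) - r (k - Suc j) \<and>
        f ((s0 + 1) - r (k - j)) * f ((s0 + 1) - r (k - Suc j)) < 0"
      by (rule alternation_reversed[OF r(2)]) (use s0p in \<open>auto simp: F_def\<close>)
    then show "oscillates f k s0"
      unfolding oscillates_def
      using r s0 by (intro exI[of _ "\<lambda>j. (s0 + 1) - r (k - j)"]) auto
  qed (use \<delta> L in auto)
qed

text \<open>If \<open>s\<^sub>0\<close> is bounded, one starts slightly to the right of \<open>s\<^sub>0\<close>. The point \<open>s\<^sub>0\<close> may be arbitrarily close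
  to 0, where \<open>f\<close> itself is small, so the profile \<open>f / s\<close> has to be controlled: its derivative is
  \<open>g / s\<^sup>2\<close> with \<open>g = s * f' - f\<close>, and \<open>g 0 = 0\<close>, \<open>g' = s * f''\<close> give \<open>\<bar>g\<bar> \<le> K * s\<^sup>3\<close>.\<close>

lemma ode_oscillates_rightwards:
  fixes \<mu> K R0 :: real
  assumes mu: "0 < \<mu>" and K: "0 < K" and R0: "0 < R0"
  obtains \<delta> R :: real where "0 < \<delta>" "R0 \<le> R"
    "\<And>f f' q S s0. R \<le> S \<Longrightarrow> s0 \<in> {0<..R0} \<Longrightarrow> s0 / 2 \<le> \<bar>f s0\<bar> \<Longrightarrow>
      continuous_on {0..S} f \<Longrightarrow> continuous_on {0..S} f' \<Longrightarrow> f 0 = 0 \<Longrightarrow>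
      (\<forall>s\<in>{0<..S}. cubic_ode_at \<mu> K \<delta> f f' q s) \<Longrightarrow>
      oscillates f k S"
proof -
  define B where "B = K * (R0 + 1)"
  define h where "h = min 1 (1 / (4 * B))"
  define D where "D = K * (R0 + 1)\<^sup>2 + 1"
  have B: "0 < B" using K R0 by (simp add: B_def)
  have h: "0 < h" "h \<le> 1" "B * h \<le> 1/4"
  proof -
    show "0 < h" "h \<le> 1" using B by (auto simp: h_def)
    have "B * h \<le> B * (1 / (4 * B))" using B by (intro mult_left_mono) (auto simp: h_def)
    then show "B * h \<le> 1/4" using B by simp
  qed
  have "0 < h/4" "0 < D" "0 < R0 + 1" using h K R0 by (auto simp: D_def add_nonneg_pos)
  from cubic_ode_oscillates[OF mu K this, of k] obtain \<delta> L :: real where \<delta>: "0 < \<delta>" and L: "R0 + 1 \<le> L"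
    and osc: "\<And>a f f' q. cubic_ode \<mu> K \<delta> a L f f' q \<Longrightarrow> a \<le> R0 + 1 \<Longrightarrow> h/4 \<le> \<bar>f a\<bar> \<Longrightarrow> \<bar>f' a\<bar> \<le> D \<Longrightarrow>
     (\<exists>r::nat \<Rightarrow> real. r 0 = a \<and> (\<forall>j<k. r j < r (Suc j) \<and> f (r j) * f (r (Suc j)) < 0) \<and> r k \<le> L)"
    by blast
  show thesis
  proof (rule that[of \<delta> L])
    fix f f' q :: "real \<Rightarrow> real" and S s0 :: real
    assume S: "L \<le> S" and s0: "s0 \<in> {0<..R0}" "s0 / 2 \<le> \<bar>f s0\<bar>"
      and cont: "continuous_on {0..S} f" "continuous_on {0..S} f'" and f0: "f 0 = 0"
      and ode': "\<forall>s\<in>{0<..S}. cubic_ode_at \<mu> K \<delta> f f' q s"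
    note ode = ode'[unfolded cubic_ode_at_def, rule_format]
    define g where "g = (\<lambda>s. s * f' s - f s)"
    have g: "\<bar>g s\<bar> \<le> K * s ^ 3" if s: "s \<in> {0<..S}" for s
    proof -
      have "\<exists>l z. 0 < z \<and> z < s \<and> (g has_real_derivative l) (at z) \<and> g s - g 0 = (s - 0) * l"
      proof (rule MVT)
        show "continuous_on {0..s} g" unfolding g_def
          by (intro continuous_intros continuous_on_subset[OF cont(1)] continuous_on_subset[OF cont(2)])
            (use s in auto)
        show "g differentiable (at x)" if "0 < x" "x < s" for x
        proof -
          have "f differentiable (at x)" "f' differentiable (at x)"
            using ode[of x] that s by (auto simp: real_differentiable_def)
          then show ?thesis unfolding g_def by (intro differentiable_diff differentiable_mult differentiable_ident)
        qed
      qed (use s in auto)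
      then obtain l z where z: "0 < z" "z < s" "(g has_real_derivative l) (at z)" "g s = s * l"
        by (auto simp: g_def f0)
      have oz: "(f has_real_derivative f' z) (at z)" "(f' has_real_derivative - (q z * f z)) (at z)"
        "\<bar>f z\<bar> \<le> z" "\<bar>q z\<bar> \<le> K" using ode[of z] z s by auto
      have "(g has_real_derivative z * - (q z * f z)) (at z)"
        unfolding g_def using oz by (auto intro!: derivative_eq_intros)
      then have "l = z * - (q z * f z)" using z(3) DERIV_unique by blast
      then have "\<bar>g s\<bar> = s * (z * (\<bar>q z\<bar> * \<bar>f z\<bar>))" using z s by (simp add: abs_mult)
      also have "\<dots> \<le> s * (s * (K * s))"
        using oz z s K by (intro mult_mono mult_nonneg_nonneg) auto
      finally show ?thesis by (simp add: power3_eq_cube mult_ac)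
    qed
    define a where "a = s0 + h"
    have a: "0 < a" "a \<le> R0 + 1" "h \<le> a" "s0 < a" "a \<le> S" using s0 h S L by (auto simp: a_def)
    have quarter: "1/4 \<le> \<bar>f a / a\<bar>"
    proof -
      have "\<exists>z>s0. z < a \<and> f a / a - f s0 / s0 = (a - s0) * (g z / z\<^sup>2)"
      proof (rule MVT2)
        fix x assume x: "s0 \<le> x" "x \<le> a"
        then have "(f has_real_derivative f' x) (at x)" using ode[of x] s0 a by auto
        moreover have "x \<noteq> 0" using x s0 by auto
        ultimately show "((\<lambda>s. f s / s) has_real_derivative g x / x\<^sup>2) (at x)"
          unfolding g_def by (auto intro!: derivative_eq_intros simp: power2_eq_square field_simps)
      qed (use a in auto)
      then obtain z where z: "s0 < z" "z < a" "f a / a - f s0 / s0 = h * (g z / z\<^sup>2)"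
        by (auto simp: a_def)
      have zp: "0 < z" "z \<le> R0 + 1" using z s0 a by auto
      have "\<bar>g z / z\<^sup>2\<bar> \<le> K * z ^ 3 / z\<^sup>2"
        using g[of z] z s0 a by (simp add: abs_divide divide_right_mono)
      also have "\<dots> = K * z" using zp by (simp add: power2_eq_square power3_eq_cube)
      also have "\<dots> \<le> B" unfolding B_def using zp K by (intro mult_left_mono) auto
      finally have "h * \<bar>g z / z\<^sup>2\<bar> \<le> h * B" using h by (intro mult_left_mono) auto
      then have "\<bar>f a / a - f s0 / s0\<bar> \<le> 1/4" using h z(3) by (simp add: abs_mult mult.commute)
      moreover have "1/2 \<le> \<bar>f s0 / s0\<bar>" using s0 by (simp add: pos_le_divide_eq)
      ultimately show ?thesis by linarith
    qed
    have "cubic_ode \<mu> K \<delta> a L f f' q"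
      unfolding cubic_ode_def
    proof
      fix s assume "s \<in> {a..L}"
      then have "s \<in> {0<..S}" using a S by auto
      note o = ode[OF this]
      show "(f has_real_derivative f' s) (at s within {a..L}) \<and>
         (f' has_real_derivative - (q s * f s)) (at s within {a..L}) \<and>
         \<bar>f s\<bar> \<le> s \<and> \<bar>q s\<bar> \<le> K \<and> \<mu> * (f s)\<^sup>2 / s\<^sup>2 - \<delta> \<le> q s"
        by (intro conjI has_field_derivative_at_within[OF conjunct1[OF o]]
            has_field_derivative_at_within[OF conjunct1[OF conjunct2[OF o]]]) (simp_all only: o)
    qed
    moreover have "h/4 \<le> \<bar>f a\<bar>"
    proof -
      have "a / 4 \<le> \<bar>f a\<bar>" using quarter a by (simp add: pos_le_divide_eq)
      then show ?thesis using a by linarith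
    qed
    moreover have "\<bar>f' a\<bar> \<le> D"
    proof -
      have "\<bar>f a\<bar> \<le> a" using ode[of a] a by auto
      moreover have "\<bar>g a\<bar> \<le> K * a ^ 3" using g[of a] a by simp
      moreover have "\<bar>a * f' a\<bar> \<le> \<bar>g a\<bar> + \<bar>f a\<bar>" by (simp add: g_def)
      ultimately have "a * \<bar>f' a\<bar> \<le> K * a ^ 3 + a"
        using a by (simp add: abs_mult)
      also have "\<dots> = a * (K * a\<^sup>2 + 1)" by (simp add: power2_eq_square power3_eq_cube algebra_simps)
      finally have "\<bar>f' a\<bar> \<le> K * a\<^sup>2 + 1" using a by simp
      also have "\<dots> \<le> D" unfolding D_def using a K by (intro add_mono mult_left_mono power_mono) auto
      finally show ?thesis .
    qed
    ultimately obtain r :: "nat \<Rightarrow> real" where "r 0 = a"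
      "\<forall>j<k. r j < r (Suc j) \<and> f (r j) * f (r (Suc j)) < 0" "r k \<le> L"
      using osc a by blast
    then show "oscillates f k S"
      unfolding oscillates_def
      using a S by (intro exI[of _ r]) auto
  qed (use \<delta> L in auto)
qed

text \<open>The radius \<open>R\<^sub>1\<close> that suffices for moving inwards serves as the bound on \<open>s\<^sub>0\<close> for moving outwards.\<close>

lemma ode_oscillates:
  fixes \<mu> K :: real
  assumes mu: "0 < \<mu>" and K: "0 < K"
  obtains \<delta> R :: real where "0 < \<delta>" "1 \<le> R"
    "\<And>f f' q S s0. R \<le> S \<Longrightarrow> s0 \<in> {0<..S} \<Longrightarrow> s0 / 2 \<le> \<bar>f s0\<bar> \<Longrightarrow>
      continuous_on {0..S} f \<Longrightarrow> continuous_on {0..S} f' \<Longrightarrow> f 0 = 0 \<Longrightarrow>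
      (\<forall>s\<in>{0<..S}. cubic_ode_at \<mu> K \<delta> f f' q s) \<Longrightarrow>
      oscillates f k S"
proof -
  obtain \<delta>1 R1 :: real where 1: "0 < \<delta>1" "1 \<le> R1" and left:
    "\<And>f f' q s0. R1 \<le> s0 \<Longrightarrow> s0 / 2 \<le> \<bar>f s0\<bar> \<Longrightarrow>
      (\<forall>s\<in>{0<..s0}. cubic_ode_at \<mu> K \<delta>1 f f' q s) \<Longrightarrow>
      oscillates f k s0"
    using ode_oscillates_leftwards[OF mu K, of k] by metis
  have "0 < R1" using 1 by simp
  obtain \<delta>2 R2 :: real where 2: "0 < \<delta>2" "R1 \<le> R2" and right:
    "\<And>f f' q S s0. R2 \<le> S \<Longrightarrow> s0 \<in> {0<..R1} \<Longrightarrow> s0 / 2 \<le> \<bar>f s0\<bar> \<Longrightarrow>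
      continuous_on {0..S} f \<Longrightarrow> continuous_on {0..S} f' \<Longrightarrow> f 0 = 0 \<Longrightarrow>
      (\<forall>s\<in>{0<..S}. cubic_ode_at \<mu> K \<delta>2 f f' q s) \<Longrightarrow>
      oscillates f k S"
    using ode_oscillates_rightwards[OF mu K \<open>0 < R1\<close>, of k] by metis
  show thesis
  proof (rule that[of "min \<delta>1 \<delta>2" R2])
    fix f f' q :: "real \<Rightarrow> real" and S s0 :: real
    assume S: "R2 \<le> S" and s0: "s0 \<in> {0<..S}" "s0 / 2 \<le> \<bar>f s0\<bar>"
      and reg: "continuous_on {0..S} f" "continuous_on {0..S} f'" "f 0 = 0"
      and ode: "\<forall>s\<in>{0<..S}. cubic_ode_at \<mu> K (min \<delta>1 \<delta>2) f f' q s"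
    show "oscillates f k S"
    proof (cases "R1 \<le> s0")
      case True
      have "\<forall>s\<in>{0<..s0}. cubic_ode_at \<mu> K \<delta>1 f f' q s"
        using ode s0(1) by (auto intro: cubic_ode_at_mono[where \<delta> = "min \<delta>1 \<delta>2"])
      then have "oscillates f k s0" using left[of s0 f] True s0(2) by blast
      then show ?thesis using s0(1) unfolding oscillates_def by force
    next
      case False
      then have s1: "s0 \<in> {0<..R1}" using s0 by auto
      have "\<forall>s\<in>{0<..S}. cubic_ode_at \<mu> K \<delta>2 f f' q s"
        using ode by (auto intro: cubic_ode_at_mono[where \<delta> = "min \<delta>1 \<delta>2"])
      then show ?thesis using right[of S s0 f] S s1 s0(2) reg by blast
    qed
  qed (use 1 2 in auto)
qed

text \<open>A profile whose maximum modulus on \<open>{0..\<rho>}\<close> is \<open>M\<close>, together with the equation for \<open>r * W r\<close> in the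
  original variables; the bounds on \<open>Q\<close> are those of \<open>cubic_ode_at\<close> multiplied by \<open>M\<^sup>2\<close>.\<close>

definition large_profile ::
  "real \<Rightarrow> real \<Rightarrow> real \<Rightarrow> real \<Rightarrow> real \<Rightarrow> (real \<Rightarrow> real) \<Rightarrow> (real \<Rightarrow> real) \<Rightarrow> (real \<Rightarrow> real) \<Rightarrow> bool" where
  "large_profile \<mu> K \<delta> M \<rho> W v' Q \<longleftrightarrow>
     continuous_on {0..\<rho>} W \<and> continuous_on {0..\<rho>} v' \<and>
     (\<forall>r\<in>{0..\<rho>}. \<bar>W r\<bar> \<le> M) \<and> (\<exists>r\<in>{0..\<rho>}. \<bar>W r\<bar> = M) \<and>
     (\<forall>r\<in>{0<..\<rho>}. ((\<lambda>r. r * W r) has_real_derivative v' r) (at r) \<and>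
        (v' has_real_derivative - (Q r * (r * W r))) (at r) \<and>
        \<bar>Q r\<bar> \<le> K * M\<^sup>2 \<and> \<mu> * (W r)\<^sup>2 - \<delta> * M\<^sup>2 \<le> Q r)"

text \<open>The rescaling \<open>f s = v (s / M)\<close>. Half of the maximum is attained at a positive radius even if the
  maximum itself is attained at the origin.\<close>

lemma large_profile_oscillates:
  fixes \<mu> K :: real
  assumes mu: "0 < \<mu>" and K: "0 < K"
  obtains \<delta> R :: real where "0 < \<delta>" "1 \<le> R"
    "\<And>W v' Q \<rho> M. R \<le> M \<Longrightarrow> 1/2 \<le> \<rho> \<Longrightarrow> large_profile \<mu> K \<delta> M \<rho> W v' Q \<Longrightarrow> oscillates W k \<rho>"
proof -
  obtain \<delta> R :: real where \<delta>: "0 < \<delta>" and R: "1 \<le> R" and osc: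
    "\<And>f f' q S s0. R \<le> S \<Longrightarrow> s0 \<in> {0<..S} \<Longrightarrow> s0 / 2 \<le> \<bar>f s0\<bar> \<Longrightarrow>
      continuous_on {0..S} f \<Longrightarrow> continuous_on {0..S} f' \<Longrightarrow> f 0 = 0 \<Longrightarrow>
      (\<forall>s\<in>{0<..S}. cubic_ode_at \<mu> K \<delta> f f' q s) \<Longrightarrow>
      oscillates f k S"
    using ode_oscillates[OF mu K, of k] by metis
  show thesis
  proof (rule that[of \<delta> "2 * R"])
    fix W v' Q :: "real \<Rightarrow> real" and \<rho> M :: real
    assume M: "2 * R \<le> M" and \<rho>: "1/2 \<le> \<rho>" and "large_profile \<mu> K \<delta> M \<rho> W v' Q"
    then have cont: "continuous_on {0..\<rho>} W" "continuous_on {0..\<rho>} v'"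
      and le: "\<And>r. r \<in> {0..\<rho>} \<Longrightarrow> \<bar>W r\<bar> \<le> M" and attained: "\<exists>r\<in>{0..\<rho>}. \<bar>W r\<bar> = M"
      and ode: "\<And>r. r \<in> {0<..\<rho>} \<Longrightarrow> ((\<lambda>r. r * W r) has_real_derivative v' r) (at r) \<and>
         (v' has_real_derivative - (Q r * (r * W r))) (at r) \<and>
         \<bar>Q r\<bar> \<le> K * M\<^sup>2 \<and> \<mu> * (W r)\<^sup>2 - \<delta> * M\<^sup>2 \<le> Q r"
      by (simp_all only: large_profile_def)
    have M0: "0 < M" using M R by simp
    obtain r0 where r0: "r0 \<in> {0<..\<rho>}" "M / 2 \<le> \<bar>W r0\<bar>"
    proof -
      obtain r1 where r1: "r1 \<in> {0..\<rho>}" "\<bar>W r1\<bar> = M" using attained by blast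
      show thesis
      proof (cases "r1 = 0")
        case False
        then show thesis using that[of r1] r1 M0 by auto
      next
        case True
        obtain d where d: "d > 0" "\<And>r. r \<in> {0..\<rho>} \<Longrightarrow> dist r 0 < d \<Longrightarrow> dist (W r) (W 0) < M / 2"
          using cont(1) \<rho> M0 unfolding continuous_on_iff
          by (metis True half_gt_zero r1(1))
        define r where "r = min (d / 2) \<rho>"
        have r: "r \<in> {0<..\<rho>}" "dist r 0 < d" using d(1) \<rho> by (auto simp: r_def dist_real_def)
        have "dist (W r) (W 0) < M / 2" by (rule d(2)) (use r in auto)
        then have "\<bar>W r - W 0\<bar> < M / 2" by (simp add: dist_real_def)
        then have "M / 2 \<le> \<bar>W r\<bar>" using r1(2) unfolding True by linarith
        then show thesis using r by (intro that[of r]) auto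
      qed
    qed
    define f where "f = (\<lambda>s. s / M * W (s / M))"
    define f' where "f' = (\<lambda>s. v' (s / M) / M)"
    have "oscillates f k (\<rho> * M)"
    proof (rule osc[of "\<rho> * M" "r0 * M" f f' "\<lambda>s. Q (s / M) / M\<^sup>2"])
      have "1/2 * M \<le> \<rho> * M" using \<rho> M0 by (intro mult_right_mono) auto
      then show "R \<le> \<rho> * M" using M by linarith
      show "r0 * M \<in> {0<..\<rho> * M}" using r0 M0 by auto
      show "r0 * M / 2 \<le> \<bar>f (r0 * M)\<bar>"
        using r0 M0 mult_left_mono[OF r0(2), of r0] by (simp add: f_def abs_mult)
      have img: "(\<lambda>s. s / M) ` {0..\<rho> * M} \<subseteq> {0..\<rho>}" using M0 by (auto simp: field_simps)
      have "continuous_on {0..\<rho> * M} (\<lambda>s. W (s / M))" "continuous_on {0..\<rho> * M} (\<lambda>s. v' (s / M))"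
        using M0 by (auto intro!: continuous_on_compose2[OF cont(1) _ img]
            continuous_on_compose2[OF cont(2) _ img] continuous_intros)
      then show "continuous_on {0..\<rho> * M} f" "continuous_on {0..\<rho> * M} f'"
        unfolding f_def f'_def using M0 by (auto intro!: continuous_intros)
      show "f 0 = 0" by (simp add: f_def)
      show "\<forall>s\<in>{0<..\<rho> * M}. cubic_ode_at \<mu> K \<delta> f f' (\<lambda>s. Q (s / M) / M\<^sup>2) s"
      proof
        fix s assume s: "s \<in> {0<..\<rho> * M}"
        define x where "x = s / M"
        have x: "x \<in> {0<..\<rho>}" "s = x * M" using s M0 by (auto simp: x_def field_simps)
        note o = ode[OF x(1)]
        have inner: "((\<lambda>s. s / M) has_real_derivative 1 / M) (at s)"
          by (rule DERIV_cdivide[OF DERIV_ident])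
        have "(f has_real_derivative v' x * (1 / M)) (at s)"
          unfolding f_def
          by (rule DERIV_chain2[where g = "\<lambda>s. s / M" and f = "\<lambda>r. r * W r", OF _ inner])
            (use o in \<open>simp add: x_def\<close>)
        moreover have "((\<lambda>s. v' (s / M)) has_real_derivative - (Q x * (x * W x)) * (1 / M)) (at s)"
          by (rule DERIV_chain2[where g = "\<lambda>s. s / M" and f = v', OF _ inner])
            (use o in \<open>simp add: x_def\<close>)
        from DERIV_cdivide[OF this, of M]
        have "(f' has_real_derivative - (Q x / M\<^sup>2 * f s)) (at s)"
          unfolding f'_def f_def by (simp add: x_def power2_eq_square)
        moreover have "\<bar>f s\<bar> \<le> s"
        proof -
          have "x * \<bar>W x\<bar> \<le> x * M" using le[of x] x by (intro mult_left_mono) auto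
          then show ?thesis using x M0 by (simp add: f_def abs_mult)
        qed
        moreover have "\<bar>Q x / M\<^sup>2\<bar> \<le> K" using o M0 by (simp add: pos_divide_le_eq)
        moreover have "\<mu> * (f s)\<^sup>2 / s\<^sup>2 - \<delta> \<le> Q x / M\<^sup>2"
        proof -
          have "\<mu> * (f s)\<^sup>2 / s\<^sup>2 - \<delta> = (\<mu> * (W x)\<^sup>2 - \<delta> * M\<^sup>2) / M\<^sup>2"
            using x M0 by (simp add: f_def power_mult_distrib diff_divide_distrib)
          then show ?thesis using o M0 by (simp add: divide_right_mono)
        qed
        ultimately show "cubic_ode_at \<mu> K \<delta> f f' (\<lambda>s. Q (s / M) / M\<^sup>2) s"
          by (simp add: cubic_ode_at_def f'_def x_def)
      qed
    qed
    then obtain r :: "nat \<Rightarrow> real" where r: "0 < r 0"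
      "\<forall>j<k. r j < r (Suc j) \<and> f (r j) * f (r (Suc j)) < 0" "r k \<le> \<rho> * M"
      unfolding oscillates_def by blast
    have pos: "0 < r j" if "j \<le> k" for j
      using that by (induction j) (use r in \<open>auto, meson Suc_le_lessD less_imp_le less_trans\<close>)
    have "W (r j / M) * W (r (Suc j) / M) < 0" if "j < k" for j
    proof -
      have "(r j / M * (r (Suc j) / M)) * (W (r j / M) * W (r (Suc j) / M)) < 0"
        using r(2) that by (simp add: f_def mult_ac)
      moreover have "0 < r j / M * (r (Suc j) / M)" using pos[of j] pos[of "Suc j"] that M0 by simp
      ultimately show ?thesis by (metis mult_less_0_iff not_less_iff_gr_or_eq)
    qed
    then show "oscillates W k \<rho>"
      unfolding oscillates_def
      using r M0 by (intro exI[of _ "\<lambda>j. r j / M"]) (auto simp: divide_strict_right_mono pos_divide_le_eq)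
  qed (use \<delta> R in auto)
qed

section \<open>Smooth compactly supported functions on the line\<close>

text \<open>A smooth function together with the sequence of its derivatives, which saves iterating \<open>deriv\<close>.\<close>

definition smooth_family :: "(nat \<Rightarrow> real \<Rightarrow> real) \<Rightarrow> bool" where
  "smooth_family Z \<longleftrightarrow> (\<forall>k t. (Z k has_real_derivative Z (Suc k) t) (at t))"

lemma smooth_family_of_closed_class:
  assumes "P f" and closed: "\<And>g. P g \<Longrightarrow> \<exists>g'. P g' \<and> (\<forall>t. (g has_real_derivative g' t) (at t))"
  obtains Z where "smooth_family Z" "Z 0 = f"
proof -
  have step: "P (deriv g) \<and> (\<forall>t. (g has_real_derivative deriv g t) (at t))" if Pg: "P g" for g
  proof -
    obtain g' where g': "P g'" "\<forall>t. (g has_real_derivative g' t) (at t)" using closed[OF Pg] by blast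
    then have "deriv g = g'" by (auto intro!: ext DERIV_imp_deriv)
    with g' show ?thesis by simp
  qed
  have "P ((deriv ^^ n) f)" for n by (induction n) (use assms(1) step in auto)
  then have "smooth_family (\<lambda>n. (deriv ^^ n) f)" unfolding smooth_family_def using step by auto
  then show thesis by (rule that) simp
qed

text \<open>The family of functions that contains \<open>exp (- 1 / t)\<close>, extended by zero, and is closed under
  differentiation.\<close>

definition flat_exp :: "real poly \<Rightarrow> real \<Rightarrow> real" where
  "flat_exp p t = (if 0 < t then poly p (inverse t) * exp (- inverse t) else 0)"

lemma poly_times_exp_tendsto_0:
  fixes p :: "real poly"
  shows "((\<lambda>x. poly p x * exp (- x)) \<longlongrightarrow> 0) at_top"
proof -
  have "((\<lambda>x. \<Sum>i\<le>degree p. coeff p i * (x ^ i / exp x)) \<longlongrightarrow> (\<Sum>i\<le>degree p. coeff p i * 0)) at_top"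
    by (intro tendsto_intros tendsto_power_div_exp_0)
  then show ?thesis
    by (simp add: poly_altdef exp_minus sum_distrib_right divide_inverse mult.assoc)
qed

lemma DERIV_flat_exp:
  "(flat_exp p has_real_derivative flat_exp ([:0, 0, 1:] * (p - pderiv p)) t) (at t)"
proof (cases t "0::real" rule: linorder_cases)
  case less
  have "((\<lambda>_. 0) has_real_derivative 0) (at t)" by simp
  then have "(flat_exp p has_real_derivative 0) (at t)"
    by (rule has_field_derivative_transform_within_open[where S = "{..<0}"])
      (use less in \<open>auto simp: flat_exp_def\<close>)
  then show ?thesis using less by (simp add: flat_exp_def)
next
  case greater
  have "((\<lambda>t. poly p (inverse t) * exp (- inverse t)) has_real_derivative
      flat_exp ([:0, 0, 1:] * (p - pderiv p)) t) (at t)"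
  proof -
    have inv: "((\<lambda>t. inverse t) has_real_derivative - (inverse t * inverse t)) (at t)"
      using DERIV_inverse[of t UNIV] greater by (simp add: power2_eq_square)
    show ?thesis
      using DERIV_mult[OF DERIV_chain2[OF poly_DERIV inv] DERIV_chain2[OF DERIV_exp DERIV_minus[OF inv]], of p] greater
      by (simp add: flat_exp_def algebra_simps)
  qed
  then show ?thesis
    by (rule has_field_derivative_transform_within_open[where S = "{0<..}"])
      (use greater in \<open>auto simp: flat_exp_def\<close>)
next
  case equal
  have "((\<lambda>h. flat_exp p h / h) \<longlongrightarrow> 0) (at_right 0)"
  proof -
    have "((\<lambda>x. poly ([:0, 1:] * p) x * exp (- x)) \<longlongrightarrow> 0) at_top"
      by (rule poly_times_exp_tendsto_0)
    then have "((\<lambda>h. poly ([:0, 1:] * p) (inverse h) * exp (- inverse h)) \<longlongrightarrow> 0) (at_right 0)"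
      by (rule filterlim_compose[OF _ filterlim_inverse_at_top_right])
    then show ?thesis
      by (rule Lim_transform_eventually)
        (auto simp: eventually_at_right_field flat_exp_def divide_inverse mult_ac intro!: exI[of _ 1])
  qed
  moreover have "((\<lambda>h. flat_exp p h / h) \<longlongrightarrow> 0) (at_left 0)"
    by (rule Lim_transform_eventually[OF tendsto_const])
      (auto simp: eventually_at_left_field flat_exp_def intro!: exI[of _ "-1"])
  ultimately have "((\<lambda>h. flat_exp p h / h) \<longlongrightarrow> 0) (at 0)" by (simp add: filterlim_at_split)
  then show ?thesis unfolding equal by (simp add: DERIV_def flat_exp_def)
qed

text \<open>Contains the bump \<open>exp (- 1 / (\<epsilon> + t)) * exp (- 1 / (\<epsilon> - t))\<close> and is closed under differentiation.\<close>

inductive bump_class :: "real \<Rightarrow> (real \<Rightarrow> real) \<Rightarrow> bool" for \<epsilon> where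
  left: "bump_class \<epsilon> (\<lambda>t. flat_exp p (\<epsilon> + t))"
| right: "bump_class \<epsilon> (\<lambda>t. flat_exp p (\<epsilon> - t))"
| add: "bump_class \<epsilon> f \<Longrightarrow> bump_class \<epsilon> g \<Longrightarrow> bump_class \<epsilon> (\<lambda>t. f t + g t)"
| mult: "bump_class \<epsilon> f \<Longrightarrow> bump_class \<epsilon> g \<Longrightarrow> bump_class \<epsilon> (\<lambda>t. f t * g t)"
| minus: "bump_class \<epsilon> f \<Longrightarrow> bump_class \<epsilon> (\<lambda>t. - f t)"

lemma bump_class_deriv:
  assumes "bump_class \<epsilon> f"
  shows "\<exists>f'. bump_class \<epsilon> f' \<and> (\<forall>t. (f has_real_derivative f' t) (at t))"
  using assms
proof induction
  case (left p)
  have "((\<lambda>t. flat_exp p (\<epsilon> + t)) has_real_derivative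
      flat_exp ([:0, 0, 1:] * (p - pderiv p)) (\<epsilon> + t)) (at t)" for t
    using DERIV_chain2[where g = "\<lambda>t. \<epsilon> + t", OF DERIV_flat_exp DERIV_add[OF DERIV_const DERIV_ident]]
    by simp
  then show ?case using bump_class.left by blast
next
  case (right p)
  have "((\<lambda>t. flat_exp p (\<epsilon> - t)) has_real_derivative
      - flat_exp ([:0, 0, 1:] * (p - pderiv p)) (\<epsilon> - t)) (at t)" for t
    using DERIV_chain2[where g = "\<lambda>t. \<epsilon> - t", OF DERIV_flat_exp DERIV_diff[OF DERIV_const DERIV_ident]]
    by simp
  then show ?case using bump_class.minus[OF bump_class.right] by blast
next
  case (add f g)
  then obtain f' g' where fg: "bump_class \<epsilon> f'" "bump_class \<epsilon> g'"
    "\<forall>t. (f has_real_derivative f' t) (at t)" "\<forall>t. (g has_real_derivative g' t) (at t)" by blast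
  show ?case
    by (intro exI[of _ "\<lambda>t. f' t + g' t"] conjI allI bump_class.add DERIV_add) (use fg in auto)
next
  case (mult f g)
  then obtain f' g' where fg: "bump_class \<epsilon> f'" "bump_class \<epsilon> g'"
    "\<forall>t. (f has_real_derivative f' t) (at t)" "\<forall>t. (g has_real_derivative g' t) (at t)" by blast
  show ?case
    by (intro exI[of _ "\<lambda>t. f' t * g t + g' t * f t"] conjI allI bump_class.add bump_class.mult DERIV_mult)
      (use fg mult.hyps in auto)
next
  case (minus f)
  then obtain f' where f: "bump_class \<epsilon> f'" "\<forall>t. (f has_real_derivative f' t) (at t)" by blast
  show ?case
    by (intro exI[of _ "\<lambda>t. - f' t"] conjI allI bump_class.minus DERIV_minus) (use f in auto)
qed

lemma DERIV_zero_imp_eq: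
  fixes f :: "real \<Rightarrow> real"
  assumes "\<And>t. (f has_real_derivative f' t) (at t)" "\<And>t. t \<in> {min a b..max a b} \<Longrightarrow> f' t = 0"
  shows "f a = f b"
proof -
  have *: "f x = f y" if "x < y" "\<And>t. t \<in> {x..y} \<Longrightarrow> f' t = 0" for x y
  proof -
    have "\<exists>z>x. z < y \<and> f y - f x = (y - x) * f' z"
      by (rule MVT2[OF that(1)]) (rule assms(1))
    with that(2) show ?thesis by auto
  qed
  show ?thesis
  proof (cases a b rule: linorder_cases)
    case less
    then show ?thesis using assms(2) by (intro *) auto
  next
    case greater
    then show ?thesis using assms(2) by (intro *[symmetric]) auto
  qed simp
qed

lemma antiderivative_vanishing_at:
  fixes f :: "real \<Rightarrow> real"
  assumes "continuous_on UNIV f"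
  obtains F where "\<And>t. (F has_real_derivative f t) (at t)" "F a = 0"
proof -
  have "\<exists>F. \<forall>x :: real. - \<infinity> < ereal x \<longrightarrow> x < \<infinity> \<longrightarrow> (F has_vector_derivative f x) (at x)"
    by (rule einterval_antiderivative) (use assms in \<open>auto simp: continuous_on_eq_continuous_at\<close>)
  then obtain F where "\<And>x. (F has_real_derivative f x) (at x)"
    by (auto simp: has_real_derivative_iff_has_vector_derivative)
  then show thesis
    using that[of "\<lambda>t. F t - F a"] DERIV_diff[OF _ DERIV_const] by fastforce
qed

text \<open>A smooth convex replacement of the positive part of \<open>t\<close>, up to an additive constant \<open>c\<close> on the right,
  which cancels in all later combinations: its second derivative is a mollifier
  of total mass one supported in \<open>{-\<epsilon>..\<epsilon>}\<close>.\<close>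

definition smooth_hinge :: "real \<Rightarrow> real \<Rightarrow> (nat \<Rightarrow> real \<Rightarrow> real) \<Rightarrow> bool" where
  "smooth_hinge \<epsilon> c H \<longleftrightarrow> smooth_family H \<and>
     (\<forall>t. t \<le> - \<epsilon> \<longrightarrow> H 0 t = 0 \<and> H 1 t = 0) \<and> (\<forall>t. \<epsilon> \<le> t \<longrightarrow> H 0 t = t + c \<and> H 1 t = 1) \<and>
     (\<forall>t. 0 \<le> H 2 t) \<and> (\<forall>t. \<epsilon> \<le> \<bar>t\<bar> \<longrightarrow> H 2 t = 0)"

text \<open>Integrate a bump twice from the left end of its support and divide by its mass \<open>I\<close>.\<close>

lemma smooth_hinge_exists:
  fixes \<epsilon> :: real
  assumes "0 < \<epsilon>"
  obtains H c where "smooth_hinge \<epsilon> c H"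
proof -
  define \<rho> where "\<rho> = (\<lambda>t. flat_exp 1 (\<epsilon> + t) * flat_exp 1 (\<epsilon> - t))"
  have "bump_class \<epsilon> \<rho>" unfolding \<rho>_def by (intro bump_class.intros)
  then obtain B where B: "smooth_family B" "B 0 = \<rho>"
    by (rule smooth_family_of_closed_class[where P = "bump_class \<epsilon>", OF _ bump_class_deriv])
  have der\<rho>: "(\<rho> has_real_derivative B 1 t) (at t)" for t
    using B(1)[unfolded smooth_family_def, rule_format, of 0 t] by (simp add: B(2))
  have "continuous_on UNIV \<rho>" by (rule DERIV_continuous_on) (rule der\<rho>)
  then obtain R1 where R1: "\<And>t. (R1 has_real_derivative \<rho> t) (at t)" "R1 (- \<epsilon>) = 0"
    by (rule antiderivative_vanishing_at[where a = "- \<epsilon>"]) blast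
  have "continuous_on UNIV R1" by (rule DERIV_continuous_on) (rule R1(1))
  then obtain R where R: "\<And>t. (R has_real_derivative R1 t) (at t)" "R (- \<epsilon>) = 0"
    by (rule antiderivative_vanishing_at[where a = "- \<epsilon>"]) blast
  have nonneg: "0 \<le> \<rho> t" for t by (simp add: \<rho>_def flat_exp_def)
  have zero: "\<rho> t = 0" if "\<epsilon> \<le> \<bar>t\<bar>" for t using that by (auto simp: \<rho>_def flat_exp_def)
  have pos: "0 < \<rho> t" if "\<bar>t\<bar> < \<epsilon>" for t using that by (auto simp: \<rho>_def flat_exp_def)
  define I where "I = R1 \<epsilon>"
  have I: "0 < I"
  proof -
    have "\<exists>z>- \<epsilon>. z < \<epsilon> \<and> R1 \<epsilon> - R1 (- \<epsilon>) = (\<epsilon> - - \<epsilon>) * \<rho> z"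
      by (rule MVT2) (use assms R1 in auto)
    then obtain z where "- \<epsilon> < z" "z < \<epsilon>" "R1 \<epsilon> = 2 * \<epsilon> * \<rho> z" using R1(2) by auto
    then show ?thesis using pos[of z] assms by (simp add: I_def)
  qed
  have R1l: "R1 t = 0" if "t \<le> - \<epsilon>" for t
  proof -
    have "R1 t = R1 (- \<epsilon>)"
      by (rule DERIV_zero_imp_eq[OF R1(1)], rule zero) (use that assms in auto)
    with R1(2) show ?thesis by simp
  qed
  have R1r: "R1 t = I" if "\<epsilon> \<le> t" for t
    unfolding I_def by (rule DERIV_zero_imp_eq[OF R1(1)], rule zero) (use that assms in auto)
  have Rl: "R t = 0" if "t \<le> - \<epsilon>" for t
  proof -
    have "R t = R (- \<epsilon>)"
      by (rule DERIV_zero_imp_eq[OF R(1)], rule R1l) (use that assms in auto)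
    with R(2) show ?thesis by simp
  qed
  have Rr: "R t = I * t + (R \<epsilon> - I * \<epsilon>)" if "\<epsilon> \<le> t" for t
  proof -
    have der: "((\<lambda>t. R t - I * t) has_real_derivative R1 t - I) (at t)" for t
      using DERIV_diff[OF R(1) DERIV_cmult_Id] .
    have "R t - I * t = R \<epsilon> - I * \<epsilon>"
      by (rule DERIV_zero_imp_eq[OF der]) (use R1r that in auto)
    then show ?thesis by simp
  qed
  define Z where "Z = (\<lambda>k t. case k of 0 \<Rightarrow> R t / I | Suc 0 \<Rightarrow> R1 t / I | Suc (Suc j) \<Rightarrow> B j t / I)"
  have "smooth_family Z"
    unfolding smooth_family_def
  proof (intro allI)
    fix k t
    show "(Z k has_real_derivative Z (Suc k) t) (at t)"
    proof (cases k)
      case 0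
      then show ?thesis using DERIV_cdivide[OF R(1), of I t] by (simp add: Z_def)
    next
      case (Suc j)
      show ?thesis
      proof (cases j)
        case 0
        then show ?thesis using Suc DERIV_cdivide[OF R1(1), of I t] by (simp add: Z_def B(2))
      next
        case (Suc i)
        have "(B i has_real_derivative B (Suc i) t) (at t)" using B(1) by (simp add: smooth_family_def)
        from DERIV_cdivide[OF this, of I] show ?thesis using Suc \<open>k = Suc j\<close> by (simp add: Z_def)
      qed
    qed
  qed
  define c where "c = (R \<epsilon> - I * \<epsilon>) / I"
  have Zr: "Z 0 t = t + c" if "\<epsilon> \<le> t" for t
    unfolding Z_def Rr[OF that] c_def using I by (simp add: field_simps)
  have "smooth_hinge \<epsilon> c Z"
    unfolding smooth_hinge_def using \<open>smooth_family Z\<close> Zr I B(2)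
    by (simp add: Z_def numeral_2_eq_2 Rl R1l R1r nonneg zero)
  then show thesis by (rule that)
qed

section \<open>Weak second derivatives on an interval\<close>

lemma smooth_family_derivative_zero:
  assumes "smooth_family Z" "open U" "\<And>t. t \<in> U \<Longrightarrow> Z 0 t = 0" "t \<in> U"
  shows "Z k t = 0"
  using assms(4)
proof (induction k arbitrary: t)
  case (Suc k)
  have "((\<lambda>_. 0) has_real_derivative Z (Suc k) t) (at t)"
    by (rule has_field_derivative_transform_within_open[OF _ assms(2) Suc.prems Suc.IH])
      (use assms(1) in \<open>simp_all add: smooth_family_def\<close>)
  then show ?case using DERIV_unique[OF _ DERIV_const] by blast
qed (use assms in auto)

lemma smooth_family_continuous: "smooth_family Z \<Longrightarrow> continuous_on S (Z k)"
  unfolding smooth_family_def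
  by (rule DERIV_continuous_on[where D = "Z (Suc k)"]) (blast intro: has_field_derivative_at_within)

text \<open>A test function on the open interval from \<open>\<alpha>\<close> to \<open>\<beta>\<close> with all its derivatives.\<close>

definition test_family :: "real \<Rightarrow> real \<Rightarrow> (nat \<Rightarrow> real \<Rightarrow> real) \<Rightarrow> bool" where
  "test_family \<alpha> \<beta> Z \<longleftrightarrow> smooth_family Z \<and> (\<forall>k t. t \<notin> {\<alpha><..<\<beta>} \<longrightarrow> Z k t = 0)"

lemma mollifier_approximates:
  fixes d \<rho> :: "real \<Rightarrow> real"
  assumes cont: "continuous_on {\<alpha>..\<beta>} d" and \<rho>: "continuous_on UNIV \<rho>" "\<And>t. 0 \<le> \<rho> t"
    and supp: "\<And>t. \<epsilon> \<le> \<bar>t\<bar> \<Longrightarrow> \<rho> t = 0"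
    and one: "integral {\<alpha>..\<beta>} (\<lambda>t. \<rho> (t - p)) = 1"
    and close: "\<And>t. t \<in> {\<alpha>..\<beta>} \<Longrightarrow> \<bar>t - p\<bar> \<le> \<epsilon> \<Longrightarrow> \<bar>d t - d p\<bar> \<le> \<eta>"
  shows "\<bar>integral {\<alpha>..\<beta>} (\<lambda>t. d t * \<rho> (t - p)) - d p\<bar> \<le> \<eta>"
proof -
  have c: "continuous_on {\<alpha>..\<beta>} (\<lambda>t. \<rho> (t - p))"
    by (rule continuous_on_compose2[OF \<rho>(1)]) (auto intro!: continuous_intros)
  have int: "(\<lambda>t. \<rho> (t - p)) integrable_on {\<alpha>..\<beta>}" "(\<lambda>t. d t * \<rho> (t - p)) integrable_on {\<alpha>..\<beta>}"
    by (auto intro!: integrable_continuous_real continuous_intros cont c)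
  have "integral {\<alpha>..\<beta>} (\<lambda>t. d t * \<rho> (t - p)) - d p
      = integral {\<alpha>..\<beta>} (\<lambda>t. d t * \<rho> (t - p)) - integral {\<alpha>..\<beta>} (\<lambda>t. d p * \<rho> (t - p))"
    using one by simp
  also have "\<dots> = integral {\<alpha>..\<beta>} (\<lambda>t. d t * \<rho> (t - p) - d p * \<rho> (t - p))"
    using int by (intro integral_diff[symmetric] integrable_on_mult_right) auto
  also have "\<bar>\<dots>\<bar> \<le> integral {\<alpha>..\<beta>} (\<lambda>t. \<eta> * \<rho> (t - p))"
  proof (rule integral_norm_bound_integral[where 'a = real, unfolded real_norm_def])
    show "(\<lambda>t. d t * \<rho> (t - p) - d p * \<rho> (t - p)) integrable_on {\<alpha>..\<beta>}"
      using int by (intro integrable_diff integrable_on_mult_right) auto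
    show "(\<lambda>t. \<eta> * \<rho> (t - p)) integrable_on {\<alpha>..\<beta>}"
      using int by (intro integrable_on_mult_right) auto
    fix t assume t: "t \<in> {\<alpha>..\<beta>}"
    show "\<bar>d t * \<rho> (t - p) - d p * \<rho> (t - p)\<bar> \<le> \<eta> * \<rho> (t - p)"
    proof (cases "\<bar>t - p\<bar> \<le> \<epsilon>")
      case True
      have "\<bar>d t * \<rho> (t - p) - d p * \<rho> (t - p)\<bar> = \<bar>d t - d p\<bar> * \<rho> (t - p)"
        using \<rho>(2)[of "t - p"] by (simp flip: left_diff_distrib add: abs_mult)
      also have "\<dots> \<le> \<eta> * \<rho> (t - p)" using close[OF t True] \<rho>(2) by (intro mult_right_mono) auto
      finally show ?thesis .
    qed (use supp in auto)
  qed
  also have "\<dots> = \<eta>" using one by simp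
  finally show ?thesis .
qed

text \<open>The combination \<open>(r - q) H(t - p) + (p - r) H(t - q) + (q - p) H(t - r)\<close> of three hinges vanishes on
  the right as well, because the coefficients are orthogonal to affine functions. It is therefore
  an admissible test function, and its second derivative is a combination of three mollifiers. Letting
  the width of the hinges tend to zero evaluates \<open>d\<close> at the three points.\<close>

lemma three_point_relation:
  fixes d :: "real \<Rightarrow> real"
  assumes cont: "continuous_on {a<..<b} d"
    and orth: "\<And>\<alpha> \<beta> Z. a < \<alpha> \<Longrightarrow> \<alpha> < \<beta> \<Longrightarrow> \<beta> < b \<Longrightarrow> test_family \<alpha> \<beta> Z \<Longrightarrow>
      integral {\<alpha>..\<beta>} (\<lambda>t. d t * Z 2 t) = 0"
    and pqr: "p \<in> {a<..<b}" "q \<in> {a<..<b}" "r \<in> {a<..<b}"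
  shows "(r - q) * d p + (p - r) * d q + (q - p) * d r = 0"
proof -
  define s where "s = \<bar>r - q\<bar> + \<bar>p - r\<bar> + \<bar>q - p\<bar>"
  define l where "l = min p (min q r)"
  define u where "u = max p (max q r)"
  define \<alpha> where "\<alpha> = (a + l) / 2"
  define \<beta> where "\<beta> = (u + b) / 2"
  have ab: "a < \<alpha>" "\<alpha> < l" "l \<le> u" "u < \<beta>" "\<beta> < b"
    using pqr by (auto simp: \<alpha>_def \<beta>_def l_def u_def)
  have cont': "continuous_on {\<alpha>..\<beta>} d" by (rule continuous_on_subset[OF cont]) (use ab in auto)
  have bound: "\<bar>(r - q) * d p + (p - r) * d q + (q - p) * d r\<bar> \<le> s * \<eta>" if "0 < \<eta>" for \<eta>
  proof -
    have close: "\<exists>e>0. \<forall>t\<in>{\<alpha>..\<beta>}. \<bar>t - x\<bar> \<le> e \<longrightarrow> \<bar>d t - d x\<bar> \<le> \<eta>" if x: "x \<in> {\<alpha>..\<beta>}" for x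
    proof -
      obtain e where "0 < e" "\<forall>t\<in>{\<alpha>..\<beta>}. dist t x < e \<longrightarrow> dist (d t) (d x) < \<eta>"
        using cont'[unfolded continuous_on_iff, rule_format, OF x \<open>0 < \<eta>\<close>] by (elim exE conjE)
      then have e: "0 < e" "\<And>t. t \<in> {\<alpha>..\<beta>} \<Longrightarrow> dist t x < e \<Longrightarrow> dist (d t) (d x) < \<eta>" by simp_all
      show ?thesis
      proof (intro exI[of _ "e/2"] conjI ballI impI)
        fix t assume "t \<in> {\<alpha>..\<beta>}" "\<bar>t - x\<bar> \<le> e / 2"
        then have "dist (d t) (d x) < \<eta>" using e(1) by (intro e(2)) (auto simp: dist_real_def)
        then show "\<bar>d t - d x\<bar> \<le> \<eta>" by (simp add: dist_real_def)
      qed (use e in auto)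
    qed
    have mem: "p \<in> {\<alpha>..\<beta>}" "q \<in> {\<alpha>..\<beta>}" "r \<in> {\<alpha>..\<beta>}" using ab by (auto simp: l_def u_def)
    obtain e1 where e1: "0 < e1" "\<forall>t\<in>{\<alpha>..\<beta>}. \<bar>t - p\<bar> \<le> e1 \<longrightarrow> \<bar>d t - d p\<bar> \<le> \<eta>"
      using close[OF mem(1)] by (elim exE conjE)
    obtain e2 where e2: "0 < e2" "\<forall>t\<in>{\<alpha>..\<beta>}. \<bar>t - q\<bar> \<le> e2 \<longrightarrow> \<bar>d t - d q\<bar> \<le> \<eta>"
      using close[OF mem(2)] by (elim exE conjE)
    obtain e3 where e3: "0 < e3" "\<forall>t\<in>{\<alpha>..\<beta>}. \<bar>t - r\<bar> \<le> e3 \<longrightarrow> \<bar>d t - d r\<bar> \<le> \<eta>"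
      using close[OF mem(3)] by (elim exE conjE)
    note e = e1(1) e2(1) e3(1)
    define \<epsilon> where "\<epsilon> = Min {e1, e2, e3, (l - \<alpha>) / 2, (\<beta> - u) / 2}"
    have le: "\<epsilon> \<le> y" if "y \<in> {e1, e2, e3, (l - \<alpha>) / 2, (\<beta> - u) / 2}" for y
      unfolding \<epsilon>_def by (rule Min_le) (use that in simp_all)
    have \<epsilon>: "0 < \<epsilon>" "\<epsilon> \<le> e1" "\<epsilon> \<le> e2" "\<epsilon> \<le> e3" "\<epsilon> \<le> (l - \<alpha>) / 2" "\<epsilon> \<le> (\<beta> - u) / 2"
      by (simp add: \<epsilon>_def e ab) (rule le; simp)+
    obtain H c where hinge: "smooth_hinge \<epsilon> c H" by (rule smooth_hinge_exists[OF \<epsilon>(1)])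
    then have H: "smooth_family H" "\<And>t. t \<le> - \<epsilon> \<Longrightarrow> H 0 t = 0" "\<And>t. \<epsilon> \<le> t \<Longrightarrow> H 0 t = t + c"
      "\<And>t. t \<le> - \<epsilon> \<Longrightarrow> H 1 t = 0" "\<And>t. \<epsilon> \<le> t \<Longrightarrow> H 1 t = 1"
      "\<And>t. 0 \<le> H 2 t" "\<And>t. \<epsilon> \<le> \<bar>t\<bar> \<Longrightarrow> H 2 t = 0"
      by (simp_all only: smooth_hinge_def)
    have cH: "continuous_on UNIV (H 2)" by (rule smooth_family_continuous[OF H(1)])
    define Z where "Z = (\<lambda>k t. (r - q) * H k (t - p) + (p - r) * H k (t - q) + (q - p) * H k (t - r))"
    have derH: "((\<lambda>t. H k (t - x)) has_real_derivative H (Suc k) (t - x)) (at t)" for k x t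
    proof -
      have inner: "((\<lambda>t. t - x) has_real_derivative 1) (at t)"
        using DERIV_diff[OF DERIV_ident DERIV_const] by simp
      have "(H k has_real_derivative H (Suc k) (t - x)) (at (t - x))"
        using H(1) by (simp add: smooth_family_def)
      from DERIV_chain2[where g = "\<lambda>t. t - x", OF this inner] show ?thesis by simp
    qed
    have Zsmooth: "smooth_family Z"
      unfolding smooth_family_def Z_def by (intro allI DERIV_add DERIV_cmult derH)
    have Z0: "Z 0 t = 0" if "t \<in> {..<l - \<epsilon>} \<union> {u + \<epsilon><..}" for t
    proof (cases "t < l - \<epsilon>")
      case True
      then show ?thesis by (simp add: Z_def H(2) l_def)
    next
      case False
      then have "u + \<epsilon> < t" using that by auto
      then have "Z 0 t = (r - q) * (t - p + c) + (p - r) * (t - q + c) + (q - p) * (t - r + c)"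
        by (simp add: Z_def H(3) u_def)
      then show ?thesis by (simp add: algebra_simps)
    qed
    have tf: "test_family \<alpha> \<beta> Z"
      unfolding test_family_def
    proof (intro conjI allI impI Zsmooth)
      fix k t assume "t \<notin> {\<alpha><..<\<beta>}"
      then have "t \<in> {..<l - \<epsilon>} \<union> {u + \<epsilon><..}" using \<epsilon> ab by auto
      then show "Z k t = 0"
        by (rule smooth_family_derivative_zero[OF Zsmooth _ Z0, rotated 2]) auto
    qed
    have zero: "integral {\<alpha>..\<beta>} (\<lambda>t. d t * Z 2 t) = 0"
      by (rule orth[OF ab(1) _ ab(5) tf]) (use ab in auto)
    define J where "J = (\<lambda>x. integral {\<alpha>..\<beta>} (\<lambda>t. d t * H 2 (t - x)))"
    have J: "\<bar>J x - d x\<bar> \<le> \<eta>" if x: "x \<in> {l..u}" "\<And>t. t \<in> {\<alpha>..\<beta>} \<Longrightarrow> \<bar>t - x\<bar> \<le> \<epsilon> \<Longrightarrow> \<bar>d t - d x\<bar> \<le> \<eta>" for x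
      unfolding J_def
    proof (rule mollifier_approximates[OF cont' cH H(6,7) _ x(2)])
      have "((\<lambda>t. H 2 (t - x)) has_integral H 1 (\<beta> - x) - H 1 (\<alpha> - x)) {\<alpha>..\<beta>}"
        using ab
        by (intro fundamental_theorem_of_calculus, linarith)
          (simp flip: has_real_derivative_iff_has_vector_derivative,
            use derH[of 1 x] in \<open>simp add: numeral_2_eq_2 has_field_derivative_at_within\<close>)
      moreover have "H 1 (\<beta> - x) = 1" by (rule H(5)) (use x ab \<epsilon> in auto)
      moreover have "H 1 (\<alpha> - x) = 0" by (rule H(4)) (use x ab \<epsilon> in auto)
      ultimately show "integral {\<alpha>..\<beta>} (\<lambda>t. H 2 (t - x)) = 1" by (simp add: integral_unique)
    qed
    have lu: "p \<in> {l..u}" "q \<in> {l..u}" "r \<in> {l..u}" by (auto simp: l_def u_def)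
    have Jp: "\<bar>J p - d p\<bar> \<le> \<eta>"
      by (rule J[OF lu(1)], rule e1(2)[rule_format], assumption, erule order_trans, rule \<epsilon>(2))
    have Jq: "\<bar>J q - d q\<bar> \<le> \<eta>"
      by (rule J[OF lu(2)], rule e2(2)[rule_format], assumption, erule order_trans, rule \<epsilon>(3))
    have Jr: "\<bar>J r - d r\<bar> \<le> \<eta>"
      by (rule J[OF lu(3)], rule e3(2)[rule_format], assumption, erule order_trans, rule \<epsilon>(4))
    have int: "(\<lambda>t. d t * H 2 (t - x)) integrable_on {\<alpha>..\<beta>}" for x
      by (intro integrable_continuous_real continuous_intros cont' continuous_on_compose2[OF cH])
        (auto intro!: continuous_intros)
    have "((\<lambda>t. (r - q) * (d t * H 2 (t - p)) + (p - r) * (d t * H 2 (t - q)) + (q - p) * (d t * H 2 (t - r)))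
        has_integral (r - q) * J p + (p - r) * J q + (q - p) * J r) {\<alpha>..\<beta>}"
      unfolding J_def by (intro has_integral_add has_integral_mult_right integrable_integral int)
    moreover have "(\<lambda>t. (r - q) * (d t * H 2 (t - p)) + (p - r) * (d t * H 2 (t - q)) + (q - p) * (d t * H 2 (t - r)))
        = (\<lambda>t. d t * Z 2 t)" by (rule ext) (simp add: Z_def algebra_simps)
    ultimately have "(r - q) * J p + (p - r) * J q + (q - p) * J r = 0"
      using zero by (simp add: integral_unique)
    then have "(r - q) * d p + (p - r) * d q + (q - p) * d r
      = (r - q) * (d p - J p) + (p - r) * (d q - J q) + (q - p) * (d r - J r)"
      by (simp add: algebra_simps)
    also have "\<bar>\<dots>\<bar> \<le> \<bar>r - q\<bar> * \<bar>d p - J p\<bar> + \<bar>p - r\<bar> * \<bar>d q - J q\<bar> + \<bar>q - p\<bar> * \<bar>d r - J r\<bar>"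
      unfolding abs_mult[symmetric] by linarith
    also have "\<dots> \<le> \<bar>r - q\<bar> * \<eta> + \<bar>p - r\<bar> * \<eta> + \<bar>q - p\<bar> * \<eta>"
      using Jp Jq Jr by (intro add_mono mult_left_mono) (auto simp: abs_minus_commute)
    finally show ?thesis by (simp add: s_def algebra_simps)
  qed
  show ?thesis
  proof (rule ccontr)
    assume ne: "\<not> ?thesis"
    define m where "m = \<bar>(r - q) * d p + (p - r) * d q + (q - p) * d r\<bar>"
    have m: "0 < m" using ne by (simp add: m_def)
    have "0 \<le> s" by (simp add: s_def)
    have "m \<le> s * (m / (2 * (s + 1)))" unfolding m_def
      by (rule bound) (use m \<open>0 \<le> s\<close> in \<open>auto simp: m_def\<close>)
    also have "\<dots> \<le> m / 2" using m \<open>0 \<le> s\<close> by (simp add: field_simps)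
    finally show False using m by simp
  qed
qed

text \<open>Subtract a double antiderivative \<open>V\<^sub>0\<close> of \<open>h\<close>. The difference is orthogonal to all second derivatives
  of test functions, so by the three point relation it is the affine interpolation of its values at
  two fixed points.\<close>

lemma weak_second_derivative_is_classical:
  fixes v h :: "real \<Rightarrow> real"
  assumes ab: "a < b" and v: "continuous_on {a<..<b} v" and h: "continuous_on {a<..<b} h"
    and weak: "\<And>\<alpha> \<beta> Z. a < \<alpha> \<Longrightarrow> \<alpha> < \<beta> \<Longrightarrow> \<beta> < b \<Longrightarrow> test_family \<alpha> \<beta> Z \<Longrightarrow>
      integral {\<alpha>..\<beta>} (\<lambda>t. v t * Z 2 t) = integral {\<alpha>..\<beta>} (\<lambda>t. h t * Z 0 t)"
  obtains v' where "\<And>t. t \<in> {a<..<b} \<Longrightarrow> (v has_real_derivative v' t) (at t)"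
    "\<And>t. t \<in> {a<..<b} \<Longrightarrow> (v' has_real_derivative h t) (at t)"
proof -
  have anti: "\<exists>F. \<forall>x\<in>{a<..<b}. (F has_real_derivative f x) (at x)"
    if "continuous_on {a<..<b} f" for f :: "real \<Rightarrow> real"
  proof -
    have "\<exists>F. \<forall>x :: real. ereal a < ereal x \<longrightarrow> ereal x < ereal b \<longrightarrow> (F has_vector_derivative f x) (at x)"
      by (rule einterval_antiderivative)
        (use that ab in \<open>auto simp: continuous_on_eq_continuous_at\<close>)
    then obtain F where "\<forall>x :: real. ereal a < ereal x \<longrightarrow> ereal x < ereal b \<longrightarrow> (F has_vector_derivative f x) (at x)" ..
    then show ?thesis
      by (intro exI[of _ F]) (simp add: has_real_derivative_iff_has_vector_derivative)
  qed
  obtain V1 where V1: "\<And>x. x \<in> {a<..<b} \<Longrightarrow> (V1 has_real_derivative h x) (at x)"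
    using anti[OF h] by blast
  have cV1: "continuous_on {a<..<b} V1"
    by (rule DERIV_continuous_on[where D = h]) (rule has_field_derivative_at_within[OF V1])
  obtain V0 where V0: "\<And>x. x \<in> {a<..<b} \<Longrightarrow> (V0 has_real_derivative V1 x) (at x)"
    using anti[OF cV1] by blast
  have cV0: "continuous_on {a<..<b} V0"
    by (rule DERIV_continuous_on[where D = V1]) (rule has_field_derivative_at_within[OF V0])
  define d where "d = (\<lambda>t. v t - V0 t)"
  have orth: "integral {\<alpha>..\<beta>} (\<lambda>t. d t * Z 2 t) = 0"
    if \<alpha>\<beta>: "a < \<alpha>" "\<alpha> < \<beta>" "\<beta> < b" and Z: "test_family \<alpha> \<beta> Z" for \<alpha> \<beta> Z
  proof -
    have sub: "{\<alpha>..\<beta>} \<subseteq> {a<..<b}" using \<alpha>\<beta> by auto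
    have Zs: "smooth_family Z" and Zend: "Z k \<alpha> = 0" "Z k \<beta> = 0" for k
      using Z by (auto simp: test_family_def)
    have der: "(Z k has_real_derivative Z (Suc k) t) (at t)" for k t
      using Zs by (simp add: smooth_family_def)
    have "((\<lambda>t. V0 t * Z 2 t - h t * Z 0 t) has_integral
        (V0 \<beta> * Z 1 \<beta> - V1 \<beta> * Z 0 \<beta>) - (V0 \<alpha> * Z 1 \<alpha> - V1 \<alpha> * Z 0 \<alpha>)) {\<alpha>..\<beta>}"
    proof (rule fundamental_theorem_of_calculus)
      fix t assume "t \<in> {\<alpha>..\<beta>}"
      then have t: "t \<in> {a<..<b}" using sub by blast
      have "((\<lambda>t. V0 t * Z 1 t - V1 t * Z 0 t) has_real_derivative
          (V1 t * Z 1 t + Z (Suc 1) t * V0 t) - (h t * Z 0 t + Z (Suc 0) t * V1 t)) (at t)"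
        by (intro DERIV_diff DERIV_mult V0[OF t] V1[OF t] der)
      then have "((\<lambda>t. V0 t * Z 1 t - V1 t * Z 0 t) has_real_derivative V0 t * Z 2 t - h t * Z 0 t) (at t)"
        by (simp add: algebra_simps numeral_2_eq_2)
      then show "((\<lambda>t. V0 t * Z 1 t - V1 t * Z 0 t) has_vector_derivative V0 t * Z 2 t - h t * Z 0 t)
          (at t within {\<alpha>..\<beta>})"
        unfolding has_real_derivative_iff_has_vector_derivative[symmetric]
        by (rule has_field_derivative_at_within)
    qed (use \<alpha>\<beta> in auto)
    then have parts: "integral {\<alpha>..\<beta>} (\<lambda>t. V0 t * Z 2 t - h t * Z 0 t) = 0"
      by (simp add: Zend integral_unique)
    have int: "(\<lambda>t. f t * Z k t) integrable_on {\<alpha>..\<beta>}" if "continuous_on {a<..<b} f" for f k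
      by (intro integrable_continuous_real continuous_intros smooth_family_continuous[OF Zs]
          continuous_on_subset[OF that sub])
    have "integral {\<alpha>..\<beta>} (\<lambda>t. d t * Z 2 t)
        = integral {\<alpha>..\<beta>} (\<lambda>t. v t * Z 2 t) - integral {\<alpha>..\<beta>} (\<lambda>t. V0 t * Z 2 t)"
      unfolding d_def left_diff_distrib by (intro integral_diff int v cV0)
    also have "integral {\<alpha>..\<beta>} (\<lambda>t. V0 t * Z 2 t) = integral {\<alpha>..\<beta>} (\<lambda>t. h t * Z 0 t)"
      using parts integral_diff[OF int[OF cV0] int[OF h], of 2 0] by simp
    finally show ?thesis using weak[OF \<alpha>\<beta> Z] by simp
  qed
  have cd: "continuous_on {a<..<b} d" unfolding d_def by (intro continuous_intros v cV0)
  define p where "p = (2 * a + b) / 3"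
  define q where "q = (a + 2 * b) / 3"
  have pq: "p \<in> {a<..<b}" "q \<in> {a<..<b}" "p < q" using ab by (auto simp: p_def q_def)
  define B where "B = (d q - d p) / (q - p)"
  have affine: "d t = d p + B * (t - p)" if "t \<in> {a<..<b}" for t
  proof -
    have "(t - q) * d p + (p - t) * d q + (q - p) * d t = 0"
    proof (rule three_point_relation[where d = d and a = a and b = b])
      show "integral {\<alpha>..\<beta>} (\<lambda>t. d t * Z 2 t) = 0"
        if "a < \<alpha>" "\<alpha> < \<beta>" "\<beta> < b" "test_family \<alpha> \<beta> Z" for \<alpha> \<beta> Z
        using that by (rule orth)
    qed (use cd pq that in auto)
    then have "(q - p) * d t = (q - p) * d p + (d q - d p) * (t - p)"
      by (simp add: algebra_simps)
    also have "d q - d p = (q - p) * B" using pq(3) by (simp add: B_def)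
    also have "(q - p) * d p + (q - p) * B * (t - p) = (q - p) * (d p + B * (t - p))"
      by (simp add: algebra_simps)
    finally have "(q - p) * d t = (q - p) * (d p + B * (t - p))" .
    then show ?thesis using pq(3) by simp
  qed
  show thesis
  proof (rule that[of "\<lambda>t. V1 t + B"])
    fix t assume t: "t \<in> {a<..<b}"
    show "((\<lambda>t. V1 t + B) has_real_derivative h t) (at t)"
      using DERIV_add[OF V1[OF t] DERIV_const] by simp
    have "((\<lambda>t. V0 t + (d p + B * (t - p))) has_real_derivative V1 t + B) (at t)"
      using V0[OF t] by (auto intro!: derivative_eq_intros)
    then show "(v has_real_derivative V1 t + B) (at t)"
      by (rule has_field_derivative_transform_within_open[where S = "{a<..<b}"])
        (use t affine in \<open>auto simp: d_def algebra_simps\<close>)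
  qed
qed

section \<open>Radial test functions and their Laplacian\<close>

text \<open>With \<open>k = 0\<close>, \<open>m = 1\<close> this is the test function \<open>\<zeta> \<bar>x\<bar> / \<bar>x\<bar>\<close>; the other atoms occur in its derivatives.\<close>

definition radial_atom :: "(nat \<Rightarrow> real \<Rightarrow> real) \<Rightarrow> nat \<Rightarrow> nat \<Rightarrow> 'a::euclidean_space \<Rightarrow> real" where
  "radial_atom Z k m x = Z k (norm x) * inverse (norm x) ^ m"

text \<open>A class of functions that contains the atoms and is closed under partial derivatives; hence all its
  members are infinitely differentiable.\<close>

inductive radial_class :: "(nat \<Rightarrow> real \<Rightarrow> real) \<Rightarrow> ('a::euclidean_space \<Rightarrow> real) \<Rightarrow> bool" for Z where
  atom: "radial_class Z (radial_atom Z k m)"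
| coord: "radial_class Z f \<Longrightarrow> radial_class Z (\<lambda>x. f x * (x \<bullet> b))"
| add: "radial_class Z f \<Longrightarrow> radial_class Z g \<Longrightarrow> radial_class Z (\<lambda>x. f x + g x)"
| scale: "radial_class Z f \<Longrightarrow> radial_class Z (\<lambda>x. c * f x)"

text \<open>At the origin the formula also holds, since the atoms vanish in a neighbourhood of it.\<close>

lemma has_derivative_radial_atom:
  fixes x :: "'a::euclidean_space"
  assumes Z: "test_family \<alpha> \<beta> Z" and \<alpha>: "0 < \<alpha>"
  shows "(radial_atom Z k m has_derivative
    (\<lambda>h. (radial_atom Z (Suc k) (Suc m) x - real m * radial_atom Z k (Suc (Suc m)) x) * (x \<bullet> h))) (at x)"
proof (cases "x = 0")
  case True
  have zero: "radial_atom Z j n y = 0" if "y \<in> ball 0 \<alpha>" for j n and y :: 'a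
    using Z that by (simp add: radial_atom_def test_family_def)
  have "((\<lambda>_. 0) has_derivative (\<lambda>_. 0)) (at x)" by simp
  then have "(radial_atom Z k m has_derivative (\<lambda>_. 0)) (at x)"
    by (rule has_derivative_transform_within_open[where s = "ball 0 \<alpha>"])
      (use True \<alpha> zero in auto)
  then show ?thesis using True by simp
next
  case False
  define r where "r = norm x"
  have r: "0 < r" using False by (simp add: r_def)
  have norm_der: "(norm has_derivative (\<lambda>h. (x \<bullet> h) * inverse r)) (at x)"
    using has_derivative_norm[OF False] by (simp add: sgn_div_norm r_def mult.commute inner_commute)
  have "(Z k has_real_derivative Z (Suc k) r) (at r)"
    using Z by (simp add: test_family_def smooth_family_def)
  moreover have inv: "((\<lambda>r. inverse r) has_real_derivative - (inverse r * inverse r)) (at r)"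
    using DERIV_inverse[of r UNIV] r by (simp add: power2_eq_square)
  ultimately have der: "((\<lambda>r. Z k r * inverse r ^ m) has_real_derivative
      Z (Suc k) r * inverse r ^ m + (real m * (- (inverse r * inverse r) * inverse r ^ (m - Suc 0))) * Z k r) (at r)"
    by (intro DERIV_mult DERIV_power)
  have eq: "Z (Suc k) r * inverse r ^ m + (real m * (- (inverse r * inverse r) * inverse r ^ (m - Suc 0))) * Z k r
      = Z (Suc k) r * inverse r ^ m - real m * Z k r * inverse r ^ Suc m"
    by (cases m) (simp_all add: algebra_simps)
  have "((\<lambda>r. Z k r * inverse r ^ m) has_derivative
      (*) (Z (Suc k) r * inverse r ^ m - real m * Z k r * inverse r ^ Suc m)) (at (norm x))"
    using der[unfolded eq has_field_derivative_def] unfolding r_def .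
  from has_derivative_compose[OF norm_der this]
  have "((\<lambda>x. Z k (norm x) * inverse (norm x) ^ m) has_derivative
      (\<lambda>h. (Z (Suc k) r * inverse r ^ m - real m * Z k r * inverse r ^ Suc m) * ((x \<bullet> h) * inverse r))) (at x)" .
  moreover have "(\<lambda>h. (Z (Suc k) r * inverse r ^ m - real m * Z k r * inverse r ^ Suc m) * ((x \<bullet> h) * inverse r))
      = (\<lambda>h. (radial_atom Z (Suc k) (Suc m) x - real m * radial_atom Z k (Suc (Suc m)) x) * (x \<bullet> h))"
    by (rule ext) (simp add: radial_atom_def r_def algebra_simps)
  ultimately show ?thesis by (simp add: radial_atom_def[abs_def])
qed

lemma partial_deriv_eq:
  "(f has_derivative f') (at x) \<Longrightarrow> partial_deriv b f x = f' b"
  unfolding partial_deriv_def by (simp add: frechet_derivative_at[symmetric])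

lemma radial_class_derivative:
  assumes Z: "test_family \<alpha> \<beta> Z" "0 < \<alpha>" and f: "radial_class Z f"
  shows "\<exists>F. (\<forall>x. (f has_derivative F x) (at x)) \<and> (\<forall>b. radial_class Z (\<lambda>x. F x b))"
  using f
proof induction
  case (atom k m)
  have "radial_class Z (\<lambda>x::'a. (radial_atom Z (Suc k) (Suc m) x + (- real m) * radial_atom Z k (Suc (Suc m)) x) * (x \<bullet> b))" for b
    by (intro radial_class.intros)
  then have "radial_class Z (\<lambda>x::'a. (radial_atom Z (Suc k) (Suc m) x - real m * radial_atom Z k (Suc (Suc m)) x) * (x \<bullet> b))" for b
    by simp
  then show ?case using has_derivative_radial_atom[OF Z, of k m] by (intro exI conjI allI)
next
  case (coord f b)
  then obtain F where F: "\<forall>x. (f has_derivative F x) (at x)" "\<forall>b. radial_class Z (\<lambda>x. F x b)" by (elim exE conjE)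
  have "((\<lambda>x. f x * (x \<bullet> b)) has_derivative (\<lambda>h. f x * (h \<bullet> b) + F x h * (x \<bullet> b))) (at x)" for x
    using F(1) by (intro has_derivative_mult has_derivative_inner_left has_derivative_ident) simp
  moreover have "radial_class Z (\<lambda>x. f x * (h \<bullet> b) + F x h * (x \<bullet> b))" for h
    using radial_class.add[OF radial_class.scale[OF coord.hyps, of "h \<bullet> b"] radial_class.coord[OF F(2)[rule_format]]]
    by (simp add: mult.commute)
  ultimately show ?case by (intro exI conjI allI)
next
  case (add f g)
  from add.IH(1) obtain F where F: "\<forall>x. (f has_derivative F x) (at x)" "\<forall>b. radial_class Z (\<lambda>x. F x b)" by (elim exE conjE)
  from add.IH(2) obtain G where G: "\<forall>x. (g has_derivative G x) (at x)" "\<forall>b. radial_class Z (\<lambda>x. G x b)" by (elim exE conjE)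
  show ?case
    using F G by (intro exI[of _ "\<lambda>x h. F x h + G x h"] conjI allI has_derivative_add radial_class.add) simp_all
next
  case (scale f c)
  then obtain F where F: "\<forall>x. (f has_derivative F x) (at x)" "\<forall>b. radial_class Z (\<lambda>x. F x b)" by (elim exE conjE)
  show ?case
    using F by (intro exI[of _ "\<lambda>x h. c * F x h"] conjI allI has_derivative_mult_right radial_class.scale) simp_all
qed

lemma radial_class_Ck:
  fixes f :: "'a::euclidean_space \<Rightarrow> real"
  assumes Z: "test_family \<alpha> \<beta> Z" "0 < \<alpha>"
  shows "radial_class Z f \<Longrightarrow> Ck k f"
proof (induction k arbitrary: f)
  case 0
  obtain F where "\<forall>x. (f has_derivative F x) (at x)"
    using radial_class_derivative[OF Z 0] by (elim exE conjE)
  then show ?case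
    by (auto intro!: continuous_at_imp_continuous_on has_derivative_continuous simp: continuous_on_eq_continuous_at)
next
  case (Suc k)
  obtain F where F: "\<forall>x. (f has_derivative F x) (at x)" "\<forall>b. radial_class Z (\<lambda>x. F x b)"
    using radial_class_derivative[OF Z Suc.prems] by (elim exE conjE)
  have "partial_deriv b f = (\<lambda>x. F x b)" for b
    using F(1) by (intro ext partial_deriv_eq) simp
  then show ?case using F Suc.IH by (auto simp: differentiable_def)
qed

lemma radial_class_support:
  assumes Z: "test_family \<alpha> \<beta> Z" and f: "radial_class Z f" and x: "norm x \<notin> {\<alpha><..<\<beta>}"
  shows "f x = 0"
  using f by induction (use Z x in \<open>auto simp: test_family_def radial_atom_def\<close>)

lemma radial_test_function:
  fixes f :: "'a::euclidean_space \<Rightarrow> real"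
  assumes Z: "test_family \<alpha> \<beta> Z" "0 < \<alpha>" "\<beta> < R" and f: "radial_class Z f"
  shows "test_function (ball 0 R) f"
  unfolding test_function_def
proof (intro conjI allI)
  show "Ck k f" for k by (rule radial_class_Ck[OF Z(1,2) f])
  show "\<exists>K. compact K \<and> K \<subseteq> ball 0 R \<and> (\<forall>x. x \<notin> K \<longrightarrow> f x = 0)"
    using Z(3) by (intro exI[of _ "cball 0 \<beta>"] conjI allI impI radial_class_support[OF Z(1) f])
      (auto simp: dist_norm)
qed

text \<open>In dimension three the Laplacian of a radial \<open>\<phi>\<close> is \<open>(r * \<phi>)'' / r\<close>, which is why the factor
  \<open>1 / \<bar>x\<bar>\<close> in the test function removes all lower order terms.\<close>

lemma radial_laplacian:
  fixes x :: "real^3"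
  assumes Z: "test_family \<alpha> \<beta> Z" "0 < \<alpha>"
  shows "(\<Sum>b\<in>Basis. partial_deriv b (partial_deriv b (radial_atom Z 0 1)) x) = radial_atom Z 2 1 x"
proof -
  define A where "A = (\<lambda>x::real^3. radial_atom Z 1 2 x - radial_atom Z 0 3 x)"
  define B where "B = radial_atom Z 2 3 x - 3 * radial_atom Z 1 4 x + 3 * radial_atom Z 0 5 x"
  have first: "partial_deriv b (radial_atom Z 0 1) = (\<lambda>x. A x * (x \<bullet> b))" for b
    using has_derivative_radial_atom[OF Z, of 0 1]
    by (intro ext, subst partial_deriv_eq) (simp_all add: A_def numeral_2_eq_2 numeral_3_eq_3)
  have "(A has_derivative (\<lambda>h. (radial_atom Z (Suc 1) (Suc 2) x - real 2 * radial_atom Z 1 (Suc (Suc 2)) x) * (x \<bullet> h)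
      - (radial_atom Z (Suc 0) (Suc 3) x - real 3 * radial_atom Z 0 (Suc (Suc 3)) x) * (x \<bullet> h))) (at x)"
    unfolding A_def by (intro has_derivative_diff has_derivative_radial_atom[OF Z])
  moreover have "(\<lambda>h. (radial_atom Z (Suc 1) (Suc 2) x - real 2 * radial_atom Z 1 (Suc (Suc 2)) x) * (x \<bullet> h)
      - (radial_atom Z (Suc 0) (Suc 3) x - real 3 * radial_atom Z 0 (Suc (Suc 3)) x) * (x \<bullet> h)) = (\<lambda>h. B * (x \<bullet> h))"
    by (rule ext) (simp add: B_def algebra_simps eval_nat_numeral)
  ultimately have "(A has_derivative (\<lambda>h. B * (x \<bullet> h))) (at x)" by simp
  then have "((\<lambda>x. A x * (x \<bullet> b)) has_derivative (\<lambda>h. A x * (h \<bullet> b) + B * (x \<bullet> h) * (x \<bullet> b))) (at x)" for b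
    by (intro has_derivative_mult has_derivative_inner_left has_derivative_ident)
  then have second: "partial_deriv b (partial_deriv b (radial_atom Z 0 1)) x
      = A x * (b \<bullet> b) + B * (x \<bullet> b) * (x \<bullet> b)" for b
    unfolding first by (rule partial_deriv_eq)
  have "(\<Sum>b\<in>Basis. partial_deriv b (partial_deriv b (radial_atom Z 0 1)) x)
      = (\<Sum>b\<in>(Basis :: (real^3) set). A x + B * ((x \<bullet> b) * (x \<bullet> b)))"
    unfolding second by (intro sum.cong) (auto simp: inner_same_Basis)
  also have "\<dots> = 3 * A x + B * (norm x)\<^sup>2"
    by (simp add: sum.distrib sum_distrib_left[symmetric] euclidean_inner[symmetric] power2_norm_eq_inner)
  also have "\<dots> = radial_atom Z 2 1 x"
  proof (cases "x = 0")
    case True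
    have "Z k 0 = 0" for k using Z by (simp add: test_family_def)
    then show ?thesis using True by (simp add: A_def B_def radial_atom_def)
  next
    case False
    then show ?thesis
      by (simp add: A_def B_def radial_atom_def field_simps eval_nat_numeral)
  qed
  finally show ?thesis .
qed

section \<open>Polar coordinates and radial representatives\<close>

text \<open>The density of the norm under Lebesgue measure: the area of the sphere of radius \<open>r\<close>, expressed by the
  volume of the unit ball.\<close>

abbreviation radial_weight :: "real \<Rightarrow> real" where
  "radial_weight r \<equiv> 3 * measure lborel (ball (0::real^3) 1) * r\<^sup>2"

lemma emeasure_shell:
  "emeasure lborel (ball (0::real^3) 1 - cball 0 t) = (\<integral>\<^sup>+r\<in>{0..1} \<inter> {t<..}. ennreal (radial_weight r) \<partial>lborel)"
proof -
  define \<omega> where "\<omega> = measure lborel (ball (0::real^3) 1)"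
  have \<omega>: "0 \<le> \<omega>" by (simp add: \<omega>_def)
  have FTC: "(\<integral>\<^sup>+r. ennreal (radial_weight r) * indicator {s..1} r \<partial>lborel) = ennreal (\<omega> - \<omega> * s ^ 3)"
    if "0 \<le> s" "s \<le> 1" for s
  proof -
    have "(\<integral>\<^sup>+r. ennreal (3 * \<omega> * r\<^sup>2) * indicator {s..1} r \<partial>lborel) = ennreal (\<omega> * 1 ^ 3 - \<omega> * s ^ 3)"
      by (rule nn_integral_FTC_Icc[where F = "\<lambda>r. \<omega> * r ^ 3"])
        (use that \<omega> in \<open>auto intro!: derivative_eq_intros simp: power2_eq_square\<close>)
    then show ?thesis by (simp add: \<omega>_def)
  qed
  have ball_meas: "emeasure lborel (cball (0::real^3) s) = ennreal (\<omega> * s ^ 3)" if "0 \<le> s" for s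
  proof -
    have "emeasure lborel (cball (0::real^3) s) = ennreal (unit_ball_vol 3 * s ^ 3)"
      using emeasure_cball[OF that, of "0::real^3"] by simp
    moreover have "\<omega> = unit_ball_vol 3" using content_ball[of 1 "0::real^3"] by (simp add: \<omega>_def)
    ultimately show ?thesis by simp
  qed
  have unit: "emeasure lborel (ball (0::real^3) 1) = ennreal \<omega>"
    using emeasure_ball[of 1 "0::real^3"] content_ball[of 1 "0::real^3"] by (simp add: \<omega>_def)
  consider "t < 0" | "0 \<le> t" "t \<le> 1" | "1 < t" by linarith
  then show ?thesis
  proof cases
    case 1
    then have "ball (0::real^3) 1 - cball 0 t = ball 0 1" "{0..1} \<inter> {t<..} = {0..1::real}" by auto
    then show ?thesis using unit FTC[of 0] by simp
  next
    case 2
    have "emeasure lborel (ball (0::real^3) 1 - cball 0 t) = ennreal (\<omega> - \<omega> * t ^ 3)"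
    proof (cases "t = 1")
      case True
      then have empty: "ball (0::real^3) 1 - cball 0 t = {}" by auto
      show ?thesis unfolding empty using True by simp
    next
      case False
      then have "cball (0::real^3) t \<subseteq> ball 0 1" using 2 by auto
      then have "emeasure lborel (ball (0::real^3) 1 - cball 0 t)
          = emeasure lborel (ball (0::real^3) 1) - emeasure lborel (cball (0::real^3) t)"
        by (intro emeasure_Diff) (auto simp: ball_meas 2)
      then show ?thesis using 2 \<omega> by (simp add: unit ball_meas ennreal_minus)
    qed
    moreover have "(\<integral>\<^sup>+r\<in>{0..1} \<inter> {t<..}. ennreal (radial_weight r) \<partial>lborel)
        = (\<integral>\<^sup>+r. ennreal (radial_weight r) * indicator {t..1} r \<partial>lborel)"
    proof (rule nn_integral_cong_AE)
      show "AE r in lborel. ennreal (radial_weight r) * indicator ({0..1} \<inter> {t<..}) r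
          = ennreal (radial_weight r) * indicator {t..1} r"
        using AE_lborel_singleton[of t]
        by eventually_elim (use 2 in \<open>auto split: split_indicator\<close>)
    qed
    ultimately show ?thesis using FTC 2 by simp
  next
    case 3
    then have "ball (0::real^3) 1 - cball 0 t = {}" "{0..1} \<inter> {t<..} = {}" by auto
    then show ?thesis by (simp only:) simp
  qed
qed

text \<open>Two finite measures on the line that agree on all half-lines \<open>{t<..}\<close> are equal; on half-lines
  both sides are volumes of shells.\<close>

lemma distr_norm_ball:
  "distr (density lborel (indicator (ball (0::real^3) 1))) borel norm
    = density lborel (\<lambda>r. ennreal (radial_weight r) * indicator {0..1} r)" (is "?M = ?N")
proof (rule measure_eqI_lessThan)
  show "sets ?M = sets borel" "sets ?N = sets borel" by simp_all
  have eq: "emeasure ?M {t<..} = emeasure lborel (ball (0::real^3) 1 - cball 0 t)" for t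
  proof -
    have "emeasure ?M {t<..} = emeasure (density lborel (indicator (ball (0::real^3) 1))) (norm -` {t<..})"
      by (subst emeasure_distr) auto
    also have "\<dots> = (\<integral>\<^sup>+x. indicator (ball (0::real^3) 1) x * indicator (norm -` {t<..}) x \<partial>lborel)"
      by (rule emeasure_density) (auto simp: vimage_def intro!: borel_measurable_indicator)
    also have "\<dots> = (\<integral>\<^sup>+x. indicator (ball (0::real^3) 1 - cball 0 t) x \<partial>lborel)"
      by (intro nn_integral_cong) (auto split: split_indicator)
    finally show ?thesis by simp
  qed
  show "emeasure ?M {t<..} < \<infinity>" for t
  proof -
    have "emeasure lborel (ball (0::real^3) 1 - cball 0 t) \<le> emeasure lborel (ball (0::real^3) 1)"
      by (intro emeasure_mono) auto
    also have "\<dots> < \<infinity>" using emeasure_ball[of 1 "0::real^3"] by simp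
    finally show ?thesis by (simp add: eq)
  qed
  show "emeasure ?M {t<..} = emeasure ?N {t<..}" for t
    unfolding eq emeasure_shell
    by (subst emeasure_density) (auto intro!: nn_integral_cong split: split_indicator)
qed

lemma integral_radial:
  fixes F :: "real \<Rightarrow> real"
  assumes F: "continuous_on {\<alpha>..\<beta>} F" "\<And>r. r \<notin> {\<alpha>..\<beta>} \<Longrightarrow> F r = 0" and \<alpha>\<beta>: "0 < \<alpha>" "\<beta> < 1"
  shows "(LINT x|lebesgue_on B1. F (norm x)) = 3 * measure lborel B1 * integral {\<alpha>..\<beta>} (\<lambda>r. r\<^sup>2 * F r)"
proof -
  have "(\<lambda>r. indicator {\<alpha>..\<beta>} r *\<^sub>R F r) \<in> borel_measurable borel"
    by (rule borel_measurable_continuous_on_indicator) (use F in auto)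
  moreover have "(\<lambda>r. indicator {\<alpha>..\<beta>} r *\<^sub>R F r) = F"
    using F(2) by (intro ext) (auto split: split_indicator)
  ultimately have meas: "F \<in> borel_measurable borel" by simp
  have "(LINT x|lebesgue_on B1. F (norm x)) = (LINT x|lebesgue. indicator B1 x * F (norm x))"
    by (subst integral_restrict_space) auto
  also have "\<dots> = (LINT x|lborel. indicator B1 x * F (norm x))"
  proof (rule integral_completion)
    have "(\<lambda>x::real^3. F (norm x)) \<in> borel_measurable lborel"
      by (rule measurable_compose[OF _ meas]) simp
    then show "(\<lambda>x. indicator B1 x * F (norm x)) \<in> borel_measurable lborel"
      by (intro borel_measurable_times borel_measurable_indicator) auto
  qed
  also have "\<dots> = (LINT x|density lborel (\<lambda>x. ennreal (indicator B1 x)). F (norm x))"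
    using meas by (subst integral_real_density) (auto intro!: borel_measurable_indicator)
  also have "\<dots> = (LINT r|distr (density lborel (indicator B1)) borel norm. F r)"
    using meas by (subst integral_distr) (auto simp: ennreal_indicator)
  also have "\<dots> = (LINT r|density lborel (\<lambda>r. ennreal (radial_weight r * indicator {0..1} r)). F r)"
    unfolding distr_norm_ball
    by (rule arg_cong[where f = "\<lambda>M. integral\<^sup>L M F"], rule arg_cong[where f = "density lborel"])
      (auto split: split_indicator)
  also have "\<dots> = (LINT r|lborel. radial_weight r * indicator {0..1} r * F r)"
    using meas by (subst integral_real_density) auto
  also have "\<dots> = (LINT r:{\<alpha>..\<beta>}|lborel. radial_weight r * F r)"
    unfolding set_lebesgue_integral_def
    by (intro Bochner_Integration.integral_cong) (use F(2) \<alpha>\<beta> in \<open>auto split: split_indicator\<close>)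
  also have "\<dots> = integral {\<alpha>..\<beta>} (\<lambda>r. radial_weight r * F r)"
  proof (rule set_borel_integral_eq_integral(2))
    show "set_integrable lborel {\<alpha>..\<beta>} (\<lambda>r. radial_weight r * F r)"
      by (rule borel_integrable_atLeastAtMost') (intro continuous_intros F(1))
  qed
  also have "\<dots> = 3 * measure lborel B1 * integral {\<alpha>..\<beta>} (\<lambda>r. r\<^sup>2 * F r)"
    by (simp add: mult.assoc)
  finally show ?thesis .
qed

lemma AE_lebesgue_on_iff_negligible:
  assumes "S \<in> sets lebesgue"
  shows "(AE x in lebesgue_on S. P x) \<longleftrightarrow> negligible {x \<in> S. \<not> P x}"
  using assms
  by (simp add: AE_restrict_space_iff completion.AE_iff_null_sets negligible_iff_null_sets)

lemma continuous_AE_zero_imp_zero: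
  fixes f :: "'a::euclidean_space \<Rightarrow> real"
  assumes "open S" "continuous_on S f" "negligible {x \<in> S. f x \<noteq> 0}" "x \<in> S"
  shows "f x = 0"
proof -
  have "open {x \<in> S. f x \<noteq> 0}"
    using continuous_open_preimage[OF assms(2,1), of "- {0}"] by (simp add: vimage_def Int_def open_Compl)
  then have "{x \<in> S. f x \<noteq> 0} = {}" using open_not_negligible assms(3) by blast
  with assms(4) show ?thesis by blast
qed

text \<open>For an orthogonal map \<open>T\<close> with \<open>T x = y\<close>, the continuous function \<open>w z - w (T z)\<close> vanishes almost
  everywhere, since \<open>T\<close> preserves null sets, and hence everywhere.\<close>

lemma AE_radial_continuous_imp_radial:
  fixes w :: "real^'n \<Rightarrow> real"
  assumes cont: "continuous_on (ball 0 R) w" and radial: "AE x in lebesgue_on (ball 0 R). w x = f (norm x)"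
    and xy: "x \<in> ball 0 R" "norm x = norm y"
  shows "w x = w y"
proof -
  obtain T where T: "orthogonal_transformation T" "T x = y"
    using orthogonal_transformation_exists[OF xy(2)] .
  have normT: "norm (T z) = norm z" for z by (rule orthogonal_transformation_norm[OF T(1)])
  have linT: "linear T" using T(1) by (rule orthogonal_transformation_linear)
  define N where "N = {z \<in> ball 0 R. w z \<noteq> f (norm z)}"
  have N: "negligible N" using radial by (simp add: N_def AE_lebesgue_on_iff_negligible)
  have inv: "orthogonal_transformation (inv T)" by (rule orthogonal_transformation_inv[OF T(1)])
  have "negligible (inv T ` N)"
    by (rule negligible_differentiable_image_negligible[OF order_refl N])
      (rule linear_imp_differentiable_on[OF orthogonal_transformation_linear[OF inv]])
  with N have null: "negligible (N \<union> inv T ` N)" by (rule negligible_Un)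
  have "w x - w (T x) = 0"
  proof (rule continuous_AE_zero_imp_zero[OF open_ball _ _ xy(1)])
    have "continuous_on (ball 0 R) T" by (rule linear_continuous_on) (simp add: linT linear_linear)
    then show "continuous_on (ball 0 R) (\<lambda>z. w z - w (T z))"
      by (intro continuous_intros cont continuous_on_compose2[OF cont]) (auto simp: normT)
    show "negligible {z \<in> ball 0 R. w z - w (T z) \<noteq> 0}"
    proof (rule negligible_subset[OF null], rule subsetI)
      fix z assume z: "z \<in> {z \<in> ball 0 R. w z - w (T z) \<noteq> 0}"
      show "z \<in> N \<union> inv T ` N"
      proof (rule ccontr)
        assume no: "z \<notin> N \<union> inv T ` N"
        have "z = inv T (T z)"
          by (simp add: orthogonal_transformation_inj[OF T(1)])
        then have "T z \<notin> N" using no by blast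
        moreover have "T z \<in> ball 0 R" using z by (simp add: normT)
        ultimately have "w (T z) = f (norm z)" by (simp add: N_def normT)
        moreover have "w z = f (norm z)" using no z by (simp add: N_def)
        ultimately show False using z by simp
      qed
    qed
  qed
  then show ?thesis using T(2) by simp
qed

section \<open>The radial equation of a weak solution\<close>

lemma test_function_partial_deriv:
  assumes \<phi>: "test_function \<Omega> \<phi>" and b: "b \<in> Basis"
  shows "test_function \<Omega> (partial_deriv b \<phi>)"
  unfolding test_function_def
proof (intro conjI allI)
  show "Ck k (partial_deriv b \<phi>)" for k
    using \<phi> b Ck.simps(2)[of k \<phi>] by (simp add: test_function_def del: Ck.simps)
  obtain K where K: "compact K" "K \<subseteq> \<Omega>" "\<And>x. x \<notin> K \<Longrightarrow> \<phi> x = 0"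
    using \<phi> unfolding test_function_def by blast
  have "partial_deriv b \<phi> x = 0" if "x \<notin> K" for x
  proof -
    have "((\<lambda>_. 0) has_derivative (\<lambda>_. 0)) (at x)" by simp
    then have "(\<phi> has_derivative (\<lambda>_. 0)) (at x)"
      by (rule has_derivative_transform_within_open[where s = "- K"])
        (use K that in \<open>auto simp: compact_imp_closed open_Compl\<close>)
    then show ?thesis by (simp add: partial_deriv_eq)
  qed
  then show "\<exists>K. compact K \<and> K \<subseteq> \<Omega> \<and> (\<forall>x. x \<notin> K \<longrightarrow> partial_deriv b \<phi> x = 0)"
    using K by blast
qed

lemma test_function_continuous:
  "test_function \<Omega> \<phi> \<Longrightarrow> continuous_on UNIV \<phi>"
  unfolding test_function_def by (metis Ck.simps(1))

lemma test_function_bounded: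
  assumes "test_function \<Omega> \<phi>"
  obtains C where "\<And>x. \<bar>\<phi> x\<bar> \<le> C"
proof -
  obtain K where K: "compact K" "\<And>x. x \<notin> K \<Longrightarrow> \<phi> x = 0"
    using assms unfolding test_function_def by blast
  have "bounded (\<phi> ` K)"
    using K(1) test_function_continuous[OF assms]
    by (intro compact_imp_bounded compact_continuous_image) (auto intro: continuous_on_subset)
  then obtain C where C: "\<And>y. y \<in> \<phi> ` K \<Longrightarrow> norm y \<le> C" unfolding bounded_iff by blast
  show thesis
  proof (rule that[of "max C 0"])
    fix x
    show "\<bar>\<phi> x\<bar> \<le> max C 0"
    proof (cases "x \<in> K")
      case True
      then have "norm (\<phi> x) \<le> C" by (intro C imageI)
      then show ?thesis by simp
    qed (simp add: K(2))
  qed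
qed

lemma continuous_imp_measurable_lebesgue_on:
  fixes f :: "'a::euclidean_space \<Rightarrow> real"
  assumes "f \<in> borel_measurable borel"
  shows "f \<in> borel_measurable (lebesgue_on S)"
  by (intro measurable_restrict_space1 measurable_completion) (use assms in simp)

lemma integrable_square_integrable_times_test:
  fixes f :: "real^3 \<Rightarrow> real"
  assumes f: "square_integrable B1 f" and \<phi>: "test_function B1 \<phi>"
  shows "integrable (lebesgue_on B1) (\<lambda>x. f x * \<phi> x)"
proof -
  have meas: "f \<in> borel_measurable (lebesgue_on B1)"
    and int: "integrable (lebesgue_on B1) (\<lambda>x. (f x)\<^sup>2)"
    using f by (auto simp: square_integrable_def)
  have m\<phi>: "\<phi> \<in> borel_measurable (lebesgue_on B1)"
    by (rule continuous_imp_measurable_lebesgue_on[OF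
        borel_measurable_continuous_onI[OF test_function_continuous[OF \<phi>]]])
  obtain C where C: "\<And>x. \<bar>\<phi> x\<bar> \<le> C" using test_function_bounded[OF \<phi>] by blast
  interpret finite_measure "lebesgue_on B1" by (rule finite_measure_lebesgue_on) simp
  have "integrable (lebesgue_on B1) (\<lambda>x. (1 + (f x)\<^sup>2) * C)"
    by (intro integrable_mult_left Bochner_Integration.integrable_add int integrable_const)
  then show ?thesis
  proof (rule Bochner_Integration.integrable_bound)
    show "(\<lambda>x. f x * \<phi> x) \<in> borel_measurable (lebesgue_on B1)"
      by (intro borel_measurable_times meas m\<phi>)
    show "AE x in lebesgue_on B1. norm (f x * \<phi> x) \<le> norm ((1 + (f x)\<^sup>2) * C)"
    proof (rule AE_I2)
      fix x
      have "0 \<le> (\<bar>f x\<bar> - 1)\<^sup>2" by simp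
      then have "2 * \<bar>f x\<bar> \<le> 1 + (f x)\<^sup>2" by (simp add: power2_diff)
      then have "\<bar>f x\<bar> \<le> 1 + (f x)\<^sup>2" by linarith
      then have "\<bar>f x\<bar> * \<bar>\<phi> x\<bar> \<le> (1 + (f x)\<^sup>2) * C"
        using C[of x] by (intro mult_mono) auto
      then show "norm (f x * \<phi> x) \<le> norm ((1 + (f x)\<^sup>2) * C)"
        using order_trans[OF abs_ge_zero C[of x]] by (simp add: abs_mult)
    qed
  qed
qed

text \<open>The weak gradient is tested with the partial derivatives of \<open>\<phi>\<close>, which moves both derivatives to the
  test function. All products are integrable because \<open>\<bar>f\<bar> \<le> 1 + f\<^sup>2\<close> on a set of finite measure.\<close>

lemma weak_form_very_weak:
  fixes u :: "real^3 \<Rightarrow> real"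
  assumes u: "u \<in> H1 B1" and \<phi>: "test_function B1 \<phi>"
  shows "(LINT x|lebesgue_on B1. weak_grad B1 u x \<bullet> classical_grad \<phi> x + l * u x * \<phi> x)
    = (LINT x|lebesgue_on B1. u x * (l * \<phi> x - (\<Sum>b\<in>Basis. partial_deriv b (partial_deriv b \<phi>) x)))"
proof -
  define g where "g = weak_grad B1 u"
  have "square_integrable B1 g \<and> is_weak_grad B1 u g"
    unfolding g_def weak_grad_def 
    by (rule someI_ex[where P = "\<lambda>g. square_integrable B1 g \<and> is_weak_grad B1 u g"]) (use u in \<open>simp add: H1_def\<close>)
  then have g: "square_integrable B1 g" "is_weak_grad B1 u g" by auto
  have squ: "square_integrable B1 u" using u by (simp add: H1_def)
  have sqg: "square_integrable B1 (\<lambda>x. g x \<bullet> b)" if "b \<in> Basis" for b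
    unfolding square_integrable_def
  proof
    have gm: "g \<in> borel_measurable (lebesgue_on B1)" using g(1) by (simp add: square_integrable_def)
    then show m: "(\<lambda>x. g x \<bullet> b) \<in> borel_measurable (lebesgue_on B1)"
      by (intro borel_measurable_inner) auto
    have "integrable (lebesgue_on B1) (\<lambda>x. (norm (g x))\<^sup>2)" using g(1) by (simp add: square_integrable_def)
    then show "integrable (lebesgue_on B1) (\<lambda>x. (norm (g x \<bullet> b))\<^sup>2)"
    proof (rule Bochner_Integration.integrable_bound)
      show "(\<lambda>x. (norm (g x \<bullet> b))\<^sup>2) \<in> borel_measurable (lebesgue_on B1)"
        by (intro borel_measurable_power borel_measurable_norm m measurable_compose[OF m])
      show "AE x in lebesgue_on B1. norm ((norm (g x \<bullet> b))\<^sup>2) \<le> norm ((norm (g x))\<^sup>2)"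
      proof (rule AE_I2)
        fix x
        have "(g x \<bullet> b)\<^sup>2 \<le> (norm (g x))\<^sup>2"
          by (rule iffD1[OF abs_le_square_iff]) (simp add: Basis_le_norm[OF that])
        then show "norm ((norm (g x \<bullet> b))\<^sup>2) \<le> norm ((norm (g x))\<^sup>2)" by simp
      qed
    qed
  qed
  define D where "D = (\<lambda>b. partial_deriv b \<phi>)"
  have tD: "test_function B1 (D b)" if "b \<in> Basis" for b
    unfolding D_def by (rule test_function_partial_deriv[OF \<phi> that])
  have tDD: "test_function B1 (partial_deriv b (D b))" if "b \<in> Basis" for b
    by (rule test_function_partial_deriv[OF tD[OF that] that])
  note i1 = integrable_square_integrable_times_test[OF sqg tD]
  note i2 = integrable_square_integrable_times_test[OF squ tDD]
  note i3 = integrable_square_integrable_times_test[OF squ \<phi>]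
  have grad: "g x \<bullet> classical_grad \<phi> x = (\<Sum>b\<in>Basis. (g x \<bullet> b) * D b x)" for x
    by (simp add: classical_grad_def D_def inner_sum_right mult.commute)
  have "(LINT x|lebesgue_on B1. g x \<bullet> classical_grad \<phi> x + l * u x * \<phi> x)
      = (LINT x|lebesgue_on B1. (\<Sum>b\<in>Basis. (g x \<bullet> b) * D b x) + l * (u x * \<phi> x))"
    by (simp add: grad mult.assoc)
  also have "\<dots> = (\<Sum>b\<in>Basis. LINT x|lebesgue_on B1. (g x \<bullet> b) * D b x) + l * (LINT x|lebesgue_on B1. u x * \<phi> x)"
    by (subst Bochner_Integration.integral_add)
      (auto intro!: Bochner_Integration.integrable_sum i1 i3 Bochner_Integration.integral_sum)
  also have "(\<Sum>b\<in>Basis. LINT x|lebesgue_on B1. (g x \<bullet> b) * D b x)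
      = (\<Sum>b\<in>Basis. - (LINT x|lebesgue_on B1. u x * partial_deriv b (D b) x))"
    using g(2) tD unfolding is_weak_grad_def by (intro sum.cong) auto
  also have "\<dots> + l * (LINT x|lebesgue_on B1. u x * \<phi> x)
      = (LINT x|lebesgue_on B1. l * (u x * \<phi> x)) - (LINT x|lebesgue_on B1. (\<Sum>b\<in>Basis. u x * partial_deriv b (D b) x))"
    by (subst Bochner_Integration.integral_sum) (auto intro!: i2 simp: sum_negf)
  also have "\<dots> = (LINT x|lebesgue_on B1. l * (u x * \<phi> x) - (\<Sum>b\<in>Basis. u x * partial_deriv b (D b) x))"
    by (intro Bochner_Integration.integral_diff[symmetric] Bochner_Integration.integrable_sum i2 integrable_mult_right i3)
  also have "\<dots> = (LINT x|lebesgue_on B1. u x * (l * \<phi> x - (\<Sum>b\<in>Basis. partial_deriv b (D b) x)))"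
    by (intro Bochner_Integration.integral_cong) (simp_all add: right_diff_distrib sum_distrib_left mult.left_commute)
  finally show ?thesis by (simp add: g_def D_def)
qed

lemma radial_measurable:
  fixes F :: "real \<Rightarrow> real"
  assumes F: "continuous_on {\<alpha>..\<beta>} F" "\<And>r. r \<notin> {\<alpha>..\<beta>} \<Longrightarrow> F r = 0"
  shows "(\<lambda>x::'a::euclidean_space. F (norm x)) \<in> borel_measurable (lebesgue_on S)"
proof -
  have "(\<lambda>r. indicator {\<alpha>..\<beta>} r *\<^sub>R F r) \<in> borel_measurable borel"
    by (rule borel_measurable_continuous_on_indicator) (use F in auto)
  moreover have "(\<lambda>r. indicator {\<alpha>..\<beta>} r *\<^sub>R F r) = F"
    using F(2) by (intro ext) (auto split: split_indicator)
  ultimately have "F \<in> borel_measurable borel" by simp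
  then show ?thesis
    by (intro continuous_imp_measurable_lebesgue_on measurable_compose[OF borel_measurable_norm]) simp_all
qed

text \<open>Testing with \<open>\<zeta> \<bar>x\<bar> / \<bar>x\<bar>\<close> and using polar coordinates gives the equation for \<open>v r = r * W r\<close> in the sense
  of distributions on the open interval, hence classically. Since the right-hand side \<open>h\<close> is continuous
  up to 0, its integral from 0 extends \<open>v'\<close> continuously to the origin.\<close>

lemma radial_weak_solution_ode:
  fixes u rhs :: "real^3 \<Rightarrow> real" and W H :: "real \<Rightarrow> real"
  assumes u: "u \<in> H1 B1" "AE x in lebesgue_on B1. u x = W (norm x)"
    and rhs: "rhs \<in> borel_measurable (lebesgue_on B1)" "AE x in lebesgue_on B1. rhs x = H (norm x)"
    and W: "continuous_on {0..<1} W" and H: "continuous_on {0..<1} H"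
    and weak: "\<And>\<phi>. test_function B1 \<phi> \<Longrightarrow>
      (LINT x|lebesgue_on B1. weak_grad B1 u x \<bullet> classical_grad \<phi> x + l * u x * \<phi> x)
      = (LINT x|lebesgue_on B1. rhs x * \<phi> x)"
  shows "\<exists>v'. (\<forall>\<rho><1. continuous_on {0..\<rho>} v') \<and> (\<forall>r\<in>{0<..<1}.
    ((\<lambda>r. r * W r) has_real_derivative v' r) (at r) \<and>
    (v' has_real_derivative l * (r * W r) - r * H r) (at r))"
proof -
  define v where "v = (\<lambda>r. r * W r)"
  define h where "h = (\<lambda>r. l * (r * W r) - r * H r)"
  have ch: "continuous_on {0..<1} h" unfolding h_def by (intro continuous_intros W H)
  have cv: "continuous_on {0..<1} v" unfolding v_def by (intro continuous_intros W)
  have very_weak: "integral {\<alpha>..\<beta>} (\<lambda>t. v t * Z 2 t) = integral {\<alpha>..\<beta>} (\<lambda>t. h t * Z 0 t)"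
    if ab: "0 < \<alpha>" "\<alpha> < \<beta>" "\<beta> < 1" and Z: "test_family \<alpha> \<beta> Z" for \<alpha> \<beta> Z
  proof -
    have sub: "{\<alpha>..\<beta>} \<subseteq> {0..<1}" using ab by auto
    have Zs: "smooth_family Z" and Zz: "\<And>k t. t \<notin> {\<alpha><..<\<beta>} \<Longrightarrow> Z k t = 0"
      using Z by (auto simp: test_family_def)
    note cZ = smooth_family_continuous[OF Zs]
    define \<phi> :: "real^3 \<Rightarrow> real" where "\<phi> = radial_atom Z 0 1"
    have \<phi>: "test_function B1 \<phi>"
      unfolding \<phi>_def by (rule radial_test_function[OF Z ab(1,3) radial_class.atom])
    define F1 where "F1 = (\<lambda>r. W r * (l * (Z 0 r * inverse r) - Z 2 r * inverse r))"
    define F2 where "F2 = (\<lambda>r. H r * (Z 0 r * inverse r))"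
    have F1: "continuous_on {\<alpha>..\<beta>} F1" "\<And>r. r \<notin> {\<alpha>..\<beta>} \<Longrightarrow> F1 r = 0"
      unfolding F1_def using ab Zz
      by (auto intro!: continuous_intros continuous_on_subset[OF W sub] cZ)
    have F2: "continuous_on {\<alpha>..\<beta>} F2" "\<And>r. r \<notin> {\<alpha>..\<beta>} \<Longrightarrow> F2 r = 0"
      unfolding F2_def using ab Zz
      by (auto intro!: continuous_intros continuous_on_subset[OF H sub] cZ)
    have m\<phi>: "\<phi> \<in> borel_measurable (lebesgue_on B1)"
      by (rule continuous_imp_measurable_lebesgue_on[OF
          borel_measurable_continuous_onI[OF test_function_continuous[OF \<phi>]]])
    have lap: "u x * (l * \<phi> x - (\<Sum>b\<in>Basis. partial_deriv b (partial_deriv b \<phi>) x))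
        = u x * (l * (Z 0 (norm x) * inverse (norm x)) - Z 2 (norm x) * inverse (norm x))" for x
      unfolding \<phi>_def radial_laplacian[OF Z ab(1)] by (simp add: radial_atom_def)
    have "(LINT x|lebesgue_on B1. F1 (norm x))
        = (LINT x|lebesgue_on B1. u x * (l * \<phi> x - (\<Sum>b\<in>Basis. partial_deriv b (partial_deriv b \<phi>) x)))"
    proof (rule integral_cong_AE)
      show "(\<lambda>x. F1 (norm x)) \<in> borel_measurable (lebesgue_on B1)" by (rule radial_measurable[OF F1])
      have "(\<lambda>x. partial_deriv b (partial_deriv b \<phi>) x) \<in> borel_measurable (lebesgue_on B1)"
        if "b \<in> Basis" for b
        by (intro continuous_imp_measurable_lebesgue_on borel_measurable_continuous_onI
            test_function_continuous[OF test_function_partial_deriv[OF test_function_partial_deriv[OF \<phi> that] that]])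
      moreover have "u \<in> borel_measurable (lebesgue_on B1)"
        using u(1) by (simp add: H1_def square_integrable_def)
      ultimately show "(\<lambda>x. u x * (l * \<phi> x - (\<Sum>b\<in>Basis. partial_deriv b (partial_deriv b \<phi>) x)))
          \<in> borel_measurable (lebesgue_on B1)"
        by (intro borel_measurable_times borel_measurable_diff borel_measurable_sum borel_measurable_const m\<phi>)
      show "AE x in lebesgue_on B1. F1 (norm x)
          = u x * (l * \<phi> x - (\<Sum>b\<in>Basis. partial_deriv b (partial_deriv b \<phi>) x))"
        using u(2) unfolding lap by eventually_elim (simp add: F1_def)
    qed
    also have "\<dots> = (LINT x|lebesgue_on B1. rhs x * \<phi> x)"
      using weak[OF \<phi>] weak_form_very_weak[OF u(1) \<phi>, of l] by simp
    also have "\<dots> = (LINT x|lebesgue_on B1. F2 (norm x))"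
    proof (rule integral_cong_AE)
      show "(\<lambda>x. F2 (norm x)) \<in> borel_measurable (lebesgue_on B1)" by (rule radial_measurable[OF F2])
      show "(\<lambda>x. rhs x * \<phi> x) \<in> borel_measurable (lebesgue_on B1)"
        by (intro borel_measurable_times rhs(1) m\<phi>)
      show "AE x in lebesgue_on B1. rhs x * \<phi> x = F2 (norm x)"
        using rhs(2) by eventually_elim (simp add: F2_def \<phi>_def radial_atom_def)
    qed
    finally have F12: "(LINT x|lebesgue_on B1. F1 (norm x)) = (LINT x|lebesgue_on B1. F2 (norm x))" .
    have "3 * measure lborel B1 * integral {\<alpha>..\<beta>} (\<lambda>r. r\<^sup>2 * F1 r)
        = 3 * measure lborel B1 * integral {\<alpha>..\<beta>} (\<lambda>r. r\<^sup>2 * F2 r)"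
    proof -
      have "(LINT x|lebesgue_on B1. F1 (norm x)) = 3 * measure lborel B1 * integral {\<alpha>..\<beta>} (\<lambda>r. r\<^sup>2 * F1 r)"
        by (rule integral_radial[OF F1(1) _ ab(1,3)]) (rule F1(2))
      moreover have "(LINT x|lebesgue_on B1. F2 (norm x)) = 3 * measure lborel B1 * integral {\<alpha>..\<beta>} (\<lambda>r. r\<^sup>2 * F2 r)"
        by (rule integral_radial[OF F2(1) _ ab(1,3)]) (rule F2(2))
      ultimately show ?thesis using F12 by simp
    qed
    moreover have "measure lborel B1 \<noteq> 0" using content_ball_gt_0_iff[of "0::real^3" 1] by simp
    ultimately have eq: "integral {\<alpha>..\<beta>} (\<lambda>r. r\<^sup>2 * F1 r) = integral {\<alpha>..\<beta>} (\<lambda>r. r\<^sup>2 * F2 r)" by simp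
    have int: "(\<lambda>r. f r * Z k r) integrable_on {\<alpha>..\<beta>}" if "continuous_on {0..<1} f" for f k
      by (intro integrable_continuous_real continuous_intros continuous_on_subset[OF that sub] cZ)
    have "integral {\<alpha>..\<beta>} (\<lambda>r. r\<^sup>2 * F1 r) = integral {\<alpha>..\<beta>} (\<lambda>r. l * v r * Z 0 r - v r * Z 2 r)"
      using ab by (intro Henstock_Kurzweil_Integration.integral_cong) (simp add: F1_def v_def field_simps power2_eq_square)
    also have "\<dots> = integral {\<alpha>..\<beta>} (\<lambda>r. l * v r * Z 0 r) - integral {\<alpha>..\<beta>} (\<lambda>r. v r * Z 2 r)"
      by (intro Henstock_Kurzweil_Integration.integral_diff int continuous_intros cv)
    finally have 1: "integral {\<alpha>..\<beta>} (\<lambda>r. r\<^sup>2 * F1 r)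
        = integral {\<alpha>..\<beta>} (\<lambda>r. l * v r * Z 0 r) - integral {\<alpha>..\<beta>} (\<lambda>r. v r * Z 2 r)" .
    have 2: "integral {\<alpha>..\<beta>} (\<lambda>r. r\<^sup>2 * F2 r) = integral {\<alpha>..\<beta>} (\<lambda>r. r * H r * Z 0 r)"
      using ab by (intro Henstock_Kurzweil_Integration.integral_cong) (simp add: F2_def field_simps power2_eq_square)
    have "integral {\<alpha>..\<beta>} (\<lambda>r. h r * Z 0 r) = integral {\<alpha>..\<beta>} (\<lambda>r. l * v r * Z 0 r - r * H r * Z 0 r)"
      by (simp add: h_def v_def algebra_simps)
    also have "\<dots> = integral {\<alpha>..\<beta>} (\<lambda>r. l * v r * Z 0 r) - integral {\<alpha>..\<beta>} (\<lambda>r. r * H r * Z 0 r)"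
      by (intro Henstock_Kurzweil_Integration.integral_diff int continuous_intros cv H)
    finally show ?thesis using eq 1 2 by simp
  qed
  have open_sub: "{0<..<1} \<subseteq> {0..<1::real}" by auto
  obtain v1 where v1: "\<And>t. t \<in> {0<..<1} \<Longrightarrow> (v has_real_derivative v1 t) (at t)"
    "\<And>t. t \<in> {0<..<1} \<Longrightarrow> (v1 has_real_derivative h t) (at t)"
  proof (rule weak_second_derivative_is_classical[where a = 0 and b = 1 and v = v and h = h])
    show "continuous_on {0<..<1} v" "continuous_on {0<..<1} h"
      by (rule continuous_on_subset[OF cv open_sub], rule continuous_on_subset[OF ch open_sub])
  qed (use very_weak in auto)
  \<comment> \<open>Agrees with \<open>v1\<close> inside the interval (normalised at the arbitrary point 1/2) and is continuous at 0.\<close>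
  define v' where "v' = (\<lambda>r. v1 (1/2) + (integral {0..r} h - integral {0..1/2} h))"
  have der': "(v' has_real_derivative h r) (at r within {0..\<rho>})" if "\<rho> < 1" "r \<in> {0..\<rho>}" for r \<rho>
  proof -
    have "((\<lambda>r. integral {0..r} h) has_real_derivative h r) (at r within {0..\<rho>})"
      by (rule integral_has_real_derivative[OF _ that(2)])
        (rule continuous_on_subset[OF ch], use that in auto)
    then show ?thesis unfolding v'_def
      by (auto intro!: derivative_eq_intros)
  qed
  have der: "(v' has_real_derivative h r) (at r)" if r: "r \<in> {0<..<1}" for r
  proof -
    define \<rho> where "\<rho> = (r + 1) / 2"
    have "(v' has_real_derivative h r) (at r within {0..\<rho>})" by (rule der') (use r in \<open>auto simp: \<rho>_def\<close>)
    moreover have "at r within {0..\<rho>} = at r"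
      by (rule at_within_Icc_at) (use r in \<open>auto simp: \<rho>_def\<close>)
    ultimately show ?thesis by simp
  qed
  have v'_eq: "v' r = v1 r" if r: "r \<in> {0<..<1}" for r
  proof -
    have "\<exists>c. \<forall>x\<in>{0<..<1::real}. v' x - v1 x = c"
    proof (rule has_field_derivative_zero_constant)
      show "((\<lambda>x. v' x - v1 x) has_real_derivative 0) (at x within {0<..<1})" if "x \<in> {0<..<1}" for x
        using DERIV_diff[OF der[OF that] v1(2)[OF that]] by (simp add: has_field_derivative_at_within)
    qed auto
    then obtain c where c: "\<And>x. x \<in> {0<..<1} \<Longrightarrow> v' x - v1 x = c" by blast
    have "v' (1/2) - v1 (1/2) = 0" by (simp add: v'_def)
    then have "c = 0" using c[of "1/2"] by simp
    with c[OF r] show ?thesis by simp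
  qed
  show ?thesis
  proof (intro exI[of _ v'] conjI allI impI ballI)
    show "continuous_on {0..\<rho>} v'" if "\<rho> < 1" for \<rho>
      by (rule DERIV_continuous_on[where D = h]) (rule der'[OF that])
    show "((\<lambda>r. r * W r) has_real_derivative v' r) (at r)" if "r \<in> {0<..<1}" for r
      using v1(1)[OF that] v'_eq[OF that] by (simp add: v_def)
    show "(v' has_real_derivative l * (r * W r) - r * H r) (at r)" if "r \<in> {0<..<1}" for r
      using der[OF that] by (simp add: h_def)
  qed
qed

section \<open>The a priori bound\<close>

text \<open>The profile is read off along a ray.\<close>

lemma continuous_representative_profile:
  fixes w :: "real^'n \<Rightarrow> real"
  assumes cont: "continuous_on (ball 0 R) w" and radial: "AE x in lebesgue_on (ball 0 R). w x = f (norm x)"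
  obtains W where "continuous_on {0..<R} W" "\<And>x. x \<in> ball 0 R \<Longrightarrow> w x = W (norm x)"
proof -
  define e :: "real^'n" where "e = axis undefined 1"
  have e: "norm e = 1" by (simp add: e_def)
  show thesis
  proof (rule that[of "\<lambda>r. w (r *\<^sub>R e)"])
    show "continuous_on {0..<R} (\<lambda>r. w (r *\<^sub>R e))"
      by (rule continuous_on_compose2[OF cont]) (auto intro!: continuous_intros simp: e)
    show "w x = w (norm x *\<^sub>R e)" if "x \<in> ball 0 R" for x
      by (rule AE_radial_continuous_imp_radial[OF cont radial that]) (simp add: e)
  qed
qed

text \<open>The couplings are bounded above by \<open>\<beta>\<close> and below by \<open>- \<epsilon>\<close>, so they enlarge the size of the
  potential by at most \<open>\<beta> + 1\<close> per component but lower it only by \<open>\<epsilon>\<close> per component.\<close>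

lemma coupling_bounds:
  fixes W :: "nat \<Rightarrow> real" and b :: "nat \<Rightarrow> real"
  assumes I: "finite I" "card I \<le> N" and b: "\<And>i. i \<in> I \<Longrightarrow> b i \<in> {-\<epsilon>..\<beta>}" "0 \<le> \<epsilon>" "\<epsilon> \<le> 1" "0 \<le> \<beta>"
    and M: "\<And>i. i \<in> I \<Longrightarrow> \<bar>W i\<bar> \<le> M" "0 \<le> M"
  shows "- (real N * \<epsilon> * M\<^sup>2) \<le> (\<Sum>i\<in>I. b i * (W i)\<^sup>2)"
    and "\<bar>\<Sum>i\<in>I. b i * (W i)\<^sup>2\<bar> \<le> real N * (\<beta> + 1) * M\<^sup>2"
proof -
  have sq: "(W i)\<^sup>2 \<le> M\<^sup>2" if "i \<in> I" for i using M(1)[OF that] abs_le_square_iff[of "W i" M] M(2) by simp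
  have card_le: "real (card I) * c \<le> real N * c" if "0 \<le> c" for c using I that by (simp add: mult_right_mono)
  have "(\<Sum>i\<in>I. - (b i * (W i)\<^sup>2)) \<le> real (card I) * (\<epsilon> * M\<^sup>2)"
  proof (rule sum_bounded_above)
    fix i assume i: "i \<in> I"
    have "- (b i) * (W i)\<^sup>2 \<le> \<epsilon> * M\<^sup>2" using b(1)[OF i] b(2) sq[OF i] by (intro mult_mono) auto
    then show "- (b i * (W i)\<^sup>2) \<le> \<epsilon> * M\<^sup>2" by simp
  qed
  also have "\<dots> \<le> real N * (\<epsilon> * M\<^sup>2)" using b by (intro card_le) simp
  finally show "- (real N * \<epsilon> * M\<^sup>2) \<le> (\<Sum>i\<in>I. b i * (W i)\<^sup>2)" by (simp add: sum_negf mult.assoc)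
  have "\<bar>\<Sum>i\<in>I. b i * (W i)\<^sup>2\<bar> \<le> (\<Sum>i\<in>I. \<bar>b i * (W i)\<^sup>2\<bar>)" by (rule sum_abs)
  also have "\<dots> \<le> real (card I) * ((\<beta> + 1) * M\<^sup>2)"
  proof (rule sum_bounded_above)
    fix i assume i: "i \<in> I"
    have "\<bar>b i\<bar> \<le> \<beta> + 1" using b(1)[OF i] b(2-4) by auto
    then show "\<bar>b i * (W i)\<^sup>2\<bar> \<le> (\<beta> + 1) * M\<^sup>2"
      unfolding abs_mult using sq[OF i] b(4) by (intro mult_mono) auto
  qed
  also have "\<dots> \<le> real N * ((\<beta> + 1) * M\<^sup>2)" using b by (intro card_le) simp
  finally show "\<bar>\<Sum>i\<in>I. b i * (W i)\<^sup>2\<bar> \<le> real N * (\<beta> + 1) * M\<^sup>2" by (simp add: mult.assoc)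
qed

text \<open>The component that attains the joint maximum is the one that will be shown to oscillate.\<close>

lemma joint_maximum:
  fixes W :: "'i \<Rightarrow> real \<Rightarrow> real"
  assumes I: "finite I" "I \<noteq> {}" and cont: "\<And>i. i \<in> I \<Longrightarrow> continuous_on {a..b} (W i)" and "a \<le> b"
  shows "\<exists>M. \<exists>j\<in>I. (\<exists>r\<in>{a..b}. \<bar>W j r\<bar> = M) \<and> (\<forall>i\<in>I. \<forall>r\<in>{a..b}. \<bar>W i r\<bar> \<le> M)"
proof -
  have "\<exists>x\<in>{a..b}. \<forall>r\<in>{a..b}. \<bar>W i r\<bar> \<le> \<bar>W i x\<bar>" if "i \<in> I" for i
    using continuous_attains_sup[OF compact_Icc, of a b "\<lambda>r. \<bar>W i r\<bar>"] cont[OF that] \<open>a \<le> b\<close>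
    by (auto intro: continuous_on_rabs)
  then obtain x where x: "\<And>i. i \<in> I \<Longrightarrow> x i \<in> {a..b}" "\<And>i r. i \<in> I \<Longrightarrow> r \<in> {a..b} \<Longrightarrow> \<bar>W i r\<bar> \<le> \<bar>W i (x i)\<bar>"
    by metis
  define A where "A = (\<lambda>i. \<bar>W i (x i)\<bar>) ` I"
  have A: "finite A" "A \<noteq> {}" using I by (auto simp: A_def)
  obtain j where j: "j \<in> I" "\<bar>W j (x j)\<bar> = Max A" using Max_in[OF A] by (auto simp: A_def)
  show ?thesis
  proof (intro exI[of _ "Max A"] bexI[of _ j] conjI ballI)
    show "\<exists>r\<in>{a..b}. \<bar>W j r\<bar> = Max A" using x(1)[OF j(1)] j(2) by (rule bexI[rotated])
    show "\<bar>W i r\<bar> \<le> Max A" if "i \<in> I" "r \<in> {a..b}" for i r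
      using x(2)[OF that] Max_ge[OF A(1), of "\<bar>W i (x i)\<bar>"] that(1) by (auto simp: A_def)
  qed (rule j(1))
qed

lemma oscillates_imp_alternates:
  assumes w: "\<And>x. x \<in> B1 \<Longrightarrow> w x = W (norm x)" and osc: "oscillates W k \<rho>" and \<rho>: "\<rho> < 1"
  shows "alternates w k"
proof -
  obtain r where r: "0 < r 0" "\<forall>j<k. r j < r (Suc j) \<and> W (r j) * W (r (Suc j)) < 0" "r k < 1"
    using osc \<rho> unfolding oscillates_def by force
  have inc: "r a \<le> r b" if "a \<le> b" "b \<le> k" for a b
    using that
  proof (induction b rule: dec_induct)
    case (step n)
    then have "r n < r (Suc n)" using r(2) by simp
    then show ?case using step by simp
  qed simp
  show ?thesis
  unfolding alternates_def
proof (intro exI conjI)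
  show "\<forall>j<k. \<forall>x y. norm x = r j \<longrightarrow> norm y = r (Suc j) \<longrightarrow> w x * w y < 0"
  proof (intro allI impI)
    fix j and x y :: "real^3"
    assume j: "j < k" and xy: "norm x = r j" "norm y = r (Suc j)"
    have "x \<in> B1" "y \<in> B1" using xy inc[of j k] inc[of "Suc j" k] j r(3) by auto
    then show "w x * w y < 0" using w r(2) j xy by simp
  qed
qed (use r in auto)
qed

theorem theorem1p4:
  fixes N :: nat and lam mu :: "nat \<Rightarrow> real" and P :: "nat \<Rightarrow> nat" and \<beta> :: real
  assumes "N \<ge> 1"
    and "\<And>j. j \<in> {1..N} \<Longrightarrow> lam j > 0"
    and "\<And>j. j \<in> {1..N} \<Longrightarrow> mu j > 0"
    and "\<beta> \<ge> 0"
  shows "\<exists>\<epsilon>\<^sub>0>0. \<exists>C>0. \<forall>b :: nat \<Rightarrow> nat \<Rightarrow> real.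
    (\<forall>i\<in>{1..N}. \<forall>j\<in>{1..N}. i \<noteq> j \<longrightarrow> b i j = b j i \<and> b i j \<in> {-\<epsilon>\<^sub>0..\<beta>}) \<longrightarrow>
    (\<forall>u :: nat \<Rightarrow> real^3 \<Rightarrow> real.
       weak_solution N lam mu b u \<and> (\<forall>j\<in>{1..N}. changes_sign_exactly (u j) (P j)) \<longrightarrow>
       (MAX j\<in>{1..N}. Linf_norm (u j)) \<le> ereal C)"
proof -
  define I where "I = {1..N}"
  have I: "finite I" "I \<noteq> {}" "card I = N" using assms(1) by (auto simp: I_def)
  \<comment> \<open>One set of constants for all components; \<open>k\<close> exceeds every prescribed number of sign changes.\<close>
  define \<mu>0 where "\<mu>0 = Min (mu ` I)"
  define \<Lambda> where "\<Lambda> = sum lam I"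
  define K where "K = sum mu I + real N * (\<beta> + 1) + \<Lambda>"
  define k where "k = Suc (sum P I)"
  have \<mu>0: "0 < \<mu>0" "\<And>j. j \<in> I \<Longrightarrow> \<mu>0 \<le> mu j" using assms(3) I by (auto simp: \<mu>0_def I_def)
  have lam: "0 \<le> lam j" if "j \<in> I" for j using assms(2)[of j] that by (simp add: I_def)
  have \<Lambda>: "0 \<le> \<Lambda>" "\<And>j. j \<in> I \<Longrightarrow> lam j \<le> \<Lambda>"
    unfolding \<Lambda>_def by (rule sum_nonneg, erule lam) (rule member_le_sum; simp add: I(1) lam)
  have summu: "mu j \<le> sum mu I" if "j \<in> I" for j
    using assms(3) I that by (intro member_le_sum) (auto simp: I_def less_imp_le)
  have Pk: "P j < k" if "j \<in> I" for j
    using member_le_sum[of j I P] I that by (simp add: k_def)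
  have K: "0 < K"
  proof -
    have "0 < sum mu I" using assms(3) I by (intro sum_pos) (auto simp: I_def)
    moreover have "0 \<le> real N * (\<beta> + 1)" using assms(4) by simp
    ultimately show ?thesis using \<Lambda>(1) by (simp add: K_def)
  qed
  obtain \<delta> R :: real where \<delta>: "0 < \<delta>" and R: "1 \<le> R" and osc:
    "\<And>W v' Q \<rho> M. R \<le> M \<Longrightarrow> 1/2 \<le> \<rho> \<Longrightarrow> large_profile \<mu>0 K \<delta> M \<rho> W v' Q \<Longrightarrow> oscillates W k \<rho>"
    using large_profile_oscillates[OF \<mu>0(1) K, of k] by metis
  \<comment> \<open>Half of \<open>\<delta> * M\<^sup>2\<close> absorbs the negative couplings, the other half absorbs \<open>lam j\<close> once \<open>M \<ge> C\<close>.\<close>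
  define \<epsilon>0 where "\<epsilon>0 = min 1 (\<delta> / (2 * real N))"
  define C where "C = R + 2 * \<Lambda> / \<delta>"
  have \<epsilon>0: "0 < \<epsilon>0" "\<epsilon>0 \<le> 1" "real N * \<epsilon>0 \<le> \<delta> / 2"
  proof -
    have N: "0 < real N" using assms(1) by simp
    then show "0 < \<epsilon>0" "\<epsilon>0 \<le> 1" using \<delta> by (auto simp: \<epsilon>0_def)
    have "real N * \<epsilon>0 \<le> real N * (\<delta> / (2 * real N))" using N by (intro mult_left_mono) (auto simp: \<epsilon>0_def)
    then show "real N * \<epsilon>0 \<le> \<delta> / 2" using N by simp
  qed
  have C: "0 < C" "R \<le> C" "2 * \<Lambda> / \<delta> \<le> C" using R \<Lambda>(1) \<delta> by (auto simp: C_def add_pos_nonneg)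
  have bound: "Linf_norm (u j) \<le> ereal C"
    if b: "\<And>i j. i \<in> I \<Longrightarrow> j \<in> I \<Longrightarrow> i \<noteq> j \<Longrightarrow> b i j \<in> {-\<epsilon>0..\<beta>}"
      and sol: "weak_solution N lam mu b u" and nodes: "\<And>j. j \<in> I \<Longrightarrow> changes_sign_exactly (u j) (P j)"
      and jI: "j \<in> I" for b u j
  proof -
    have uH: "u j \<in> H1_0_radial" and weak: "\<And>\<phi>. test_function B1 \<phi> \<Longrightarrow>
        (LINT x|lebesgue_on B1. weak_grad B1 (u j) x \<bullet> classical_grad \<phi> x + lam j * u j x * \<phi> x)
        = (LINT x|lebesgue_on B1.
             (mu j * (u j x)^3 + (\<Sum>i\<in>I - {j}. b i j * (u i x)\<^sup>2 * u j x)) * \<phi> x)" if "j \<in> I" for j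
      using sol that by (auto simp: weak_solution_def I_def)
    have uH1: "u j \<in> H1 B1" and um: "u j \<in> borel_measurable (lebesgue_on B1)" if "j \<in> I" for j
      using uH[OF that] by (auto simp: H1_0_radial_def H1_0_def H1_def square_integrable_def)
    define rep where "rep = (\<lambda>j w W. continuous_on {0..<1} W \<and> (\<forall>x\<in>B1. w x = W (norm x)) \<and>
        (AE x in lebesgue_on B1. w x = u j x) \<and> (\<forall>n. alternates w n \<longrightarrow> n \<le> P j))"
    have "\<exists>w W. rep j w W" if jI: "j \<in> I" for j
    proof -
      obtain w where w: "continuous_on B1 w" "AE x in lebesgue_on B1. w x = u j x"
        "\<forall>n. alternates w n \<longrightarrow> n \<le> P j"
        using nodes[OF jI] unfolding changes_sign_exactly_def by blast
      obtain f where f: "AE x in lebesgue_on B1. u j x = f (norm x)"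
        using uH[OF jI] unfolding H1_0_radial_def by blast
      have "AE x in lebesgue_on B1. w x = f (norm x)" using w(2) f by eventually_elim simp
      then obtain W where "continuous_on {0..<1} W" "\<And>x. x \<in> B1 \<Longrightarrow> w x = W (norm x)"
        using continuous_representative_profile[OF w(1)] by blast
      then have "rep j w W" using w(2,3) by (simp add: rep_def)
      then show ?thesis by (intro exI)
    qed
    then obtain w W where rep: "\<And>j. j \<in> I \<Longrightarrow> rep j (w j) (W j)" by metis
    have W: "\<And>j. j \<in> I \<Longrightarrow> continuous_on {0..<1} (W j)"
      and wW: "\<And>j x. j \<in> I \<Longrightarrow> x \<in> B1 \<Longrightarrow> w j x = W j (norm x)"
      and wu: "\<And>j. j \<in> I \<Longrightarrow> AE x in lebesgue_on B1. w j x = u j x"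
      and alt: "\<And>j n. j \<in> I \<Longrightarrow> alternates (w j) n \<Longrightarrow> n \<le> P j"
      using rep unfolding rep_def by auto
    have uW: "AE x in lebesgue_on B1. u j x = W j (norm x)" if "j \<in> I" for j
      using wu[OF that] AE_space[of "lebesgue_on B1"]
      by eventually_elim (use wW[OF that] in simp)
    define Q where "Q = (\<lambda>j r. mu j * (W j r)\<^sup>2 + (\<Sum>i\<in>I - {j}. b i j * (W i r)\<^sup>2) - lam j)"
    have ode: "\<exists>v'. (\<forall>\<rho><1. continuous_on {0..\<rho>} v') \<and> (\<forall>r\<in>{0<..<1}.
        ((\<lambda>r. r * W j r) has_real_derivative v' r) (at r) \<and>
        (v' has_real_derivative - (Q j r * (r * W j r))) (at r))" if j: "j \<in> I" for j
    proof -
      define H where "H = (\<lambda>r. mu j * (W j r)^3 + (\<Sum>i\<in>I - {j}. b i j * (W i r)\<^sup>2 * W j r))"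
      define rhs where "rhs = (\<lambda>x. mu j * (u j x)^3 + (\<Sum>i\<in>I - {j}. b i j * (u i x)\<^sup>2 * u j x))"
      have mrhs: "rhs \<in> borel_measurable (lebesgue_on B1)"
        unfolding rhs_def
        by (intro borel_measurable_add borel_measurable_sum borel_measurable_times
            borel_measurable_power borel_measurable_const um) (use j in auto)
      have "AE x in lebesgue_on B1. \<forall>i\<in>I. u i x = W i (norm x)"
        by (rule AE_finite_allI[OF I(1)]) (rule uW)
      then have rhsH: "AE x in lebesgue_on B1. rhs x = H (norm x)"
        by eventually_elim (use j in \<open>simp add: rhs_def H_def\<close>)
      have cH: "continuous_on {0..<1} H"
        unfolding H_def by (intro continuous_intros W) (use j in auto)
      have eq: "lam j * (r * W j r) - r * H r = - (Q j r * (r * W j r))" for r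
      proof -
        have "(\<Sum>i\<in>I - {j}. b i j * (W i r)\<^sup>2 * W j r) = (\<Sum>i\<in>I - {j}. b i j * (W i r)\<^sup>2) * W j r"
          by (simp add: sum_distrib_right)
        then show ?thesis by (simp add: H_def Q_def algebra_simps power2_eq_square power3_eq_cube)
      qed
      have "(LINT x|lebesgue_on B1. weak_grad B1 (u j) x \<bullet> classical_grad \<phi> x + lam j * u j x * \<phi> x)
          = (LINT x|lebesgue_on B1. rhs x * \<phi> x)" if "test_function B1 \<phi>" for \<phi>
        using weak[OF j that] by (simp only: rhs_def)
      from radial_weak_solution_ode[where l = "lam j", OF uH1[OF j] uW[OF j] mrhs rhsH W[OF j] cH this]
      show ?thesis unfolding eq by simp
    qed
    have le: "\<bar>W j r\<bar> \<le> C" if "j \<in> I" "r \<in> {0..<1}" for j r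
    proof (rule ccontr)
      assume "\<not> \<bar>W j r\<bar> \<le> C"
      \<comment> \<open>The interval must contain \<open>r\<close> and have length at least 1/2, so that its rescaled length is large.\<close>
      define \<rho> where "\<rho> = max r (1/2)"
      have \<rho>: "\<rho> < 1" "1/2 \<le> \<rho>" "r \<in> {0..\<rho>}" using that by (auto simp: \<rho>_def)
      have sub: "{0..\<rho>} \<subseteq> {0..<1}" using \<rho> by auto
      have cW: "continuous_on {0..\<rho>} (W i)" if "i \<in> I" for i
        by (rule continuous_on_subset[OF W[OF that] sub])
      have "0 \<le> \<rho>" using \<rho> by simp
      have "\<exists>M. \<exists>j\<in>I. (\<exists>r\<in>{0..\<rho>}. \<bar>W j r\<bar> = M) \<and> (\<forall>i\<in>I. \<forall>r\<in>{0..\<rho>}. \<bar>W i r\<bar> \<le> M)"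
        by (rule joint_maximum[OF I(1,2) _ \<open>0 \<le> \<rho>\<close>]) (rule cW)
      then obtain M m where m: "m \<in> I" "\<exists>r\<in>{0..\<rho>}. \<bar>W m r\<bar> = M"
        and M': "\<forall>i\<in>I. \<forall>r\<in>{0..\<rho>}. \<bar>W i r\<bar> \<le> M"
        by (elim exE bexE conjE) (rule that; blast)
      note M = M'[rule_format]
      have MC: "C < M" using M[OF that(1) \<rho>(3)] \<open>\<not> \<bar>W j r\<bar> \<le> C\<close> by linarith
      have M1: "1 \<le> M" "R \<le> M" using MC C R by auto
      have M2: "M \<le> M\<^sup>2" "1 \<le> M\<^sup>2" using M1 by (auto simp: power2_eq_square mult_le_cancel_left1 intro: order_trans)
      have \<Lambda>M: "\<Lambda> \<le> \<delta> / 2 * M\<^sup>2"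
      proof -
        have "2 * \<Lambda> / \<delta> \<le> M\<^sup>2" using C(3) MC M2(1) by linarith
        then show ?thesis using \<delta> by (simp add: pos_divide_le_eq mult.commute)
      qed
      obtain v' where v': "\<forall>\<rho><1. continuous_on {0..\<rho>} v'"
        "\<forall>r\<in>{0<..<1}. ((\<lambda>r. r * W m r) has_real_derivative v' r) (at r) \<and>
          (v' has_real_derivative - (Q m r * (r * W m r))) (at r)"
        using ode[OF m(1)] by (elim exE conjE)
      have "((\<lambda>r. r * W m r) has_real_derivative v' s) (at s) \<and>
            (v' has_real_derivative - (Q m s * (s * W m s))) (at s) \<and>
            \<bar>Q m s\<bar> \<le> K * M\<^sup>2 \<and> \<mu>0 * (W m s)\<^sup>2 - \<delta> * M\<^sup>2 \<le> Q m s" if s: "s \<in> {0<..\<rho>}" for s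
      proof -
        have cb: "- (real N * \<epsilon>0 * M\<^sup>2) \<le> (\<Sum>i\<in>I - {m}. b i m * (W i s)\<^sup>2)"
          "\<bar>\<Sum>i\<in>I - {m}. b i m * (W i s)\<^sup>2\<bar> \<le> real N * (\<beta> + 1) * M\<^sup>2"
          by (rule coupling_bounds[where \<epsilon> = \<epsilon>0 and \<beta> = \<beta>];
              use I m b \<epsilon>0 assms(4) M s M1 in \<open>auto simp: card_Diff_singleton\<close>)+
        have Wm: "(W m s)\<^sup>2 \<le> M\<^sup>2" using M[OF m(1), of s] s M1 abs_le_square_iff[of "W m s" M] by simp
        have mum: "0 < mu m" "0 < lam m" using assms(2,3) m by (auto simp: I_def)
        have "\<bar>Q m s\<bar> \<le> K * M\<^sup>2"
        proof -
          have 1: "mu m * (W m s)\<^sup>2 \<le> sum mu I * M\<^sup>2" using summu[OF m(1)] Wm mum by (intro mult_mono) auto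
          have 2: "lam m \<le> \<Lambda> * M\<^sup>2"
          proof -
            have "\<Lambda> * 1 \<le> \<Lambda> * M\<^sup>2" using \<Lambda>(1) M2(2) by (rule mult_left_mono[rotated])
            then show ?thesis using \<Lambda>(2)[OF m(1)] by simp
          qed
          have 3: "0 \<le> mu m * (W m s)\<^sup>2" using mum by simp
          have "K * M\<^sup>2 = sum mu I * M\<^sup>2 + real N * (\<beta> + 1) * M\<^sup>2 + \<Lambda> * M\<^sup>2"
            by (simp add: K_def algebra_simps)
          moreover have "0 \<le> sum mu I * M\<^sup>2" "0 \<le> \<Lambda> * M\<^sup>2" using 1 2 3 mum by linarith+
          ultimately show ?thesis using 1 2 3 cb(2) mum unfolding Q_def abs_le_iff by linarith
        qed
        moreover have "\<mu>0 * (W m s)\<^sup>2 - \<delta> * M\<^sup>2 \<le> Q m s"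
        proof -
          have "\<mu>0 * (W m s)\<^sup>2 \<le> mu m * (W m s)\<^sup>2" using \<mu>0(2)[OF m(1)] by (intro mult_right_mono) auto
          moreover have "real N * \<epsilon>0 * M\<^sup>2 \<le> \<delta> / 2 * M\<^sup>2" using \<epsilon>0(3) by (intro mult_right_mono) auto
          moreover have "\<delta> * M\<^sup>2 = \<delta> / 2 * M\<^sup>2 + \<delta> / 2 * M\<^sup>2" by simp
          ultimately show ?thesis using cb(1) \<Lambda>M \<Lambda>(2)[OF m(1)] unfolding Q_def by linarith
        qed
        moreover have "s \<in> {0<..<1}" using s \<rho> by auto
        ultimately show ?thesis using v'(2) by simp
      qed
      then have "large_profile \<mu>0 K \<delta> M \<rho> (W m) v' (Q m)"
        unfolding large_profile_def using cW[OF m(1)] v'(1) \<rho>(1) M[OF m(1)] m(2) by blast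
      then have "oscillates (W m) k \<rho>" by (rule osc[OF M1(2) \<rho>(2)])
      then have "alternates (w m) k"
        by (rule oscillates_imp_alternates[OF _ _ \<rho>(1), rotated]) (rule wW[OF m(1)])
      from alt[OF m(1) this] Pk[OF m(1)] show False by simp
    qed
    show ?thesis unfolding Linf_norm_def
    proof (rule esssup_I)
      show "(\<lambda>x. ereal \<bar>u j x\<bar>) \<in> borel_measurable (lebesgue_on B1)"
        by (intro borel_measurable_ereal borel_measurable_abs um jI)
      show "AE x in lebesgue_on B1. ereal \<bar>u j x\<bar> \<le> ereal C"
        using uW[OF jI] AE_space[of "lebesgue_on B1"]
        by eventually_elim (use le[OF jI] in simp)
    qed
  qed
  show ?thesis
  proof (rule exI[of _ \<epsilon>0], intro conjI \<epsilon>0(1), rule exI[of _ C], intro conjI C(1) allI impI)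
    fix b :: "nat \<Rightarrow> nat \<Rightarrow> real" and u :: "nat \<Rightarrow> real^3 \<Rightarrow> real"
    assume b: "\<forall>i\<in>{1..N}. \<forall>j\<in>{1..N}. i \<noteq> j \<longrightarrow> b i j = b j i \<and> b i j \<in> {-\<epsilon>0..\<beta>}"
      and u: "weak_solution N lam mu b u \<and> (\<forall>j\<in>{1..N}. changes_sign_exactly (u j) (P j))"
    have "Linf_norm (u j) \<le> ereal C" if "j \<in> I" for j
      by (rule bound[of b u j]) (use b u that in \<open>simp_all add: I_def\<close>)
    then show "(MAX j\<in>{1..N}. Linf_norm (u j)) \<le> ereal C"
      using I by (simp add: I_def)
  qed
qed

end
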